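(* Let $(M,\circ,e)$ be a massive F-manifold with Euler field $E$ of weight $1$, generating function $F=\mathbf a(E)$ on its analytic spectrum $L$, and discriminant $\mathcal D=(\det(E\circ))^{-1}(0)=\pi(F^{-1}(0))$. a) The discriminant is a free divisor with $\mathrm{Der}_M(\log\mathcal D)=E\circ\mathcal T_M$. b) The kernel of the map $$\mathbf a_{\mathcal D}:\mathcal T_M\to\pi_*\mathcal O_{F^{-1}(0)},\quad X\mapsto\mathbf a(X)|_{F^{-1}(0)}$$ is $\ker\mathbf a_{\mathcal D}=E\circ\mathcal T_M=\mathrm{Der}_M(\log\mathcal D)$.
   Context: An F-manifold is a triple $(M,\circ,e)$ with $M$ a connected complex manifold of dimension $n\ge1$, $\circ$ a commutative, associative $\mathcal O_M$-bilinear multiplication on the tangent sheaf $\mathcal T_M$, and $e$ a global unit field, such that $\mathrm{Lie}_{X\circ Y}(\circ)=X\circ \mathrm{Lie}_Y(\circ)+Y\circ\mathrm{Lie}_X(\circ)$ for all local vector fields $X,Y$, where $\mathrm{Lie}_X(\circ)(Z,W)=[X,Z\circ W]-[X,Z]\circ W-Z\circ[X,W]$. An Euler field of weight $1$ is a vector field $E$ with $\mathrm{Lie}_E(\circ)=\circ$. The F-manifold is massive if $T_pM$ is a semisimple algebra for generic $p$. The analytic spectrum $L\subset T^*M$ is the set of all unital algebra homomorphisms $T_pM\to\mathbb C$, $p\in M$, with complex structure locally given by the ideal generated by $y_1-1$ and $y_iy_j-\sum_ka_{ij}^ky_k$, where $\delta_1=e,\dots,\delta_n$ is a local basis of $\mathcal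 T_M$, $\delta_i\circ\delta_j=\sum_ka_{ij}^k\delta_k$, and $y_i$ is the fiberwise linear function on $T^*M$ given by $\delta_i$. $\pi:L\to M$ is the projection, $\alpha$ the canonical 1-form on $T^*M$, and $\mathbf a:\mathcal T_M\to\pi_*\mathcal O_L$, $X\mapsto\alpha(\widetilde X)|_L$ ($\widetilde X$ any lift of $X$), is an isomorphism of $\mathcal O_M$-algebras. The values of $\mathbf a(X)$ on $\pi^{-1}(p)$ are the eigenvalues of $X\circ$ on $T_pM$. For a reduced hypersurface $H\subset M$, $\mathrm{Der}_M(\log H)\subset\mathcal T_M$ is the sheaf of holomorphic vector fields tangent to $H_{reg}$; $H$ is a free divisor if $\mathrm{Der}_M(\log H)$ is a free $\mathcal O_M$-module of rank $n=\dim M$. The discriminant $\mathcal D$ is taken as a reduced hypersurface. *)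

theory Defs
  imports "HOL-Analysis.Analysis"
begin

section \<open>Complex manifolds\<close>

text \<open>Holomorphic functions of several variables: complex Frechet differentiability on an
  open set. Maps into a power of the complex numbers are treated componentwise.\<close>

definition mholomorphic_on :: "(complex^'k \<Rightarrow> complex) \<Rightarrow> (complex^'k) set \<Rightarrow> bool" where
  "mholomorphic_on f S \<longleftrightarrow> open S \<and>
     (\<forall>z\<in>S. \<exists>D. (f has_derivative D) (at z) \<and> Vector_Spaces.linear (*s) (*) D)"

text \<open>A chart is a pair of its domain and its coordinate map. A manifold is given by an atlas;
  its points are the union of the chart domains and its topology is the one induced by the
  charts (the unique one making all charts homeomorphisms onto open sets).\<close>

type_synonym ('a, 'k) chart = "'a set \<times> ('a \<Rightarrow> complex^'k)"

definition chart_inv :: "('a, 'k::finite) chart \<Rightarrow> complex^'k \<Rightarrow> 'a" where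
  "chart_inv c = inv_into (fst c) (snd c)"

definition carr :: "('a, 'k::finite) chart set \<Rightarrow> 'a set" where
  "carr A = (\<Union>c\<in>A. fst c)"

definition atlas_topology :: "('a, 'k::finite) chart set \<Rightarrow> 'a topology" where
  "atlas_topology A = topology (\<lambda>W. W \<subseteq> carr A \<and>
     (\<forall>c\<in>A. open {z \<in> snd c ` fst c. chart_inv c z \<in> W}))"

definition complex_atlas :: "('a, 'k::finite) chart set \<Rightarrow> bool" where
  "complex_atlas A \<longleftrightarrow>
     (\<forall>c\<in>A. inj_on (snd c) (fst c) \<and> open (snd c ` fst c)) \<and>
     (\<forall>c\<in>A. \<forall>d\<in>A. \<forall>i.
        mholomorphic_on (\<lambda>z. snd d (chart_inv c z) $ i) (snd c ` (fst c \<inter> fst d)))"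

definition connected_complex_manifold :: "('a, 'k::finite) chart set \<Rightarrow> bool" where
  "connected_complex_manifold A \<longleftrightarrow>
     complex_atlas A \<and> carr A \<noteq> {} \<and> connected_space (atlas_topology A) \<and>
     Hausdorff_space (atlas_topology A) \<and> second_countable (atlas_topology A)"

lemma openin_atlas_topology:
  fixes A :: "('a, 'k::finite) chart set"
  assumes "complex_atlas A"
  shows "openin (atlas_topology A) W \<longleftrightarrow> W \<subseteq> carr A \<and> (\<forall>c\<in>A. open (snd c ` (W \<inter> fst c)))"
proof -
  define P where "P = (\<lambda>W. W \<subseteq> carr A \<and>
    (\<forall>c\<in>A. open {z \<in> snd c ` fst c. chart_inv c z \<in> W}))"
  have "istopology P"
    unfolding istopology_def
  proof (intro conjI allI impI)
    fix S T assume "P S" "P T"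
    moreover have "{z \<in> snd c ` fst c. chart_inv c z \<in> S \<inter> T}
      = {z \<in> snd c ` fst c. chart_inv c z \<in> S} \<inter> {z \<in> snd c ` fst c. chart_inv c z \<in> T}"
      for c :: "('a, 'k) chart" by auto
    ultimately show "P (S \<inter> T)" unfolding P_def by auto
  next
    fix K assume K: "\<forall>S\<in>K. P S"
    have "{z \<in> snd c ` fst c. chart_inv c z \<in> \<Union>K}
      = (\<Union>S\<in>K. {z \<in> snd c ` fst c. chart_inv c z \<in> S})" for c :: "('a, 'k) chart" by auto
    then show "P (\<Union>K)" using K unfolding P_def by (auto intro!: open_Union)
  qed
  then have "openin (atlas_topology A) = P"
    by (simp add: atlas_topology_def P_def topology_inverse')
  moreover have "{z \<in> snd c ` fst c. chart_inv c z \<in> W} = snd c ` (W \<inter> fst c)" if "c \<in> A" for c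
  proof -
    have "inj_on (snd c) (fst c)" using assms that by (auto simp: complex_atlas_def)
    then show ?thesis by (auto simp: chart_inv_def)
  qed
  ultimately show ?thesis by (simp add: P_def)
qed

definition holomorphic_functions :: "('a, 'k::finite) chart set \<Rightarrow> 'a set \<Rightarrow> ('a \<Rightarrow> complex) set" where
  "holomorphic_functions A U = {f. openin (atlas_topology A) U \<and>
     (\<forall>c\<in>A. mholomorphic_on (\<lambda>z. f (chart_inv c z)) (snd c ` (U \<inter> fst c)))}"


section \<open>Vector fields\<close>

text \<open>The tangent space at \<open>p\<close> is identified with the coordinate space by means of one chosen
  chart \<open>chart_at A p\<close>. A tangent vector \<open>v\<close> at \<open>p\<close> then has in any other chart \<open>c\<close> around \<open>p\<close>
  the coordinates \<open>coords A c p v\<close>, obtained from the derivative of the coordinate change.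
  A vector field is a function giving at each point the tangent vector there; for a section
  over \<open>U\<close> only the values on \<open>U\<close> matter.\<close>

definition chart_at :: "('a, 'k::finite) chart set \<Rightarrow> 'a \<Rightarrow> ('a, 'k::finite) chart" where
  "chart_at A p = (SOME c. c \<in> A \<and> p \<in> fst c)"

definition coords ::
  "('a, 'k::finite) chart set \<Rightarrow> ('a, 'k::finite) chart \<Rightarrow> 'a \<Rightarrow> complex^'k \<Rightarrow> complex^'k" where
  "coords A c p v =
     frechet_derivative (\<lambda>z. snd c (chart_inv (chart_at A p) z)) (at (snd (chart_at A p) p)) v"

text \<open>The coordinate vector field of chart \<open>c\<close> in direction \<open>i\<close>, at \<open>p\<close>.\<close>

definition coord_vector ::
  "('a, 'k::finite) chart set \<Rightarrow> ('a, 'k::finite) chart \<Rightarrow> 'k \<Rightarrow> 'a \<Rightarrow> complex^'k" where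
  "coord_vector A c i p =
     frechet_derivative (\<lambda>z. snd (chart_at A p) (chart_inv c z)) (at (snd c p)) (axis i 1)"

definition field_in_chart ::
  "('a, 'k::finite) chart set \<Rightarrow> ('a, 'k::finite) chart \<Rightarrow> ('a \<Rightarrow> complex^'k) \<Rightarrow> complex^'k \<Rightarrow> complex^'k" where
  "field_in_chart A c X z = coords A c (chart_inv c z) (X (chart_inv c z))"

text \<open>The tangent sheaf.\<close>

definition vector_fields :: "('a, 'k::finite) chart set \<Rightarrow> 'a set \<Rightarrow> ('a \<Rightarrow> complex^'k) set" where
  "vector_fields A U = {X. openin (atlas_topology A) U \<and>
     (\<forall>c\<in>A. \<forall>i. mholomorphic_on (\<lambda>z. field_in_chart A c X z $ i) (snd c ` (U \<inter> fst c)))}"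

definition lie_bracket ::
  "('a, 'k::finite) chart set \<Rightarrow> ('a \<Rightarrow> complex^'k) \<Rightarrow> ('a \<Rightarrow> complex^'k) \<Rightarrow> 'a \<Rightarrow> complex^'k" where
  "lie_bracket A X Y p = (let c = chart_at A p; z = snd c p in
     frechet_derivative (field_in_chart A c Y) (at z) (X p)
     - frechet_derivative (field_in_chart A c X) (at z) (Y p))"

text \<open>The differential of a function at \<open>p\<close>, applied to a tangent vector at \<open>p\<close>.\<close>

definition differential ::
  "('a, 'k::finite) chart set \<Rightarrow> ('a \<Rightarrow> complex) \<Rightarrow> 'a \<Rightarrow> complex^'k \<Rightarrow> complex" where
  "differential A f p v =
     frechet_derivative (\<lambda>z. f (chart_inv (chart_at A p) z)) (at (snd (chart_at A p) p)) v"

text \<open>For a sheaf \<open>S\<close> of modules of vector fields: the fields \<open>\<delta> i \<in> S U\<close> form a basis of the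
  restriction of \<open>S\<close> to \<open>U\<close>. The rank is the number of indices, which is the dimension of the
  manifold.\<close>

definition sheaf_basis ::
  "('a, 'k::finite) chart set \<Rightarrow> ('a set \<Rightarrow> ('a \<Rightarrow> complex^'k) set) \<Rightarrow> 'a set
    \<Rightarrow> ('k \<Rightarrow> 'a \<Rightarrow> complex^'k) \<Rightarrow> bool" where
  "sheaf_basis A S U \<delta> \<longleftrightarrow> openin (atlas_topology A) U \<and> (\<forall>i. \<delta> i \<in> S U) \<and>
     (\<forall>V. openin (atlas_topology A) V \<and> V \<subseteq> U \<longrightarrow>
        (\<forall>X\<in>S V. \<exists>f. (\<forall>i. f i \<in> holomorphic_functions A V) \<and>
           (\<forall>p\<in>V. X p = (\<Sum>i\<in>UNIV. f i p *s \<delta> i p))) \<and>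
        (\<forall>f. (\<forall>i. f i \<in> holomorphic_functions A V) \<and>
           (\<forall>p\<in>V. (\<Sum>i\<in>UNIV. f i p *s \<delta> i p) = 0) \<longrightarrow> (\<forall>i. \<forall>p\<in>V. f i p = 0)))"

text \<open>A sheaf is free of rank \<open>n\<close> in the sense usual for sheaves of modules: locally it has
  a basis with \<open>n\<close> elements.\<close>

definition locally_free_full_rank ::
  "('a, 'k::finite) chart set \<Rightarrow> ('a set \<Rightarrow> ('a \<Rightarrow> complex^'k) set) \<Rightarrow> bool" where
  "locally_free_full_rank A S \<longleftrightarrow> (\<forall>p\<in>carr A. \<exists>U \<delta>. p \<in> U \<and> sheaf_basis A S U \<delta>)"


section \<open>Hypersurfaces and logarithmic vector fields\<close>

definition analytic_subset :: "('a, 'k::finite) chart set \<Rightarrow> 'a set \<Rightarrow> bool" where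
  "analytic_subset A K \<longleftrightarrow> K \<subseteq> carr A \<and>
     (\<forall>p\<in>carr A. \<exists>U G. openin (atlas_topology A) U \<and> p \<in> U \<and>
        finite G \<and> G \<subseteq> holomorphic_functions A U \<and> K \<inter> U = {q \<in> U. \<forall>g\<in>G. g q = 0})"

definition nowhere_dense_in :: "'a topology \<Rightarrow> 'a set \<Rightarrow> bool" where
  "nowhere_dense_in T K \<longleftrightarrow> T interior_of (T closure_of K) = {}"

text \<open>Reduced hypersurfaces are identified with their sets of points. The empty set counts as
  a hypersurface.\<close>

definition hypersurface :: "('a, 'k::finite) chart set \<Rightarrow> 'a set \<Rightarrow> bool" where
  "hypersurface A H \<longleftrightarrow> H \<subseteq> carr A \<and> nowhere_dense_in (atlas_topology A) H \<and>
     (\<forall>p\<in>carr A. \<exists>U. p \<in> U \<and>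
        (\<exists>g \<in> holomorphic_functions A U. H \<inter> U = {q \<in> U. g q = 0}))"

text \<open>\<open>H\<close> is near \<open>p\<close> the smooth hypersurface defined by \<open>g\<close>, whose tangent space at \<open>p\<close> is
  then the kernel of the differential of \<open>g\<close>.\<close>

definition regular_equation ::
  "('a, 'k::finite) chart set \<Rightarrow> 'a set \<Rightarrow> 'a \<Rightarrow> 'a set \<Rightarrow> ('a \<Rightarrow> complex) \<Rightarrow> bool" where
  "regular_equation A H p V g \<longleftrightarrow> p \<in> V \<and> p \<in> H \<and> g \<in> holomorphic_functions A V \<and>
     H \<inter> V = {q \<in> V. g q = 0} \<and> (\<exists>v. differential A g p v \<noteq> 0)"

definition regular_part :: "('a, 'k::finite) chart set \<Rightarrow> 'a set \<Rightarrow> 'a set" where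
  "regular_part A H = {p. \<exists>V g. regular_equation A H p V g}"

definition tangent_space_at :: "('a, 'k::finite) chart set \<Rightarrow> 'a set \<Rightarrow> 'a \<Rightarrow> (complex^'k) set" where
  "tangent_space_at A H p =
     {v. \<forall>V g. regular_equation A H p V g \<longrightarrow> differential A g p v = 0}"

definition log_vector_fields ::
  "('a, 'k::finite) chart set \<Rightarrow> 'a set \<Rightarrow> 'a set \<Rightarrow> ('a \<Rightarrow> complex^'k) set" where
  "log_vector_fields A H U =
     {X \<in> vector_fields A U. \<forall>p \<in> regular_part A H \<inter> U. X p \<in> tangent_space_at A H p}"

definition free_divisor :: "('a, 'k::finite) chart set \<Rightarrow> 'a set \<Rightarrow> bool" where
  "free_divisor A H \<longleftrightarrow>
     hypersurface A H \<and> locally_free_full_rank A (log_vector_fields A H)"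


section \<open>F-manifolds\<close>

text \<open>A multiplication is given by the algebra structures \<open>m p\<close> on the tangent spaces.\<close>

definition field_mult ::
  "('a \<Rightarrow> complex^'n \<Rightarrow> complex^'n \<Rightarrow> complex^'n)
    \<Rightarrow> ('a \<Rightarrow> complex^'n) \<Rightarrow> ('a \<Rightarrow> complex^'n) \<Rightarrow> 'a \<Rightarrow> complex^'n" where
  "field_mult m X Y p = m p (X p) (Y p)"

definition lie_mult ::
  "('a, 'n::finite) chart set \<Rightarrow> ('a \<Rightarrow> complex^'n \<Rightarrow> complex^'n \<Rightarrow> complex^'n) \<Rightarrow> ('a \<Rightarrow> complex^'n)
    \<Rightarrow> ('a \<Rightarrow> complex^'n) \<Rightarrow> ('a \<Rightarrow> complex^'n) \<Rightarrow> 'a \<Rightarrow> complex^'n" where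
  "lie_mult A m X Z W p =
     lie_bracket A X (field_mult m Z W) p
     - field_mult m (lie_bracket A X Z) W p - field_mult m Z (lie_bracket A X W) p"

definition F_manifold ::
  "('a, 'n::finite) chart set \<Rightarrow> ('a \<Rightarrow> complex^'n \<Rightarrow> complex^'n \<Rightarrow> complex^'n) \<Rightarrow> ('a \<Rightarrow> complex^'n)
    \<Rightarrow> bool" where
  "F_manifold A m e \<longleftrightarrow> connected_complex_manifold A \<and>
     (\<forall>p\<in>carr A.
        (\<forall>u. Vector_Spaces.linear (*s) (*s) (m p u)) \<and>
        (\<forall>u v. m p u v = m p v u) \<and>
        (\<forall>u v w. m p (m p u v) w = m p u (m p v w)) \<and>
        (\<forall>v. m p (e p) v = v)) \<and>
     (\<forall>U. \<forall>X\<in>vector_fields A U. \<forall>Y\<in>vector_fields A U. field_mult m X Y \<in> vector_fields A U) \<and>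
     e \<in> vector_fields A (carr A) \<and>
     (\<forall>U. \<forall>X\<in>vector_fields A U. \<forall>Y\<in>vector_fields A U.
        \<forall>Z\<in>vector_fields A U. \<forall>W\<in>vector_fields A U. \<forall>p\<in>U.
          lie_mult A m (field_mult m X Y) Z W p
          = m p (X p) (lie_mult A m Y Z W p) + m p (Y p) (lie_mult A m X Z W p))"

definition euler_field_weight1 ::
  "('a, 'n::finite) chart set \<Rightarrow> ('a \<Rightarrow> complex^'n \<Rightarrow> complex^'n \<Rightarrow> complex^'n) \<Rightarrow> ('a \<Rightarrow> complex^'n)
    \<Rightarrow> bool" where
  "euler_field_weight1 A m E \<longleftrightarrow> E \<in> vector_fields A (carr A) \<and>
     (\<forall>U. \<forall>Z\<in>vector_fields A U. \<forall>W\<in>vector_fields A U. \<forall>p\<in>U.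
        lie_mult A m E Z W p = field_mult m Z W p)"

text \<open>A (commutative, unital) algebra is semisimple if it is semisimple as a module over itself:
  every ideal has a complementary ideal.\<close>

definition algebra_ideal ::
  "(complex^'n \<Rightarrow> complex^'n \<Rightarrow> complex^'n) \<Rightarrow> (complex^'n) set \<Rightarrow> bool" where
  "algebra_ideal mu I \<longleftrightarrow> vec.subspace I \<and> (\<forall>u. \<forall>v\<in>I. mu u v \<in> I)"

definition semisimple_algebra :: "(complex^'n \<Rightarrow> complex^'n \<Rightarrow> complex^'n) \<Rightarrow> bool" where
  "semisimple_algebra mu \<longleftrightarrow> (\<forall>I. algebra_ideal mu I \<longrightarrow>
     (\<exists>J. algebra_ideal mu J \<and> I \<inter> J = {0} \<and> {u + v | u v. u \<in> I \<and> v \<in> J} = UNIV))"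

text \<open>``Generic'' means: outside some nowhere dense analytic subset.\<close>

definition massive ::
  "('a, 'n::finite) chart set \<Rightarrow> ('a \<Rightarrow> complex^'n \<Rightarrow> complex^'n \<Rightarrow> complex^'n) \<Rightarrow> bool" where
  "massive A m \<longleftrightarrow> (\<exists>K. analytic_subset A K \<and> nowhere_dense_in (atlas_topology A) K \<and>
     (\<forall>p \<in> carr A - K. semisimple_algebra (m p)))"


section \<open>The analytic spectrum\<close>

text \<open>Points of the cotangent bundle are pairs of a point of the manifold and a linear form on
  the tangent space there. In the chart induced by a chart \<open>c\<close> they have as coordinates those of
  the base point and the values of the form on the coordinate vector fields of \<open>c\<close>.\<close>

type_synonym ('a, 'n) covector = "'a \<times> (complex^'n \<Rightarrow> complex)"

definition cotangent_chart ::
  "('a, 'n::finite) chart set \<Rightarrow> ('a, 'n::finite) chart \<Rightarrow> (('a, 'n::finite) covector, 'n + 'n) chart" where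
  "cotangent_chart A c =
     ({(p, \<xi>). p \<in> fst c \<and> Vector_Spaces.linear (*s) (*) \<xi>},
      \<lambda>(p, \<xi>). \<chi> k. case k of Inl i \<Rightarrow> snd c p $ i | Inr i \<Rightarrow> \<xi> (coord_vector A c i p))"

definition cotangent_atlas ::
  "('a, 'n::finite) chart set \<Rightarrow> (('a, 'n::finite) covector, 'n + 'n) chart set" where
  "cotangent_atlas A = cotangent_chart A ` A"

text \<open>The set of points of the analytic spectrum.\<close>

definition analytic_spectrum ::
  "('a, 'n::finite) chart set \<Rightarrow> ('a \<Rightarrow> complex^'n \<Rightarrow> complex^'n \<Rightarrow> complex^'n) \<Rightarrow> ('a \<Rightarrow> complex^'n)
    \<Rightarrow> ('a, 'n::finite) covector set" where
  "analytic_spectrum A m e = {(p, \<xi>). p \<in> carr A \<and> Vector_Spaces.linear (*s) (*) \<xi> \<and>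
     \<xi> (e p) = 1 \<and> (\<forall>u v. \<xi> (m p u v) = \<xi> u * \<xi> v)}"

text \<open>The canonical 1-form at \<open>(p, \<xi>)\<close> sends a tangent vector of the cotangent bundle to the value
  of \<open>\<xi>\<close> on its projection to the tangent space at \<open>p\<close>. On any lift of the vector field \<open>X\<close> it
  therefore takes the value \<open>\<xi> (X p)\<close>: it is the fibrewise linear function given by \<open>X\<close>, and it
  represents the section \<open>a(X)\<close> of the structure sheaf of the spectrum. In particular
  \<open>fibre_linear E\<close> represents the generating function \<open>F = a(E)\<close>.\<close>

definition fibre_linear :: "('a \<Rightarrow> complex^'n) \<Rightarrow> ('a, 'n::finite) covector \<Rightarrow> complex" where
  "fibre_linear X = (\<lambda>(p, \<xi>). \<xi> (X p))"

text \<open>The stalk at \<open>q\<close> of the ideal sheaf defining the complex structure of the spectrum, as a set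
  of functions on the cotangent bundle that represent germs at \<open>q\<close>. If
  \<open>\<delta> i \<circ> \<delta> j\<close> is the sum of the \<open>a i j k \<delta> k\<close>, then \<open>fibre_linear (\<delta> i \<circ> \<delta> j)\<close>
  is the sum of the \<open>a i j k y k\<close>.\<close>

definition spectrum_ideal ::
  "('a, 'n::finite) chart set \<Rightarrow> ('a \<Rightarrow> complex^'n \<Rightarrow> complex^'n \<Rightarrow> complex^'n) \<Rightarrow> ('a \<Rightarrow> complex^'n)
    \<Rightarrow> ('a, 'n::finite) covector \<Rightarrow> (('a, 'n::finite) covector \<Rightarrow> complex) set" where
  "spectrum_ideal A m e q = {f. \<exists>U \<delta> i0 W h0 h.
     sheaf_basis A (vector_fields A) U \<delta> \<and> \<delta> i0 = e \<and> q \<in> W \<and> fst ` W \<subseteq> U \<and>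
     h0 \<in> holomorphic_functions (cotangent_atlas A) W \<and>
     (\<forall>i j. h i j \<in> holomorphic_functions (cotangent_atlas A) W) \<and>
     (\<forall>w\<in>W. f w = h0 w * (fibre_linear (\<delta> i0) w - 1) +
        (\<Sum>i\<in>UNIV. \<Sum>j\<in>UNIV. h i j w * (fibre_linear (\<delta> i) w * fibre_linear (\<delta> j) w
           - fibre_linear (field_mult m (\<delta> i) (\<delta> j)) w)))}"

text \<open>The points of the zero fibre of \<open>F\<close> and, with the complex structure of a fibre, its ideal:
  the structure sheaf of the zero fibre is that of the spectrum modulo \<open>F\<close>.\<close>

definition zero_fibre ::
  "('a, 'n::finite) chart set \<Rightarrow> ('a \<Rightarrow> complex^'n \<Rightarrow> complex^'n \<Rightarrow> complex^'n) \<Rightarrow> ('a \<Rightarrow> complex^'n)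
    \<Rightarrow> ('a \<Rightarrow> complex^'n) \<Rightarrow> ('a, 'n::finite) covector set" where
  "zero_fibre A m e E = {q \<in> analytic_spectrum A m e. fibre_linear E q = 0}"

definition zero_fibre_ideal ::
  "('a, 'n::finite) chart set \<Rightarrow> ('a \<Rightarrow> complex^'n \<Rightarrow> complex^'n \<Rightarrow> complex^'n) \<Rightarrow> ('a \<Rightarrow> complex^'n)
    \<Rightarrow> ('a \<Rightarrow> complex^'n) \<Rightarrow> ('a, 'n::finite) covector \<Rightarrow> (('a, 'n::finite) covector \<Rightarrow> complex) set" where
  "zero_fibre_ideal A m e E q = {f. \<exists>W. \<exists>g \<in> holomorphic_functions (cotangent_atlas A) W.
     \<exists>h \<in> spectrum_ideal A m e q. q \<in> W \<and> (\<forall>w\<in>W. f w = g w * fibre_linear E w + h w)}"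

text \<open>The kernel sheaf of \<open>X \<mapsto> a(X)\<close> restricted to the zero fibre of \<open>F\<close>. A section over \<open>U\<close> of the
  direct image of the structure sheaf of the zero fibre vanishes iff its germs at all points of
  the zero fibre over \<open>U\<close> do.\<close>

definition kernel_aD ::
  "('a, 'n::finite) chart set \<Rightarrow> ('a \<Rightarrow> complex^'n \<Rightarrow> complex^'n \<Rightarrow> complex^'n) \<Rightarrow> ('a \<Rightarrow> complex^'n)
    \<Rightarrow> ('a \<Rightarrow> complex^'n) \<Rightarrow> 'a set \<Rightarrow> ('a \<Rightarrow> complex^'n) set" where
  "kernel_aD A m e E U = {X \<in> vector_fields A U.
     \<forall>q \<in> zero_fibre A m e E. fst q \<in> U \<longrightarrow> fibre_linear X \<in> zero_fibre_ideal A m e E q}"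

definition discriminant ::
  "('a, 'n::finite) chart set \<Rightarrow> ('a \<Rightarrow> complex^'n \<Rightarrow> complex^'n \<Rightarrow> complex^'n) \<Rightarrow> ('a \<Rightarrow> complex^'n)
    \<Rightarrow> 'a set" where
  "discriminant A m E = {p \<in> carr A. det (matrix (m p (E p))) = 0}"

text \<open>The image sheaf of multiplication by \<open>E\<close>: its sections are locally of the form \<open>E \<circ> Y\<close>.\<close>

definition E_times_fields ::
  "('a, 'n::finite) chart set \<Rightarrow> ('a \<Rightarrow> complex^'n \<Rightarrow> complex^'n \<Rightarrow> complex^'n) \<Rightarrow> ('a \<Rightarrow> complex^'n)
    \<Rightarrow> 'a set \<Rightarrow> ('a \<Rightarrow> complex^'n) set" where
  "E_times_fields A m E U = {X \<in> vector_fields A U.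
     \<forall>p\<in>U. \<exists>V \<subseteq> U. p \<in> V \<and> (\<exists>Y \<in> vector_fields A V. \<forall>q\<in>V. X q = field_mult m E Y q)}"

end

theory Submission
  imports Defs "HOL-Complex_Analysis.Residue_Theorem"
    "HOL-Computational_Algebra.Fundamental_Theorem_Algebra"
begin

text \<open>At a semisimple point the eigenvalues of the Euler field are local coordinates adapted to the
  idempotents, so the differential of \<open>h = det (E \<circ>)\<close> at a vector \<open>X\<close> is the derivative of the
  determinant at \<open>E \<circ>\<close> in the direction \<open>X \<circ>\<close>; by continuity this holds everywhere. Hence, where
  \<open>0\<close> is a simple eigenvalue of \<open>E \<circ>\<close>, the discriminant is smooth and both being tangent to it and
  being in the kernel mean lying in the image of \<open>E \<circ>\<close>. The point is that this suffices to divide: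
  a holomorphic \<open>G\<close> that vanishes where \<open>0\<close> is a simple eigenvalue (a reduced equation of the
  discriminant, or a component of the solution of \<open>E \<circ> Y = X\<close> multiplied by \<open>h\<close> in Cramer's rule)
  is a multiple of \<open>h\<close>. Indeed, along the integral curve of the unit field through \<open>z\<close>, in complex
  time \<open>s\<close>, the function \<open>h\<close> is the characteristic polynomial \<open>det (E \<circ> + s)\<close> at \<open>z\<close>. If its
  roots are simple, \<open>G / h\<close> is holomorphic along the curve, and the maximum principle bounds it
  locally uniformly on the dense set of such \<open>z\<close>. Riemann's extension theorem does the rest.\<close>

text \<open>The division property replaces the local theory of hypersurfaces: no irreducible
  components, no Nullstellensatz and no extension across codimension two occur. Whether
  \<open>h\<close> is a reduced equation, and whether the points with \<open>0\<close> a simple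
  eigenvalue are dense in the discriminant, is never asked directly. A local equation
  \<open>g\<close> of the discriminant is simply \<open>h * k\<close>, so on the discriminant dg = k
  dh. The unit field enters because \<open>e \<circ>\<close> is the identity: the formula for the
  differential, in the direction \<open>e\<close>, says that differentiating
  \<open>det (E \<circ> + s)\<close> along \<open>e\<close> is the same as differentiating it in
  \<open>s\<close>. At the given point the eigenvalues may collide. The bound is therefore taken on
  a circle avoiding all roots there, and proved at nearby points with simple spectrum. These are
  dense since at a semisimple point the eigenvalues are local coordinates and can be moved apart
  independently. The inclusion of the multiples of \<open>E\<close> in the kernel is of another
  nature: it has to hold in the ideal defining the complex structure of the spectrum, and comes from
  an explicit combination of the generators.\<close>

lemma linear_form_iff:
  fixes D :: "complex^'k \<Rightarrow> complex"
  shows "Vector_Spaces.linear (*s) (*) D \<longleftrightarrow>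
    (\<forall>x y. D (x + y) = D x + D y) \<and> (\<forall>c x. D (c *s x) = c * D x)"
proof -
  have "vector_space ((*) :: complex \<Rightarrow> complex \<Rightarrow> complex)"
    by unfold_locales (auto simp: algebra_simps)
  then show ?thesis
    unfolding Vector_Spaces.linear_iff
    using vec.vector_space_axioms by blast
qed

lemma vlinear_iff:
  fixes D :: "complex^'k \<Rightarrow> complex^'m"
  shows "Vector_Spaces.linear (*s) (*s) D \<longleftrightarrow>
    (\<forall>x y. D (x + y) = D x + D y) \<and> (\<forall>c x. D (c *s x) = c *s D x)"
  unfolding Vector_Spaces.linear_iff by (auto intro: vec.vector_space_axioms)

lemma vlinear_componentwise:
  fixes D :: "complex^'k \<Rightarrow> complex^'m"
  shows "Vector_Spaces.linear (*s) (*s) D \<longleftrightarrow> (\<forall>i. Vector_Spaces.linear (*s) (*) (\<lambda>v. D v $ i))"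
  unfolding vlinear_iff linear_form_iff by (auto simp: vec_eq_iff)

lemma scaleR_eq_vector_smult: "a *\<^sub>R (v :: complex^'k) = complex_of_real a *s v"
  by (simp add: vec_eq_iff scaleR_conv_of_real[where 'a = complex])

lemma norm_vector_smult: "norm (c *s (v :: complex^'k)) = cmod c * norm v"
  by (simp add: norm_vec_def L2_set_right_distrib norm_mult)

lemma bounded_linear_vector_smult: "bounded_linear (\<lambda>c. c *s (v :: complex^'k))"
  by (rule bounded_linear_intro[where K = "norm v"])
    (auto simp: norm_vector_smult vector_sadd_rdistrib scaleR_eq_vector_smult scaleR_conv_of_real)

lemma linear_form_bounded_linear:
  fixes D :: "complex^'k \<Rightarrow> complex"
  assumes "Vector_Spaces.linear (*s) (*) D"
  shows "bounded_linear D"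
  using assms unfolding linear_form_iff
  by (intro linear_conv_bounded_linear[THEN iffD1] linearI)
    (auto simp: scaleR_eq_vector_smult scaleR_conv_of_real)

lemma vector_eq_sum_axis: "(v :: complex^'k) = (\<Sum>i\<in>UNIV. v $ i *s axis i 1)"
  by (simp add: vec_eq_iff axis_def if_distrib cong: if_cong)

lemma linear_form_sum_axis:
  fixes D :: "complex^'k \<Rightarrow> complex"
  assumes "Vector_Spaces.linear (*s) (*) D"
  shows "D v = (\<Sum>i\<in>UNIV. v $ i * D (axis i 1))"
proof -
  have "D (\<Sum>i\<in>I. v $ i *s axis i 1) = (\<Sum>i\<in>I. v $ i * D (axis i 1))" if "finite I" for I
    using that
  proof induction
    case empty
    have "D (0 *s 0) = 0 * D 0" using assms unfolding linear_form_iff by blast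
    then show ?case by simp
  next
    case (insert x F)
    then show ?case using assms unfolding linear_form_iff by simp
  qed
  from this[of UNIV] show ?thesis by (subst vector_eq_sum_axis) simp
qed

section \<open>Holomorphic functions of several variables\<close>

abbreviation vholomorphic_on :: "(complex^'k \<Rightarrow> complex^'m) \<Rightarrow> (complex^'k) set \<Rightarrow> bool" where
  "vholomorphic_on f S \<equiv> \<forall>i. mholomorphic_on (\<lambda>z. f z $ i) S"

lemma mholomorphic_onI:
  assumes "open S" "\<And>z. z \<in> S \<Longrightarrow> (f has_derivative D z) (at z)"
    "\<And>z. z \<in> S \<Longrightarrow> Vector_Spaces.linear (*s) (*) (D z)"
  shows "mholomorphic_on f S"
  using assms unfolding mholomorphic_on_def by blast

lemma mholomorphic_on_open: "mholomorphic_on f S \<Longrightarrow> open S"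
  by (simp add: mholomorphic_on_def)

lemma mholomorphic_has_derivative:
  assumes "mholomorphic_on f S" "z \<in> S"
  shows "(f has_derivative frechet_derivative f (at z)) (at z)"
  using assms unfolding mholomorphic_on_def
  by (meson differentiable_def frechet_derivative_works)

lemma mholomorphic_linear:
  assumes "mholomorphic_on f S" "z \<in> S"
  shows "Vector_Spaces.linear (*s) (*) (frechet_derivative f (at z))"
  using assms unfolding mholomorphic_on_def by (metis frechet_derivative_at)

lemma mholomorphic_on_subset: "mholomorphic_on f S \<Longrightarrow> open T \<Longrightarrow> T \<subseteq> S \<Longrightarrow> mholomorphic_on f T"
  unfolding mholomorphic_on_def by blast

lemma mholomorphic_on_local:
  assumes "\<And>z. z \<in> S \<Longrightarrow> \<exists>T. z \<in> T \<and> T \<subseteq> S \<and> mholomorphic_on f T"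
  shows "mholomorphic_on f S"
  unfolding mholomorphic_on_def
proof
  have "\<exists>T. open T \<and> z \<in> T \<and> T \<subseteq> S" if "z \<in> S" for z
    using assms[OF that] mholomorphic_on_open by blast
  then show "open S" by (subst open_subopen) blast
  show "\<forall>z\<in>S. \<exists>D. (f has_derivative D) (at z) \<and> Vector_Spaces.linear (*s) (*) D"
    using assms unfolding mholomorphic_on_def by blast
qed

lemma mholomorphic_on_cong:
  assumes "mholomorphic_on f S" "\<And>z. z \<in> S \<Longrightarrow> f z = g z"
  shows "mholomorphic_on g S"
proof -
  have "(g has_derivative D) (at z)" if "(f has_derivative D) (at z)" "z \<in> S" for D z
    using has_derivative_transform_within_open[OF that(1) _ that(2)] assms
    by (auto simp: mholomorphic_on_def)
  then show ?thesis using assms unfolding mholomorphic_on_def by blast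
qed

lemma mholomorphic_continuous_on: "mholomorphic_on f S \<Longrightarrow> continuous_on S f"
  by (meson continuous_at_imp_continuous_on has_derivative_continuous mholomorphic_has_derivative)

lemma mholomorphic_const: "open S \<Longrightarrow> mholomorphic_on (\<lambda>z. c) S"
  by (rule mholomorphic_onI[where D = "\<lambda>_ _. 0"]) (auto simp: linear_form_iff)

lemma mholomorphic_linear_form:
  assumes "open S" "Vector_Spaces.linear (*s) (*) D"
  shows "mholomorphic_on D S"
  using assms by (intro mholomorphic_onI[where D = "\<lambda>_. D"])
    (auto intro: bounded_linear_imp_has_derivative linear_form_bounded_linear)

lemma mholomorphic_component: "open S \<Longrightarrow> mholomorphic_on (\<lambda>z. z $ i) S"
  by (rule mholomorphic_linear_form) (auto simp: linear_form_iff)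

lemma mholomorphic_add:
  assumes "mholomorphic_on f S" "mholomorphic_on g S"
  shows "mholomorphic_on (\<lambda>z. f z + g z) S"
  using assms mholomorphic_linear[OF assms(1)] mholomorphic_linear[OF assms(2)]
  by (intro mholomorphic_onI[where
      D = "\<lambda>z v. frechet_derivative f (at z) v + frechet_derivative g (at z) v"])
    (auto simp: linear_form_iff algebra_simps mholomorphic_on_open
      intro!: derivative_eq_intros mholomorphic_has_derivative)

lemma mholomorphic_mult:
  assumes "mholomorphic_on f S" "mholomorphic_on g S"
  shows "mholomorphic_on (\<lambda>z. f z * g z) S"
  using assms mholomorphic_linear[OF assms(1)] mholomorphic_linear[OF assms(2)]
  by (intro mholomorphic_onI[where
      D = "\<lambda>z v. f z * frechet_derivative g (at z) v + frechet_derivative f (at z) v * g z"])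
    (auto simp: linear_form_iff algebra_simps mholomorphic_on_open
      intro!: derivative_eq_intros mholomorphic_has_derivative)

lemma mholomorphic_cmult: "mholomorphic_on f S \<Longrightarrow> mholomorphic_on (\<lambda>z. c * f z) S"
  by (intro mholomorphic_mult mholomorphic_const mholomorphic_on_open)

lemma mholomorphic_minus: "mholomorphic_on f S \<Longrightarrow> mholomorphic_on (\<lambda>z. - f z) S"
  using mholomorphic_cmult[of f S "-1"] by simp

lemma mholomorphic_diff:
  "mholomorphic_on f S \<Longrightarrow> mholomorphic_on g S \<Longrightarrow> mholomorphic_on (\<lambda>z. f z - g z) S"
  using mholomorphic_add[OF _ mholomorphic_minus, of f S g] by simp

lemma mholomorphic_inverse:
  assumes "mholomorphic_on f S" "\<And>z. z \<in> S \<Longrightarrow> f z \<noteq> 0"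
  shows "mholomorphic_on (\<lambda>z. inverse (f z)) S"
  using assms mholomorphic_linear[OF assms(1)]
  by (intro mholomorphic_onI[where
      D = "\<lambda>z v. - (inverse (f z) * frechet_derivative f (at z) v * inverse (f z))"])
    (auto simp: linear_form_iff distrib_left distrib_right mholomorphic_on_open
      intro!: Deriv.has_derivative_inverse mholomorphic_has_derivative)

lemma mholomorphic_divide:
  assumes "mholomorphic_on f S" "mholomorphic_on g S" "\<And>z. z \<in> S \<Longrightarrow> g z \<noteq> 0"
  shows "mholomorphic_on (\<lambda>z. f z / g z) S"
  unfolding divide_inverse using assms by (intro mholomorphic_mult mholomorphic_inverse)

lemma mholomorphic_sum:
  assumes "open S" "\<And>i. i \<in> I \<Longrightarrow> mholomorphic_on (f i) S"
  shows "mholomorphic_on (\<lambda>z. \<Sum>i\<in>I. f i z) S"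
  using assms(2)
  by (induction I rule: infinite_finite_induct)
    (auto intro: mholomorphic_const mholomorphic_add assms(1))

lemma mholomorphic_prod:
  assumes "open S" "\<And>i. i \<in> I \<Longrightarrow> mholomorphic_on (f i) S"
  shows "mholomorphic_on (\<lambda>z. \<Prod>i\<in>I. f i z) S"
  using assms(2)
  by (induction I rule: infinite_finite_induct)
    (auto intro: mholomorphic_const mholomorphic_mult assms(1))

lemma mholomorphic_det:
  fixes M :: "complex^'k \<Rightarrow> complex^'m^'m"
  assumes "open S" "\<And>i j. mholomorphic_on (\<lambda>z. M z $ i $ j) S"
  shows "mholomorphic_on (\<lambda>z. det (M z)) S"
  unfolding det_def
  using assms by (intro mholomorphic_sum mholomorphic_mult mholomorphic_const mholomorphic_prod) auto

lemma vholomorphic_has_derivative: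
  fixes f :: "complex^'k::finite \<Rightarrow> complex^'m::finite"
  assumes "vholomorphic_on f S" "z \<in> S"
  shows "(f has_derivative frechet_derivative f (at z)) (at z)"
    and "frechet_derivative f (at z) v $ i = frechet_derivative (\<lambda>z. f z $ i) (at z) v"
    and "Vector_Spaces.linear (*s) (*s) (frechet_derivative f (at z))"
proof -
  define D where "D = (\<lambda>v. \<chi> i. frechet_derivative (\<lambda>z. f z $ i) (at z) v)"
  have "(f has_derivative D) (at z)"
    unfolding has_derivative_componentwise_within[of f]
  proof
    fix b :: "complex^'m" assume "b \<in> Basis"
    \<comment> \<open>The basis is that of a real vector space: \<open>u\<close> runs through the
      real basis of the complex numbers, so each complex component is split once more.\<close>
    then obtain i u where b: "b = axis i u" unfolding Basis_vec_def by auto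
    have "((\<lambda>z. f z $ i \<bullet> u) has_derivative (\<lambda>v. D v $ i \<bullet> u)) (at z)"
      unfolding D_def using assms
      by (auto intro!: has_derivative_inner_left mholomorphic_has_derivative)
    then show "((\<lambda>x. f x \<bullet> b) has_derivative (\<lambda>x. D x \<bullet> b)) (at z)"
      by (simp add: b inner_axis)
  qed
  then have D: "frechet_derivative f (at z) = D" using frechet_derivative_at by metis
  show "(f has_derivative frechet_derivative f (at z)) (at z)"
    using \<open>(f has_derivative D) (at z)\<close> D by simp
  show *: "frechet_derivative f (at z) v $ i = frechet_derivative (\<lambda>z. f z $ i) (at z) v" for v i
    by (simp add: D D_def)
  show "Vector_Spaces.linear (*s) (*s) (frechet_derivative f (at z))"
    unfolding vlinear_componentwise * using assms mholomorphic_linear by blast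
qed

lemma vholomorphic_continuous_on:
  fixes f :: "complex^'k::finite \<Rightarrow> complex^'m::finite"
  assumes "vholomorphic_on f S" shows "continuous_on S f"
  by (meson assms continuous_at_imp_continuous_on has_derivative_continuous
      vholomorphic_has_derivative(1))

lemma mholomorphic_compose:
  fixes f :: "complex^'m::finite \<Rightarrow> complex" and g :: "complex^'k::finite \<Rightarrow> complex^'m"
  assumes "mholomorphic_on f T" "vholomorphic_on g S" "g ` S \<subseteq> T"
  shows "mholomorphic_on (\<lambda>z. f (g z)) S"
proof (rule mholomorphic_onI)
  show "open S" using assms(2) mholomorphic_on_open by blast
  fix z assume z: "z \<in> S"
  then have gz: "g z \<in> T" using assms by blast
  show "((\<lambda>z. f (g z)) has_derivative
      (\<lambda>v. frechet_derivative f (at (g z)) (frechet_derivative g (at z) v))) (at z)"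
    using has_derivative_compose[OF vholomorphic_has_derivative(1)[OF assms(2) z]
        mholomorphic_has_derivative[OF assms(1) gz]] .
  show "Vector_Spaces.linear (*s) (*)
      (\<lambda>v. frechet_derivative f (at (g z)) (frechet_derivative g (at z) v))"
    using mholomorphic_linear[OF assms(1) gz] vholomorphic_has_derivative(3)[OF assms(2) z]
    by (simp add: linear_form_iff vlinear_iff)
qed

text \<open>The link between several variables and one: complex linearity of the derivative turns
  the real chain rule into a derivative in complex time. All arguments along complex lines and
  integral curves pass through it.\<close>

lemma has_field_derivative_compose_curve:
  fixes f :: "complex^'k::finite \<Rightarrow> complex" and \<gamma> :: "complex \<Rightarrow> complex^'k"
  assumes "mholomorphic_on f S" "\<gamma> s \<in> S"
    and "\<And>i. ((\<lambda>s. \<gamma> s $ i) has_field_derivative d $ i) (at s)"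
  shows "((\<lambda>s. f (\<gamma> s)) has_field_derivative frechet_derivative f (at (\<gamma> s)) d) (at s)"
proof -
  have "(\<gamma> has_derivative (\<lambda>c. c *s d)) (at s)"
    unfolding has_derivative_componentwise_within[of \<gamma>]
  proof
    fix b :: "complex^'k" assume "b \<in> Basis"
    then obtain i u where b: "b = axis i u" unfolding Basis_vec_def by auto
    have "((\<lambda>s. \<gamma> s $ i) has_derivative (\<lambda>c. (c *s d) $ i)) (at s)"
      using assms(3)[of i] by (simp add: has_field_derivative_def mult_commute_abs)
    then have "((\<lambda>s. \<gamma> s $ i \<bullet> u) has_derivative (\<lambda>c. (c *s d) $ i \<bullet> u)) (at s)"
      by (rule has_derivative_inner_left)
    then show "((\<lambda>x. \<gamma> x \<bullet> b) has_derivative (\<lambda>x. (x *s d) \<bullet> b)) (at s)"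
      by (simp add: b inner_axis)
  qed
  from has_derivative_compose[OF this mholomorphic_has_derivative[OF assms(1,2)]]
  have "((\<lambda>s. f (\<gamma> s)) has_derivative (\<lambda>c. frechet_derivative f (at (\<gamma> s)) (c *s d))) (at s)" .
  then show ?thesis
    using mholomorphic_linear[OF assms(1,2)]
    by (simp add: has_field_derivative_def linear_form_iff mult_commute_abs)
qed

lemma has_field_derivative_line:
  fixes f :: "complex^'k::finite \<Rightarrow> complex"
  assumes "mholomorphic_on f S" "z + s *s v \<in> S"
  shows "((\<lambda>s. f (z + s *s v)) has_field_derivative frechet_derivative f (at (z + s *s v)) v) (at s)"
  by (rule has_field_derivative_compose_curve[OF assms(1), where \<gamma> = "\<lambda>s. z + s *s v", OF assms(2)]) (auto intro!: derivative_eq_intros)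

section \<open>Cauchy integrals, differentiation under the integral sign, higher
  differentiability\<close>

lemma Cauchy_integral_unit_interval:
  fixes f :: "complex \<Rightarrow> complex"
  assumes "f holomorphic_on S" "open S" "cball 0 r \<subseteq> S" "r > 0"
  defines "\<gamma> \<equiv> \<lambda>t. of_real r * exp (2 * of_real pi * \<i> * of_real t)"
  shows "f 0 = integral {0..1} (\<lambda>t. f (\<gamma> t))"
    and "deriv f 0 = integral {0..1} (\<lambda>t. f (\<gamma> t) / \<gamma> t)"
proof -
  have nz: "\<gamma> t \<noteq> 0" for t using \<open>r > 0\<close> by (simp add: \<gamma>_def)
  have cp: "circlepath 0 r t = \<gamma> t" for t by (simp add: circlepath \<gamma>_def)
  have vd: "vector_derivative (circlepath 0 r) (at t) = 2 * pi * \<i> * \<gamma> t" for t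
    by (simp add: vector_derivative_circlepath \<gamma>_def)
  have hol: "f holomorphic_on cball 0 r" "f holomorphic_on ball 0 r" "continuous_on (cball 0 r) f"
    using assms(1,3) holomorphic_on_subset holomorphic_on_imp_continuous_on ball_subset_cball
    by (blast, meson ball_subset_cball dual_order.trans holomorphic_on_subset,
        meson holomorphic_on_imp_continuous_on holomorphic_on_subset)
  \<comment> \<open>The velocity of the parametrised circle is
    \<open>2 * pi * \<i> * \<gamma> t\<close>; its two factors cancel the constant in Cauchy's
    formula and one power of the denominator. What remains is an integral over a fixed real
    interval, ready for the Leibniz rule.\<close>
  have *: "contour_integral (circlepath 0 r) g = 2 * pi * \<i> * integral {0..1} (\<lambda>t. g (\<gamma> t) * \<gamma> t)" for g
  proof -
    have "contour_integral (circlepath 0 r) g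
      = integral {0..1} (\<lambda>t. (2 * pi * \<i>) * (g (\<gamma> t) * \<gamma> t))"
      unfolding contour_integral_integral
      by (rule integral_cong) (simp add: cp vd)
    then show ?thesis by simp
  qed
  have "contour_integral (circlepath 0 r) (\<lambda>u. f u / (u - 0)) = 2 * of_real pi * \<i> * f 0"
    by (rule contour_integral_unique, rule Cauchy_integral_circlepath_simple) (use hol assms in auto)
  then show "f 0 = integral {0..1} (\<lambda>t. f (\<gamma> t))" using nz by (simp add: *)
  have "contour_integral (circlepath 0 r) (\<lambda>u. f u / (u - 0)^2) = 2 * pi * \<i> * deriv f 0"
    by (rule Cauchy_contour_integral_circlepath_2) (use hol assms in auto)
  then show "deriv f 0 = integral {0..1} (\<lambda>t. f (\<gamma> t) / \<gamma> t)"
    using nz by (simp add: * power2_eq_square)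
qed

text \<open>Cauchy's formula on the complex line through \<open>z\<close> in direction
  \<open>v\<close>. It expresses a derivative through values of \<open>f\<close> alone, so
  regularity of \<open>f\<close> passes to its derivative.\<close>

lemma frechet_derivative_Cauchy:
  fixes f :: "complex^'k::finite \<Rightarrow> complex"
  assumes "mholomorphic_on f S" "r > 0" "\<And>s. cmod s \<le> r \<Longrightarrow> z + s *s v \<in> S"
  defines "\<gamma> \<equiv> \<lambda>t. of_real r * exp (2 * of_real pi * \<i> * of_real t)"
  shows "frechet_derivative f (at z) v = integral {0..1} (\<lambda>t. f (z + \<gamma> t *s v) / \<gamma> t)"
proof -
  define T where "T = (\<lambda>s. z + s *s v) -` S"
  have "continuous_on UNIV (\<lambda>s. z + s *s v)"
    by (intro continuous_intros bounded_linear.continuous_on[OF bounded_linear_vector_smult])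
  then have oT: "open T"
    unfolding T_def using mholomorphic_on_open[OF assms(1)] open_vimage by blast
  have hol: "(\<lambda>s. f (z + s *s v)) holomorphic_on T"
    unfolding holomorphic_on_open[OF oT]
    using has_field_derivative_line[OF assms(1)] unfolding T_def by blast
  have "cball 0 r \<subseteq> T" using assms(3) by (auto simp: T_def)
  then have "deriv (\<lambda>s. f (z + s *s v)) 0 = integral {0..1} (\<lambda>t. f (z + \<gamma> t *s v) / \<gamma> t)"
    unfolding \<gamma>_def using Cauchy_integral_unit_interval(2)[OF hol oT _ \<open>r > 0\<close>] by simp
  moreover have "deriv (\<lambda>s. f (z + s *s v)) 0 = frechet_derivative f (at z) v"
    using DERIV_imp_deriv[OF has_field_derivative_line[OF assms(1), of z 0 v]] assms(2) assms(3)[of 0]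
    by simp
  ultimately show ?thesis by simp
qed

lemma continuous_on_vector_smult:
  assumes "continuous_on S f"
  shows "continuous_on S (\<lambda>x. f x *s (v :: complex^'k::finite))"
  by (rule bounded_linear.continuous_on[OF bounded_linear_vector_smult assms])

lemma open_contains_short_lines:
  fixes S :: "(complex^'k::finite) set"
  assumes "open S" "z0 \<in> S"
  obtains d r where "d > 0" "r > 0" "ball z0 d \<subseteq> S"
    "\<And>z s. z \<in> ball z0 d \<Longrightarrow> cmod s \<le> r \<Longrightarrow> z + s *s v \<in> S"
proof -
  obtain e where e: "e > 0" "ball z0 e \<subseteq> S" using assms open_contains_ball by blast
  define d where "d = e / 2"
  \<comment> \<open>The summand 1 covers \<open>v = 0\<close>.\<close>
  define r where "r = d / (norm v + 1)"
  have nv: "norm v + 1 > 0" by (simp add: add_nonneg_pos)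
  have d: "d > 0" "r > 0" using e nv by (auto simp: d_def r_def)
  have rd: "r * (norm v + 1) = d" using nv by (simp add: r_def)
  have mem: "z + s *s v \<in> S" if "z \<in> ball z0 d" "cmod s \<le> r" for z s
  proof -
    have "norm (s *s v) \<le> r * norm v"
      unfolding norm_vector_smult using that by (intro mult_right_mono) auto
    also have "\<dots> \<le> d"
      using d rd by (simp add: distrib_left)
    finally have "norm (s *s v) \<le> d" .
    then have "dist z0 (z + s *s v) < e"
      using that(1) norm_triangle_ineq4[of "z0 - z" "s *s v"] by (simp add: dist_norm d_def diff_diff_eq)
    then show ?thesis using e by auto
  qed
  have "ball z0 d \<subseteq> S" using e by (auto simp: d_def)
  then show ?thesis using that d mem by blast
qed

text \<open>Near a point one radius serves all base points, and Cauchy's formula then writes the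
  derivative as an integral of the jointly continuous \<open>f\<close> over a fixed circle. Joint
  continuity of the derivative therefore need not be assumed.\<close>

lemma continuous_on_frechet_derivative_param:
  fixes f :: "complex^'k::finite \<Rightarrow> real \<Rightarrow> complex"
  assumes "open N" "continuous_on (N \<times> {0..1}) (\<lambda>(z, t). f z t)"
    and "\<And>t. t \<in> {0..1} \<Longrightarrow> mholomorphic_on (\<lambda>z. f z t) N"
  shows "continuous_on (N \<times> {0..1}) (\<lambda>(z, t). frechet_derivative (\<lambda>z. f z t) (at z) v)"
proof -
  have "\<exists>d>0. ball z0 d \<subseteq> N \<and>
    continuous_on (ball z0 d \<times> {0..1}) (\<lambda>(z, t). frechet_derivative (\<lambda>z. f z t) (at z) v)"
    if z0: "z0 \<in> N" for z0
  proof -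
    obtain d r where d: "d > 0" "r > 0" "ball z0 d \<subseteq> N"
      and mem: "\<And>z s. z \<in> ball z0 d \<Longrightarrow> cmod s \<le> r \<Longrightarrow> z + s *s v \<in> N"
      using open_contains_short_lines[OF \<open>open N\<close> z0, where v = v] by blast
    define \<gamma> where "\<gamma> = (\<lambda>t. of_real r * exp (2 * of_real pi * \<i> * of_real t))"
    have \<gamma>: "cmod (\<gamma> t) = r" for t
      using d by (simp add: \<gamma>_def norm_mult)
    then have \<gamma>0: "\<gamma> t \<noteq> 0" for t using d by (metis norm_zero less_irrefl)
    have "continuous_on ((ball z0 d \<times> {0..1}) \<times> cbox 0 1)
        (\<lambda>(x, t). f (fst x + \<gamma> t *s v) (snd x) / \<gamma> t)"
      unfolding case_prod_beta
    proof (intro continuous_on_divide)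
      have "continuous_on ((ball z0 d \<times> {0..1::real}) \<times> cbox 0 1)
          (\<lambda>p. (fst (fst p) + \<gamma> (snd p) *s v, snd (fst p)))"
        unfolding \<gamma>_def by (intro continuous_intros continuous_on_vector_smult)
      moreover have "(\<lambda>p. (fst (fst p) + \<gamma> (snd p) *s v, snd (fst p))) `
          ((ball z0 d \<times> {0..1::real}) \<times> cbox 0 1) \<subseteq> N \<times> {0..1}"
        using mem \<gamma> by auto
      ultimately have "continuous_on ((ball z0 d \<times> {0..1::real}) \<times> cbox 0 1)
          (\<lambda>p. (\<lambda>(z, t). f z t) (fst (fst p) + \<gamma> (snd p) *s v, snd (fst p)))"
        using continuous_on_compose2[OF assms(2)] by blast
      then show "continuous_on ((ball z0 d \<times> {0..1}) \<times> cbox 0 1)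
          (\<lambda>p. f (fst (fst p) + \<gamma> (snd p) *s v) (snd (fst p)))" by simp
      show "continuous_on ((ball z0 d \<times> {0..1::real}) \<times> cbox 0 1) (\<lambda>p. \<gamma> (snd p))"
        unfolding \<gamma>_def by (intro continuous_intros)
    qed (use \<gamma>0 in auto)
    then have "continuous_on (ball z0 d \<times> {0..1})
        (\<lambda>x. integral (cbox 0 1) (\<lambda>t. f (fst x + \<gamma> t *s v) (snd x) / \<gamma> t))"
      by (rule integral_continuous_on_param)
    moreover have "frechet_derivative (\<lambda>z. f z (snd x)) (at (fst x)) v
        = integral (cbox 0 1) (\<lambda>t. f (fst x + \<gamma> t *s v) (snd x) / \<gamma> t)"
      if "x \<in> ball z0 d \<times> {0..1}" for x
      unfolding \<gamma>_def
      using frechet_derivative_Cauchy[OF assms(3) d(2), of "snd x" "fst x" v] mem that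
      by (auto simp: box_real)
    ultimately have "continuous_on (ball z0 d \<times> {0..1})
        (\<lambda>(z, t). frechet_derivative (\<lambda>z. f z t) (at z) v)"
      by (simp add: case_prod_beta cong: continuous_on_cong)
    then show ?thesis using d by blast
  qed
  then obtain d where d: "\<And>z0. z0 \<in> N \<Longrightarrow> d z0 > 0 \<and> ball z0 (d z0) \<subseteq> N \<and>
    continuous_on (ball z0 (d z0) \<times> {0..1}) (\<lambda>(z, t). frechet_derivative (\<lambda>z. f z t) (at z) v)"
    by metis
  show ?thesis
    unfolding continuous_on_eq_continuous_within
  proof
    fix x :: "(complex^'k) \<times> real" assume x: "x \<in> N \<times> {0..1}"
    let ?B = "ball (fst x) (d (fst x))"
    have dx: "d (fst x) > 0" "?B \<subseteq> N"
      "continuous_on (?B \<times> {0..1}) (\<lambda>(z, t). frechet_derivative (\<lambda>z. f z t) (at z) v)"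
      using d[of "fst x"] mem_Times_iff[THEN iffD1, OF x] by blast+
    have "at x within (?B \<times> {0..1}) = at x within (N \<times> {0..1})"
    proof (rule at_within_nhd[where S = "?B \<times> UNIV"])
      show "x \<in> ?B \<times> UNIV" using dx by (cases x) auto
      show "open (?B \<times> (UNIV::real set))" by (intro open_Times) auto
      show "?B \<times> {0..1} \<inter> ?B \<times> UNIV - {x} = N \<times> {0..1} \<inter> ?B \<times> UNIV - {x}"
        using dx(2) by (simp add: Times_Int_Times Int_absorb1)
    qed
    moreover have "x \<in> ?B \<times> {0..1}" using x dx by (cases x) auto
    ultimately show "continuous (at x within N \<times> {0..1})
        (\<lambda>(z, t). frechet_derivative (\<lambda>z. f z t) (at z) v)"
      using dx(3) unfolding continuous_on_eq_continuous_within by (metis (no_types, lifting))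
  qed
qed

text \<open>The Leibniz rule, with its continuity condition on the derivative supplied by
  \<open>continuous_on_frechet_derivative_param\<close>.\<close>

lemma mholomorphic_integral:
  fixes f :: "complex^'k::finite \<Rightarrow> real \<Rightarrow> complex"
  assumes "open N" "continuous_on (N \<times> {0..1}) (\<lambda>(z, t). f z t)"
    and hol: "\<And>t. t \<in> {0..1} \<Longrightarrow> mholomorphic_on (\<lambda>z. f z t) N"
  shows "mholomorphic_on (\<lambda>z. integral {0..1} (f z)) N"
proof (rule mholomorphic_on_local)
  fix z0 assume z0: "z0 \<in> N"
  obtain e where e: "e > 0" "ball z0 e \<subseteq> N" using \<open>open N\<close> z0 open_contains_ball by blast
  let ?B = "ball z0 e"
  define fx where "fx = (\<lambda>z t. Blinfun (frechet_derivative (\<lambda>z. f z t) (at z)))"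
  have D: "((\<lambda>z. f z t) has_derivative frechet_derivative (\<lambda>z. f z t) (at z)) (at z)"
    if "z \<in> N" "t \<in> {0..1}" for z t
    using mholomorphic_has_derivative[OF hol that(1)] that by blast
  have fx: "blinfun_apply (fx z t) = frechet_derivative (\<lambda>z. f z t) (at z)"
    if "z \<in> N" "t \<in> {0..1}" for z t
    unfolding fx_def using D[OF that] bounded_linear_Blinfun_apply has_derivative_bounded_linear by blast
  have cont: "continuous_on (?B \<times> cbox 0 1) (\<lambda>(z, t). fx z t)"
  proof (rule continuous_on_blinfun_componentwise)
    fix i :: "complex^'k"
    have "continuous_on (?B \<times> cbox 0 1) (\<lambda>(z, t). frechet_derivative (\<lambda>z. f z t) (at z) i)"
      by (rule continuous_on_subset[OF continuous_on_frechet_derivative_param[OF assms]])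
        (use e in auto)
    moreover have "(\<lambda>(z, t). frechet_derivative (\<lambda>z. f z t) (at z) i) x
        = blinfun_apply (case x of (z, t) \<Rightarrow> fx z t) i" if "x \<in> ?B \<times> cbox 0 1" for x
      using that e(2) fx[of "fst x" "snd x"] by (cases x) (auto simp: box_real)
    ultimately show "continuous_on (?B \<times> cbox 0 1) (\<lambda>x. blinfun_apply (case x of (z, t) \<Rightarrow> fx z t) i)"
      by (rule continuous_on_eq)
  qed
  have contz: "continuous_on (cbox 0 1) (f z)" if "z \<in> N" for z
  proof -
    have "continuous_on {0..1} (\<lambda>t. (\<lambda>(z, t). f z t) (z, t))"
      by (rule continuous_on_compose2[OF assms(2)]) (use that in \<open>auto intro!: continuous_intros\<close>)
    then show ?thesis by (simp add: box_real)
  qed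
  have "mholomorphic_on (\<lambda>z. integral (cbox 0 1) (f z)) ?B"
  proof (rule mholomorphic_onI)
    fix z assume z: "z \<in> ?B"
    then have zN: "z \<in> N" using e by auto
    have "((\<lambda>z. integral (cbox 0 1) (f z)) has_derivative integral (cbox 0 1) (fx z)) (at z within ?B)"
    proof (rule leibniz_rule[OF _ _ cont z])
      show "((\<lambda>z. f z t) has_derivative blinfun_apply (fx z t)) (at z within ?B)"
        if "z \<in> ?B" "t \<in> cbox 0 1" for z t
      proof (rule has_derivative_at_withinI)
        have "z \<in> N" "t \<in> {0..1}" using that e(2) by auto
        then show "((\<lambda>z. f z t) has_derivative blinfun_apply (fx z t)) (at z)"
          using D fx by metis
      qed
      show "f z integrable_on cbox 0 1" if "z \<in> ?B" for z
        using contz[of z] that e(2) integrable_continuous by blast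
    qed auto
    then show "((\<lambda>z. integral (cbox 0 1) (f z)) has_derivative integral (cbox 0 1) (fx z)) (at z)"
      using at_within_open[OF z open_ball] by simp
    have ifx: "fx z integrable_on cbox 0 1"
    proof (rule integrable_continuous)
      have "continuous_on (cbox 0 1) (\<lambda>t. (\<lambda>(z, t). fx z t) (z, t))"
        by (rule continuous_on_compose2[OF cont]) (use z in \<open>auto intro!: continuous_intros\<close>)
      then show "continuous_on (cbox 0 1) (fx z)" by simp
    qed
    \<comment> \<open>The Leibniz rule yields a real linear derivative; complex homogeneity is read
      off under the integral.\<close>
    have "blinfun_apply (integral (cbox 0 1) (fx z)) (c *s w) = c * blinfun_apply (integral (cbox 0 1) (fx z)) w"
      for c w
    proof -
      have "integral (cbox 0 1) (\<lambda>t. blinfun_apply (fx z t) (c *s w))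
          = integral (cbox 0 1) (\<lambda>t. c * blinfun_apply (fx z t) w)"
      proof (rule integral_cong)
        fix t :: real assume "t \<in> cbox 0 1"
        then have t: "t \<in> {0..1}" by simp
        show "blinfun_apply (fx z t) (c *s w) = c * blinfun_apply (fx z t) w"
          using mholomorphic_linear[OF hol[OF t] zN] fx[OF zN t] unfolding linear_form_iff by simp
      qed
      then show ?thesis by (simp only: blinfun_apply_integral[OF ifx] integral_mult_right)
    qed
    then show "Vector_Spaces.linear (*s) (*) (blinfun_apply (integral (cbox 0 1) (fx z)))"
      by (simp add: linear_form_iff blinfun.add_right)
  qed auto
  then show "\<exists>T. z0 \<in> T \<and> T \<subseteq> N \<and> mholomorphic_on (\<lambda>z. integral {0..1} (f z)) T"
    using e by (intro exI[of _ ?B]) (auto simp: box_real)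
qed

text \<open>By Cauchy's formula the directional derivative is a weighted mean of translates of
  \<open>f\<close>, to which \<open>mholomorphic_integral\<close> applies. Holomorphic functions are
  thus infinitely differentiable, which is what makes Jacobians of coordinate changes
  holomorphic.\<close>

lemma mholomorphic_frechet_derivative:
  fixes f :: "complex^'k::finite \<Rightarrow> complex"
  assumes "mholomorphic_on f S"
  shows "mholomorphic_on (\<lambda>z. frechet_derivative f (at z) v) S"
proof (rule mholomorphic_on_local)
  fix z0 assume z0: "z0 \<in> S"
  have oS: "open S" by (rule mholomorphic_on_open[OF assms])
  obtain d r where d: "d > 0" "r > 0" "ball z0 d \<subseteq> S"
    and mem: "\<And>z s. z \<in> ball z0 d \<Longrightarrow> cmod s \<le> r \<Longrightarrow> z + s *s v \<in> S"
    using open_contains_short_lines[OF oS z0, where v = v] by blast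
  define \<gamma> where "\<gamma> = (\<lambda>t. of_real r * exp (2 * of_real pi * \<i> * of_real t))"
  have \<gamma>: "cmod (\<gamma> t) = r" for t
    using d by (simp add: \<gamma>_def norm_mult)
  then have \<gamma>0: "\<gamma> t \<noteq> 0" for t using d by (metis norm_zero less_irrefl)
  have hol: "mholomorphic_on (\<lambda>z. f (z + \<gamma> t *s v) / \<gamma> t) (ball z0 d)" for t
  proof -
    have "mholomorphic_on (\<lambda>z. f (z + \<gamma> t *s v)) (ball z0 d)"
    proof (rule mholomorphic_compose[OF assms])
      show "vholomorphic_on (\<lambda>z. z + \<gamma> t *s v) (ball z0 d)"
        by (auto intro!: mholomorphic_add mholomorphic_component mholomorphic_const)
    qed (use mem \<gamma> in auto)
    then show ?thesis by (intro mholomorphic_divide mholomorphic_const) (auto simp: \<gamma>0)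
  qed
  have "mholomorphic_on (\<lambda>z. integral {0..1} (\<lambda>t. f (z + \<gamma> t *s v) / \<gamma> t)) (ball z0 d)"
  proof (rule mholomorphic_integral[OF open_ball _ hol])
    have "continuous_on (ball z0 d \<times> {0..1}) (\<lambda>p. f (fst p + \<gamma> (snd p) *s v) / \<gamma> (snd p))"
    proof (intro continuous_on_divide continuous_on_compose2[OF mholomorphic_continuous_on[OF assms]])
      show "continuous_on (ball z0 d \<times> {0..1}) (\<lambda>p. fst p + \<gamma> (snd p) *s v)"
        "continuous_on (ball z0 d \<times> {0..1}) (\<lambda>p::_ \<times> real. \<gamma> (snd p))"
        unfolding \<gamma>_def by (intro continuous_intros continuous_on_vector_smult)+
    qed (use mem \<gamma> \<gamma>0 in auto)
    then show "continuous_on (ball z0 d \<times> {0..1}) (\<lambda>(z, t). f (z + \<gamma> t *s v) / \<gamma> t)"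
      by (simp add: case_prod_beta)
  qed
  moreover have "frechet_derivative f (at z) v = integral {0..1} (\<lambda>t. f (z + \<gamma> t *s v) / \<gamma> t)"
    if "z \<in> ball z0 d" for z
    unfolding \<gamma>_def using frechet_derivative_Cauchy[OF assms d(2), of z v] mem[OF that] by blast
  ultimately have "mholomorphic_on (\<lambda>z. frechet_derivative f (at z) v) (ball z0 d)"
    by (auto elim: mholomorphic_on_cong)
  then show "\<exists>T. z0 \<in> T \<and> T \<subseteq> S \<and> mholomorphic_on (\<lambda>z. frechet_derivative f (at z) v) T"
    using d by (intro exI[of _ "ball z0 d"]) auto
qed

section \<open>The derivative of the determinant\<close>

text \<open>The derivative of the determinant at \<open>A\<close> in direction \<open>B\<close>,
  that is, the trace of the adjugate of \<open>A\<close> times \<open>B\<close>. Written with one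
  replaced column at a time, a nonzero value exhibits an invertible matrix sharing all but one
  column with \<open>A\<close>.\<close>

definition Ddet :: "complex^'n^'n \<Rightarrow> complex^'n^'n \<Rightarrow> complex" where
  "Ddet A B = (\<Sum>j\<in>UNIV. det (\<chi> i k. if k = j then B $ i $ k else A $ i $ k))"

text \<open>The expansion is taken for the transpose, so that the replaced column is the factor with
  index \<open>j\<close> in each product. This is the shape that the product rule produces, and
  linearity in \<open>B\<close> is visible in it.\<close>

lemma Ddet_expand:
  "Ddet A B = (\<Sum>p | p permutes (UNIV :: 'n::finite set). of_int (sign p) *
     (\<Sum>i\<in>UNIV. B $ p i $ i * (\<Prod>j\<in>UNIV - {i}. A $ p j $ j)))"
proof -
  have "det (\<chi> i k. if k = j then B $ i $ k else A $ i $ k)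
      = (\<Sum>p | p permutes (UNIV :: 'n set). of_int (sign p) *
          (B $ p j $ j * (\<Prod>i\<in>UNIV - {j}. A $ p i $ i)))" for j
  proof -
    have "det (\<chi> i k. if k = j then B $ i $ k else A $ i $ k)
      = det (transpose (\<chi> i k. if k = j then B $ i $ k else A $ i $ k))"
      by (rule det_transpose[symmetric])
    also have "\<dots> = (\<Sum>p | p permutes (UNIV :: 'n set). of_int (sign p) *
          (\<Prod>i\<in>UNIV. if i = j then B $ p i $ i else A $ p i $ i))"
      by (simp add: det_def transpose_def)
    also have "\<dots> = (\<Sum>p | p permutes (UNIV :: 'n set). of_int (sign p) *
          (B $ p j $ j * (\<Prod>i\<in>UNIV - {j}. A $ p i $ i)))"
      by (intro sum.cong refl arg_cong2[where f = "(*)"])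
        (subst prod.remove[of _ j], auto intro!: prod.cong)
    finally show ?thesis .
  qed
  then have "Ddet A B = (\<Sum>j\<in>UNIV. \<Sum>p | p permutes (UNIV :: 'n set). of_int (sign p) *
          (B $ p j $ j * (\<Prod>i\<in>UNIV - {j}. A $ p i $ i)))"
    by (simp add: Ddet_def)
  also have "\<dots> = (\<Sum>p | p permutes (UNIV :: 'n set). \<Sum>j\<in>UNIV. of_int (sign p) *
          (B $ p j $ j * (\<Prod>i\<in>UNIV - {j}. A $ p i $ i)))"
    by (rule sum.swap)
  finally show ?thesis by (simp add: sum_distrib_left)
qed

lemma Ddet_add: "Ddet A (B + C) = Ddet A B + Ddet A C"
  by (simp add: Ddet_expand sum.distrib distrib_left distrib_right)

lemma Ddet_cmul:
  assumes "\<And>i j. C $ i $ j = c * B $ i $ j"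
  shows "Ddet A C = c * Ddet A B"
  by (simp add: Ddet_expand assms sum_distrib_left mult.assoc mult.left_commute)

lemma Ddet_diff: "Ddet A (B - C) = Ddet A B - Ddet A C"
  using Ddet_add[of A "B - C" C] by simp

lemma has_derivative_det:
  fixes M :: "'a::real_normed_vector \<Rightarrow> complex^'n::finite^'n"
  assumes "\<And>i j. ((\<lambda>z. M z $ i $ j) has_derivative (\<lambda>v. M' v $ i $ j)) (at x)"
  shows "((\<lambda>z. det (M z)) has_derivative (\<lambda>v. Ddet (M x) (M' v))) (at x)"
proof -
  have "((\<lambda>z. \<Sum>p | p permutes (UNIV :: 'n set). of_int (sign p) * (\<Prod>i\<in>UNIV. M z $ p i $ i))
    has_derivative (\<lambda>v. Ddet (M x) (M' v))) (at x)"
    unfolding Ddet_expand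
    by (intro has_derivative_sum has_derivative_mult_right has_derivative_prod assms)
  moreover have "(\<lambda>z. \<Sum>p | p permutes (UNIV :: 'n set). of_int (sign p) * (\<Prod>i\<in>UNIV. M z $ p i $ i))
    = (\<lambda>z. det (M z))"
    by (subst det_transpose[symmetric]) (simp add: det_def transpose_def)
  ultimately show ?thesis by simp
qed

lemma has_field_derivative_det:
  fixes M :: "complex \<Rightarrow> complex^'n::finite^'n"
  assumes "\<And>i j. ((\<lambda>z. M z $ i $ j) has_field_derivative M' $ i $ j) (at x)"
  shows "((\<lambda>z. det (M z)) has_field_derivative Ddet (M x) M') (at x)"
proof -
  define N where "N = (\<lambda>v. \<chi> i j. v * M' $ i $ j)"
  have "((\<lambda>z. det (M z)) has_derivative (\<lambda>v. Ddet (M x) (N v))) (at x)"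
    by (rule has_derivative_det)
      (use assms in \<open>simp add: N_def has_field_derivative_def mult_commute_abs\<close>)
  moreover have "(\<lambda>v. Ddet (M x) (N v)) = (*) (Ddet (M x) M')"
    by (auto simp: N_def fun_eq_iff mult.commute intro!: Ddet_cmul)
  ultimately show ?thesis by (simp add: has_field_derivative_def)
qed

lemma has_field_derivative_det_affine:
  fixes A B :: "complex^'n::finite^'n"
  shows "((\<lambda>t. det (\<chi> i j. A $ i $ j + t * B $ i $ j)) has_field_derivative
    Ddet (\<chi> i j. A $ i $ j + t * B $ i $ j) B) (at t)"
  by (rule has_field_derivative_det) (auto intro!: derivative_eq_intros)

text \<open>The determinant of the pencil \<open>A + t B\<close> does not change under conjugation,
  hence neither does its derivative at \<open>t = 0\<close>.\<close>

lemma Ddet_similar: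
  fixes A B P Q :: "complex^'n::finite^'n"
  assumes "P ** Q = mat 1"
  shows "Ddet (P ** A ** Q) (P ** B ** Q) = Ddet A B"
proof -
  have pq: "det P * det Q = 1" using assms by (metis det_I det_mul)
  have entry: "(P ** X ** Q) $ i $ j = (\<Sum>k\<in>UNIV. (\<Sum>l\<in>UNIV. P $ i $ l * X $ l $ k) * Q $ k $ j)"
    for X i j by (simp add: matrix_matrix_mult_def)
  have "(\<chi> i j. (P ** A ** Q) $ i $ j + t * (P ** B ** Q) $ i $ j)
      = P ** (\<chi> i j. A $ i $ j + t * B $ i $ j) ** Q" for t
    by (simp add: vec_eq_iff entry sum.distrib distrib_left distrib_right sum_distrib_left
        sum_distrib_right mult.assoc mult.left_commute)
  then have eq: "det (\<chi> i j. (P ** A ** Q) $ i $ j + t * (P ** B ** Q) $ i $ j)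
      = det (\<chi> i j. A $ i $ j + t * B $ i $ j)" for t
    using pq by (simp add: det_mul mult.commute mult.left_commute)
  have "((\<lambda>t. det (\<chi> i j. A $ i $ j + t * B $ i $ j)) has_field_derivative
      Ddet (P ** A ** Q) (P ** B ** Q)) (at 0)"
    using has_field_derivative_det_affine[of "P ** A ** Q" "P ** B ** Q" 0] by (simp add: eq)
  moreover have "((\<lambda>t. det (\<chi> i j. A $ i $ j + t * B $ i $ j)) has_field_derivative Ddet A B) (at 0)"
    using has_field_derivative_det_affine[of A B 0] by simp
  ultimately show ?thesis by (rule DERIV_unique)
qed

text \<open>The pencil \<open>A + t A C = A (1 + t C)\<close> is singular for every
  \<open>t\<close>.\<close>

lemma Ddet_mult_right:
  fixes A C :: "complex^'n::finite^'n"
  assumes "det A = 0"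
  shows "Ddet A (A ** C) = 0"
proof -
  have "(\<chi> i j. A $ i $ j + t * (A ** C) $ i $ j) = A ** (mat 1 + (\<chi> i j. t * C $ i $ j))" for t
    unfolding matrix_add_ldistrib
    by (simp add: vec_eq_iff) (simp add: matrix_matrix_mult_def sum_distrib_left mult.left_commute)
  then have "det (\<chi> i j. A $ i $ j + t * (A ** C) $ i $ j) = 0" for t
    using assms by (simp add: det_mul)
  then have "((\<lambda>t. 0) has_field_derivative Ddet A (A ** C)) (at 0)"
    using has_field_derivative_det_affine[of A "A ** C" 0] by simp
  then show ?thesis by (rule DERIV_unique[OF _ DERIV_const])
qed

text \<open>A permutation other than the identity moves at least two indices, so even after one
  factor is left out an off-diagonal entry of \<open>A\<close> survives in the product.\<close>

lemma Ddet_diagonal: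
  fixes A B :: "complex^'n::finite^'n"
  assumes "\<And>i j. i \<noteq> j \<Longrightarrow> A $ i $ j = 0"
  shows "Ddet A B = (\<Sum>i\<in>UNIV. B $ i $ i * (\<Prod>j\<in>UNIV - {i}. A $ j $ j))"
proof -
  have "(\<Prod>j\<in>UNIV - {i}. A $ p j $ j) = 0" if p: "p permutes UNIV" "p \<noteq> id" for p and i :: 'n
  proof -
    have "\<exists>j. j \<noteq> i \<and> p j \<noteq> j"
    proof (rule ccontr)
      assume "\<not> ?thesis"
      then have fixed: "p j = j" if "j \<noteq> i" for j using that by blast
      have "p i = i"
        by (metis fixed p(1) permutes_def)
      then show False using fixed p(2) by (metis eq_id_iff)
    qed
    then show ?thesis using assms by (auto intro!: prod_zero)
  qed
  then have "(\<Sum>i\<in>UNIV. B $ p i $ i * (\<Prod>j\<in>UNIV - {i}. A $ p j $ j)) = 0"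
    if "p permutes UNIV" "p \<noteq> id" for p
    by (intro sum.neutral ballI) (simp only: that not_False_eq_True mult_zero_right)
  then have "Ddet A B = (\<Sum>p | p permutes (UNIV :: 'n set). if p = id then
      (\<Sum>i\<in>UNIV. B $ i $ i * (\<Prod>j\<in>UNIV - {i}. A $ j $ j)) else 0)"
    unfolding Ddet_expand by (intro sum.cong refl) (auto simp: sign_id)
  also have "\<dots> = (\<Sum>i\<in>UNIV. B $ i $ i * (\<Prod>j\<in>UNIV - {i}. A $ j $ j))"
    by (simp add: permutes_id finite_permutations sum.delta)
  finally show ?thesis .
qed

lemma det_diagonal_matrix:
  fixes A :: "complex^'n::finite^'n"
  assumes "\<And>i j. i \<noteq> j \<Longrightarrow> A $ i $ j = 0"
  shows "det A = (\<Prod>i\<in>UNIV. A $ i $ i)"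
  using det_diagonal assms by blast

lemma det_nonzero_solve:
  fixes A :: "complex^'n::finite^'n"
  assumes "det A \<noteq> 0"
  obtains u where "A *v u = v"
proof -
  obtain B where "A ** B = mat 1" using assms invertible_det_nz[of A] unfolding invertible_def by blast
  then have "A *v (B *v v) = v" by (simp add: matrix_vector_mul_assoc)
  then show ?thesis using that by blast
qed

text \<open>One of the summands of \<open>Ddet\<close> is nonzero, so the columns of
  \<open>A\<close> together with a single column of \<open>B\<close> span everything: the image of
  \<open>A\<close> has codimension at most one.\<close>

lemma Ddet_nonzero_corank:
  fixes A B :: "complex^'n::finite^'n"
  assumes "Ddet A B \<noteq> 0"
  obtains w where "\<And>v. \<exists>u c. v = A *v u + c *s w"
proof -
  obtain j where j: "det (\<chi> i k. if k = j then B $ i $ k else A $ i $ k) \<noteq> 0"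
    using assms unfolding Ddet_def by (meson sum.not_neutral_contains_not_neutral)
  let ?A = "\<chi> i k. if k = j then B $ i $ k else A $ i $ k"
  have "\<exists>u c. v = A *v u + c *s column j B" for v
  proof -
    obtain u where u: "?A *v u = v" using det_nonzero_solve[OF j] by blast
    have "?A *v u = A *v (\<chi> k. if k = j then 0 else u $ k) + u $ j *s column j B"
    proof (subst vec_eq_iff, intro allI)
      fix i
      have "(?A *v u) $ i = (\<Sum>k\<in>UNIV. A $ i $ k * (if k = j then 0 else u $ k)
          + (if k = j then B $ i $ k * u $ k else 0))"
        by (auto simp: matrix_vector_mult_def intro!: sum.cong)
      then show "(?A *v u) $ i = (A *v (\<chi> k. if k = j then 0 else u $ k) + u $ j *s column j B) $ i"
        by (simp add: matrix_vector_mult_def sum.distrib column_def mult.commute)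
    qed
    then show ?thesis using u by metis
  qed
  then show ?thesis using that by blast
qed

text \<open>The image of \<open>A\<close> has codimension at most one and lies in the kernel of the
  nonzero form \<open>\<phi>\<close>, so it equals that kernel. Here a single linear condition,
  tangency or vanishing of a character, becomes membership in an image.\<close>

lemma Ddet_nonzero_range:
  fixes A B :: "complex^'n::finite^'n"
  assumes "Ddet A B \<noteq> 0" "Vector_Spaces.linear (*s) (*) \<phi>" "\<And>u. \<phi> (A *v u) = 0"
    "\<phi> y \<noteq> 0" "\<phi> x = 0"
  shows "\<exists>u. x = A *v u"
proof -
  obtain w where w: "\<And>v. \<exists>u c. v = A *v u + c *s w" using Ddet_nonzero_corank[OF assms(1)] by blast
  have eq: "\<phi> (A *v u + c *s w) = c * \<phi> w" for u c
    using assms(2,3) by (simp add: linear_form_iff)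
  obtain u c where y: "y = A *v u + c *s w" using w by blast
  obtain u' c' where x: "x = A *v u' + c' *s w" using w by blast
  have "\<phi> w \<noteq> 0" using assms(4) eq y by auto
  then have "c' = 0" using assms(5) eq x by auto
  then show ?thesis using x by auto
qed

section \<open>Finite-dimensional commutative algebras\<close>

definition unital_algebra ::
  "(complex^'n \<Rightarrow> complex^'n \<Rightarrow> complex^'n) \<Rightarrow> complex^'n \<Rightarrow> bool" where
  "unital_algebra mu e \<longleftrightarrow> (\<forall>u. Vector_Spaces.linear (*s) (*s) (mu u)) \<and> (\<forall>u v. mu u v = mu v u) \<and>
     (\<forall>u v w. mu (mu u v) w = mu u (mu v w)) \<and> (\<forall>v. mu e v = v)"

definition character ::
  "(complex^'n \<Rightarrow> complex^'n \<Rightarrow> complex^'n) \<Rightarrow> complex^'n \<Rightarrow> (complex^'n \<Rightarrow> complex) \<Rightarrow> bool" where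
  "character mu e \<xi> \<longleftrightarrow> Vector_Spaces.linear (*s) (*) \<xi> \<and> \<xi> e = 1 \<and> (\<forall>u v. \<xi> (mu u v) = \<xi> u * \<xi> v)"

context
  fixes mu :: "complex^'n::finite \<Rightarrow> complex^'n \<Rightarrow> complex^'n" and e :: "complex^'n"
  assumes alg: "unital_algebra mu e"
begin

lemma alg_linear: "Vector_Spaces.linear (*s) (*s) (mu u)"
  using alg by (simp add: unital_algebra_def)

lemma alg_add_right: "mu u (v + w) = mu u v + mu u w"
  and alg_smult_right: "mu u (c *s v) = c *s mu u v"
  using alg_linear unfolding vlinear_iff by auto

lemma alg_commute: "mu u v = mu v u"
  using alg unfolding unital_algebra_def by blast

lemma alg_assoc: "mu (mu u v) w = mu u (mu v w)"
  using alg unfolding unital_algebra_def by blast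

lemma alg_left_commute: "mu u (mu v w) = mu v (mu u w)"
  using alg_assoc[of u v w] alg_assoc[of v u w] alg_commute[of u v] by simp

lemma alg_unit: "mu e v = v" "mu v e = v"
  using alg alg_commute by (auto simp: unital_algebra_def)

lemma alg_add_left: "mu (v + w) u = mu v u + mu w u"
  and alg_smult_left: "mu (c *s v) u = c *s mu v u"
  using alg_add_right alg_smult_right alg_commute by metis+

lemma alg_zero: "mu u 0 = 0" "mu 0 u = 0"
  using alg_smult_right[of u 0 0] alg_smult_left[of 0 0 u] by auto

lemma alg_diff_right: "mu u (v - w) = mu u v - mu u w"
  using alg_add_right[of u "v - w" w] by simp

lemma alg_diff_left: "mu (v - w) u = mu v u - mu w u"
  using alg_add_left[of "v - w" w u] by simp

lemma alg_sum_right: "mu u (\<Sum>i\<in>I. f i) = (\<Sum>i\<in>I. mu u (f i))"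
  by (induction I rule: infinite_finite_induct) (auto simp: alg_zero alg_add_right)

lemma alg_sum_left: "mu (\<Sum>i\<in>I. f i) u = (\<Sum>i\<in>I. mu (f i) u)"
  by (induction I rule: infinite_finite_induct) (auto simp: alg_zero alg_add_left)

lemma alg_matrix: "matrix (mu u) *v v = mu u v"
  using matrix_works[OF alg_linear] by blast

lemma alg_unit_nonzero: "e \<noteq> 0"
proof
  assume "e = 0"
  then have "v = 0" for v :: "complex^'n" using alg_unit(1)[of v] by (simp add: alg_zero)
  then have "(\<chi> i. (1::complex)) = (0 :: complex^'n)" by blast
  then show False by (simp add: vec_eq_iff)
qed

lemma alg_invertible:
  assumes "mu u v = e"
  shows "det (matrix (mu u)) \<noteq> 0"
proof -
  have "matrix (mu u) *v (mu v w) = w" for w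
    using assms by (simp add: alg_matrix alg_assoc[symmetric] alg_unit)
  then have "\<forall>w. \<exists>x. matrix (mu u) *v x = w" by blast
  then have "\<exists>B. matrix (mu u) ** B = mat 1"
    unfolding matrix_right_invertible_surjective by (simp add: surj_def) metis
  then show ?thesis by (metis det_I det_mul mult_zero_left zero_neq_one)
qed

lemma alg_polynomial_relation:
  obtains p where "p \<noteq> 0" "degree p \<le> CARD('n)"
    "(\<Sum>i\<le>CARD('n). coeff p i *s ((mu u ^^ i) e)) = 0"
proof -
  let ?n = "CARD('n)" and ?w = "\<lambda>i. (mu u ^^ i) e"
  have "\<exists>c. (\<exists>i\<le>?n. c i \<noteq> 0) \<and> (\<Sum>i\<le>?n. c i *s ?w i) = 0"
  \<comment> \<open>Linear dependence is a notion for sets, so a repeated power of \<open>u\<close>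
    is treated separately; it gives the relation \<open>w i - w j = 0\<close> at once. Otherwise
    there are \<open>n + 1\<close> vectors in dimension \<open>n\<close>.\<close>
  proof (cases "inj_on ?w {..?n}")
    case False
    then obtain i j where ij: "i \<le> ?n" "j \<le> ?n" "i \<noteq> j" "?w i = ?w j"
      by (auto simp: inj_on_def)
    let ?c = "\<lambda>k. if k = i then 1 else if k = j then -1 else (0::complex)"
    have "(\<Sum>k\<le>?n. ?c k *s ?w k) = (\<Sum>k\<le>?n. (if k = i then ?w i else 0) - (if k = j then ?w j else 0))"
      using ij by (intro sum.cong) (auto simp: vec_eq_iff)
    also have "\<dots> = 0" using ij by (simp add: sum_subtractf)
    finally have "(\<Sum>k\<le>?n. ?c k *s ?w k) = 0" .
    then show ?thesis using ij(1) by (intro exI[of _ ?c]) (auto intro!: exI[of _ i])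
  next
    case True
    have "card (?w ` {..?n}) = Suc ?n" by (simp add: card_image[OF True])
    have "vec.dependent (?w ` {..?n})"
    proof (rule ccontr)
      assume "\<not> vec.dependent (?w ` {..?n})"
      then have "card (?w ` {..?n}) \<le> vec.dim (UNIV :: (complex^'n) set)"
        by (intro vec.independent_card_le_dim) auto
      then show False using \<open>card (?w ` {..?n}) = Suc ?n\<close> unfolding vec_dim_card by linarith
    qed
    then obtain c v where c: "v \<in> ?w ` {..?n}" "c v \<noteq> 0" "(\<Sum>v\<in>?w ` {..?n}. c v *s v) = 0"
      using vec.dependent_finite[of "?w ` {..?n}"] by auto
    have "(\<Sum>i\<le>?n. c (?w i) *s ?w i) = 0"
      using c(3) by (simp add: sum.reindex[OF True] o_def)
    then show ?thesis using c(1,2) by (intro exI[of _ "\<lambda>i. c (?w i)"]) auto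
  qed
  then obtain c i where c: "i \<le> ?n" "c i \<noteq> 0" "(\<Sum>i\<le>?n. c i *s ?w i) = 0" by blast
  define p where "p = Abs_poly (\<lambda>i. if i \<le> ?n then c i else 0)"
  have p: "coeff p i = (if i \<le> ?n then c i else 0)" for i
    unfolding p_def by (subst coeff_Abs_poly[of ?n]) auto
  have "p \<noteq> 0" using p[of i] c by auto
  moreover have "degree p \<le> ?n" by (intro degree_le) (auto simp: p)
  moreover have "(\<Sum>i\<le>?n. coeff p i *s ?w i) = 0" using c(3) by (simp add: p)
  ultimately show ?thesis using that by blast
qed

text \<open>Among the proper ideals containing \<open>E\<close> one of maximal dimension is taken.
  The quotient is a field of finite dimension over the complex numbers, hence equal to them, and the
  quotient map is the character.\<close>

lemma exists_character:
  assumes "det (matrix (mu E)) = 0"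
  obtains \<xi> where "character mu e \<xi>" "\<xi> E = 0"
proof -
  let ?P = "\<lambda>I. algebra_ideal mu I \<and> E \<in> I \<and> e \<notin> I"
  have "?P (range (mu E))"
  proof (intro conjI)
    have "vec.subspace (range (mu E))"
      using alg_add_right alg_smult_right alg_zero(1)
      unfolding vec.subspace_def by (metis (no_types, lifting) rangeE rangeI)
    moreover have "mu u v \<in> range (mu E)" if v: "v \<in> range (mu E)" for u v
    proof -
      obtain w where "v = mu E w" using v by blast
      then have "mu u v = mu E (mu u w)" using alg_left_commute by blast
      then show ?thesis by blast
    qed
    ultimately show "algebra_ideal mu (range (mu E))" unfolding algebra_ideal_def by blast
    show "E \<in> range (mu E)" using alg_unit(2) by (metis rangeI)
    show "e \<notin> range (mu E)" using alg_invertible assms by auto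
  qed
  moreover have "vec.dim I < Suc (vec.dim (UNIV :: (complex^'n) set))" for I :: "(complex^'n) set"
    by (simp only: less_Suc_eq_le vec.dim_subset subset_UNIV)
  ultimately have "\<exists>I. ?P I \<and> (\<forall>J. ?P J \<longrightarrow> vec.dim J \<le> vec.dim I)"
    by (intro ex_has_greatest_nat) auto
  then obtain I where I: "?P I" and max: "\<And>J. ?P J \<Longrightarrow> vec.dim J \<le> vec.dim I"
    by blast
  have sub: "vec.subspace I" and ideal: "\<And>u v. v \<in> I \<Longrightarrow> mu u v \<in> I" and e: "e \<notin> I"
    using I unfolding algebra_ideal_def by auto
  have ideal': "mu v u \<in> I" if "v \<in> I" for u v using ideal[OF that] alg_commute by metis
  \<comment> \<open>An element outside \<open>I\<close> is invertible modulo \<open>I\<close>, since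
    otherwise \<open>I\<close> together with its multiples would be a larger proper ideal.\<close>
  have inv: "\<exists>a b. a \<in> I \<and> e = a + mu x b" if x: "x \<notin> I" for x
  proof (rule ccontr)
    assume no: "\<not> ?thesis"
    let ?J = "{a + mu x b | a b. a \<in> I}"
    have "vec.subspace ?J"
      unfolding vec.subspace_def
    proof (intro conjI ballI allI)
      have "0 + mu x 0 \<in> ?J" using vec.subspace_0[OF sub] by blast
      then show "0 \<in> ?J" by (simp add: alg_zero)
      show "y + z \<in> ?J" if yz: "y \<in> ?J" "z \<in> ?J" for y z
      proof -
        obtain a b a' b' where "y = a + mu x b" "z = a' + mu x b'" "a \<in> I" "a' \<in> I"
          using yz by blast
        then have "y + z = (a + a') + mu x (b + b')" "a + a' \<in> I"
          using vec.subspace_add[OF sub] by (auto simp: alg_add_right)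
        then show ?thesis by blast
      qed
      show "c *s y \<in> ?J" if y: "y \<in> ?J" for c y
      proof -
        obtain a b where "y = a + mu x b" "a \<in> I" using y by blast
        then have "c *s y = c *s a + mu x (c *s b)" "c *s a \<in> I"
          using vec.subspace_scale[OF sub] by (auto simp: alg_smult_right vec.scale_right_distrib)
        then show ?thesis by blast
      qed
    qed
    moreover have "mu u y \<in> ?J" if y: "y \<in> ?J" for u y
    proof -
      obtain a b where ab: "y = a + mu x b" "a \<in> I" using y by blast
      then have "mu u y = mu u a + mu x (mu u b)"
        by (simp only: alg_add_right alg_left_commute[of u x b])
      then show ?thesis using ideal[OF ab(2)] by blast
    qed
    moreover have IJ: "I \<subseteq> ?J"
    proof
      fix a assume "a \<in> I"
      moreover have "a = a + mu x 0" by (simp add: alg_zero)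
      ultimately show "a \<in> ?J" by blast
    qed
    moreover have "e \<notin> ?J" using no by blast
    ultimately have PJ: "?P ?J" using I unfolding algebra_ideal_def by blast
    then have "vec.dim ?J \<le> vec.dim I" by (rule max)
    then have "I = ?J"
      using vec.subspace_dim_equal[OF sub _ IJ] PJ unfolding algebra_ideal_def by blast
    moreover have "0 + mu x e \<in> ?J" using vec.subspace_0[OF sub] by blast
    ultimately show False using x by (simp add: alg_unit)
  qed
  \<comment> \<open>If \<open>u\<close> is not a scalar modulo \<open>I\<close>, a polynomial of
    least degree annihilating \<open>u\<close> modulo \<open>I\<close> has a root \<open>c\<close>.
    As \<open>u - c e\<close> is invertible modulo \<open>I\<close>, the factor belonging to
    \<open>c\<close> cancels and the degree drops.\<close>
  have scalar: "\<exists>c. u - c *s e \<in> I" for u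
  proof (rule ccontr)
    assume no: "\<not> ?thesis"
    let ?n = "CARD('n)"
    define ev where "ev = (\<lambda>p. \<Sum>i\<le>?n. coeff p i *s ((mu u ^^ i) e))"
    let ?Q = "\<lambda>p. p \<noteq> 0 \<and> degree p \<le> ?n \<and> ev p \<in> I"
    obtain p0 where "p0 \<noteq> 0" "degree p0 \<le> ?n" "ev p0 = 0"
      unfolding ev_def by (rule alg_polynomial_relation[of u])
    then have "?Q p0" using vec.subspace_0[OF sub] by simp
    then have "\<exists>p. ?Q p" by (rule exI)
    then have "\<exists>p. ?Q p \<and> (\<forall>q. ?Q q \<longrightarrow> degree p \<le> degree q)"
      by (elim exE) (rule ex_has_least_nat)
    then obtain p where p: "?Q p" and min: "\<And>q. ?Q q \<Longrightarrow> degree p \<le> degree q"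
      by blast
    have "degree p \<noteq> 0"
    proof
      assume "degree p = 0"
      then obtain c where c: "p = [:c:]" by (meson degree_eq_zeroE)
      then have "ev p = (\<Sum>i\<le>?n. if i = 0 then c *s e else 0)"
        unfolding ev_def by (intro sum.cong) (auto simp: coeff_pCons split: nat.split)
      then have "c *s e \<in> I" using p by simp
      then have "inverse c *s (c *s e) \<in> I" by (rule vec.subspace_scale[OF sub])
      then show False using p c e by simp
    qed
    then have "\<not> constant (poly p)" by (simp add: constant_degree)
    then obtain c where "poly p c = 0" using fundamental_theorem_of_algebra[of p] by blast
    then have "[:- c, 1:] dvd p" by (simp add: poly_eq_0_iff_dvd)
    then obtain q where q: "p = [:- c, 1:] * q" by (elim dvdE)
    have q0: "q \<noteq> 0" using p q by auto
    then have dq: "degree p = Suc (degree q)" unfolding q by (subst degree_mult_eq) auto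
    have "ev p = mu u (ev q) - c *s ev q"
    proof -
      have cp: "coeff p i = (case i of 0 \<Rightarrow> 0 | Suc j \<Rightarrow> coeff q j) - c * coeff q i" for i
        unfolding q by (simp add: coeff_pCons split: nat.split)
      have "ev p = (\<Sum>i\<le>?n. (case i of 0 \<Rightarrow> 0 | Suc j \<Rightarrow> coeff q j) *s ((mu u ^^ i) e)) - c *s ev q"
        unfolding ev_def cp by (simp add: vec.scale_left_diff_distrib sum_subtractf vec.scale_sum_right)
      moreover have "(\<Sum>i\<le>?n. (case i of 0 \<Rightarrow> 0 | Suc j \<Rightarrow> coeff q j) *s ((mu u ^^ i) e))
          = (\<Sum>i<?n. coeff q i *s ((mu u ^^ Suc i) e))"
        by (subst sum.atMost_shift) simp
      \<comment> \<open>The degree of \<open>q\<close> is one less than that of \<open>p\<close>, so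
        the summand added at index \<open>n\<close> has coefficient 0.\<close>
      moreover have "\<dots> = (\<Sum>i\<le>?n. coeff q i *s ((mu u ^^ Suc i) e))"
        using dq p by (subst lessThan_Suc_atMost[symmetric]) (simp add: coeff_eq_0)
      moreover have "\<dots> = mu u (ev q)"
        by (simp add: ev_def alg_sum_right alg_smult_right)
      ultimately show ?thesis by simp
    qed
    then have prod: "mu (u - c *s e) (ev q) \<in> I"
      using p by (simp add: alg_diff_left alg_smult_left alg_unit)
    obtain a b where ab: "a \<in> I" "e = a + mu (u - c *s e) b" using inv no by metis
    have "ev q = mu e (ev q)" by (simp add: alg_unit)
    also have "\<dots> = mu a (ev q) + mu (mu (u - c *s e) b) (ev q)"
      by (subst ab(2)) (rule alg_add_left)
    also have "mu (mu (u - c *s e) b) (ev q) = mu b (mu (u - c *s e) (ev q))"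
      by (simp only: alg_assoc alg_left_commute[of "u - c *s e" b])
    finally have "ev q \<in> I"
      using ideal'[OF ab(1)] ideal[OF prod] vec.subspace_add[OF sub] by metis
    then show False using min[of q] q0 dq p by auto
  qed
  have uniq: "c = d" if "u - c *s e \<in> I" "u - d *s e \<in> I" for u c d
  proof (rule ccontr)
    assume "c \<noteq> d"
    have "(u - d *s e) - (u - c *s e) \<in> I" using that vec.subspace_diff[OF sub] by blast
    then have "(c - d) *s e \<in> I" by (simp add: vec.scale_left_diff_distrib)
    then have "inverse (c - d) *s ((c - d) *s e) \<in> I" by (rule vec.subspace_scale[OF sub])
    moreover have "inverse (c - d) *s ((c - d) *s e) = e"
      using \<open>c \<noteq> d\<close> by (simp only: vec.scale_scale) simp
    ultimately show False using e by simp
  qed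
  define \<xi> where "\<xi> = (\<lambda>u. SOME c. u - c *s e \<in> I)"
  have \<xi>: "u - \<xi> u *s e \<in> I" for u unfolding \<xi>_def by (rule someI_ex[OF scalar])
  have \<xi>I: "\<xi> u = c" if "u - c *s e \<in> I" for u c using uniq \<xi> that by blast
  have "\<xi> (u + v) = \<xi> u + \<xi> v" for u v
  proof (rule \<xi>I)
    have "(u - \<xi> u *s e) + (v - \<xi> v *s e) \<in> I" using \<xi> vec.subspace_add[OF sub] by blast
    then show "u + v - (\<xi> u + \<xi> v) *s e \<in> I" by (simp add: vec.scale_left_distrib algebra_simps)
  qed
  moreover have "\<xi> (c *s u) = c * \<xi> u" for c u
  proof (rule \<xi>I)
    have "c *s (u - \<xi> u *s e) \<in> I" using \<xi> vec.subspace_scale[OF sub] by blast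
    then show "c *s u - (c * \<xi> u) *s e \<in> I" by (simp add: vec.scale_right_diff_distrib)
  qed
  moreover have "\<xi> e = 1" by (rule \<xi>I) (simp add: vec.subspace_0[OF sub])
  moreover have "\<xi> (mu u v) = \<xi> u * \<xi> v" for u v
  proof (rule \<xi>I)
    have "mu (u - \<xi> u *s e) v + \<xi> u *s (v - \<xi> v *s e) \<in> I"
      by (intro vec.subspace_add[OF sub] vec.subspace_scale[OF sub] ideal' \<xi>)
    then show "mu u v - (\<xi> u * \<xi> v) *s e \<in> I"
      by (simp add: alg_diff_left alg_smult_left alg_unit vec.scale_right_diff_distrib)
  qed
  moreover have "\<xi> E = 0" by (rule \<xi>I) (use I in simp)
  ultimately have "character mu e \<xi> \<and> \<xi> E = 0" by (simp add: character_def linear_form_iff)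
  then show ?thesis using that by blast
qed

lemma character_add: "character mu e \<xi> \<Longrightarrow> \<xi> (u + v) = \<xi> u + \<xi> v"
  and character_smult: "character mu e \<xi> \<Longrightarrow> \<xi> (c *s v) = c * \<xi> v"
  and character_mult: "character mu e \<xi> \<Longrightarrow> \<xi> (mu u v) = \<xi> u * \<xi> v"
  by (auto simp: character_def linear_form_iff)

lemma character_zero: "character mu e \<xi> \<Longrightarrow> \<xi> 0 = 0"
  using character_smult[of \<xi> 0 0] by simp

lemma character_singular:
  assumes "character mu e \<xi>" "\<xi> E = 0"
  shows "det (matrix (mu E)) = 0"
proof (rule ccontr)
  assume "det (matrix (mu E)) \<noteq> 0"
  then obtain v where "matrix (mu E) *v v = e" using det_nonzero_solve by blast
  then have "\<xi> (mu E v) = 1" using assms by (simp add: alg_matrix character_def)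
  then show False using assms by (simp add: character_def)
qed

text \<open>The common kernel \<open>N\<close> of the characters has a complementary ideal, and the
  component \<open>a\<close> of the unit in \<open>N\<close> is idempotent. If
  \<open>a \<noteq> 0\<close>, then \<open>e - a\<close> is a zero divisor, so some character kills
  it and takes the value 1 on \<open>a\<close>, against \<open>a \<in> N\<close>. Hence the
  complement contains the unit and \<open>N = 0\<close>.\<close>

lemma semisimple_characters_separate:
  assumes "semisimple_algebra mu" and v: "\<And>\<xi>. character mu e \<xi> \<Longrightarrow> \<xi> v = 0"
  shows "v = 0"
proof -
  define N where "N = {v. \<forall>\<xi>. character mu e \<xi> \<longrightarrow> \<xi> v = 0}"
  have ideal: "algebra_ideal mu N"
    unfolding algebra_ideal_def vec.subspace_def N_def
    by (auto simp: character_add character_smult character_mult character_zero)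
  obtain J where J: "algebra_ideal mu J" "N \<inter> J = {0}" "{u + v | u v. u \<in> N \<and> v \<in> J} = UNIV"
    using assms(1)[unfolded semisimple_algebra_def, rule_format, OF ideal] by (elim exE conjE)
  have "e \<in> {u + v | u v. u \<in> N \<and> v \<in> J}" by (simp only: J(3) UNIV_I)
  then obtain a b where ab: "e = a + b" "a \<in> N" "b \<in> J" by blast
  have "mu b a \<in> N" using ideal ab(2) unfolding algebra_ideal_def by blast
  then have "mu a b \<in> N" by (simp only: alg_commute[of a b])
  moreover have "mu a b \<in> J" using J(1) ab unfolding algebra_ideal_def by blast
  ultimately have "mu a b = 0" using J(2) by blast
  then have aa: "mu a a = a"
    using alg_unit(2)[of a] unfolding ab(1) by (simp add: alg_add_right)
  have "a = 0"
  proof (rule ccontr)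
    assume "a \<noteq> 0"
    have "mu (e - a) a = 0" by (simp add: alg_diff_left alg_unit aa)
    then have "matrix (mu (e - a)) *v a = 0" by (simp add: alg_matrix)
    then have "\<not> invertible (matrix (mu (e - a)))" using \<open>a \<noteq> 0\<close>
      unfolding invertible_def using matrix_left_invertible_ker by blast
    then have "det (matrix (mu (e - a))) = 0" by (simp add: invertible_det_nz)
    then obtain \<xi> where \<xi>: "character mu e \<xi>" "\<xi> (e - a) = 0" using exists_character by blast
    have "\<xi> e = \<xi> ((e - a) + a)" by simp
    also have "\<dots> = \<xi> (e - a) + \<xi> a" using \<xi>(1) unfolding character_def linear_form_iff by blast
    also have "\<dots> = 0" using \<xi> ab(2) unfolding N_def by auto
    finally show False using \<xi>(1) by (simp add: character_def)
  qed
  then have "e \<in> J" using ab by simp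
  then have "mu v e \<in> J" using J(1) unfolding algebra_ideal_def by blast
  moreover have "v \<in> N" using v by (simp add: N_def)
  ultimately show ?thesis using J(2) by (auto simp: alg_unit)
qed

text \<open>The rows of \<open>F\<close> are characters. They separate vectors, so the square matrix
  \<open>F\<close> is injective and hence invertible; as the characters are multiplicative,
  \<open>F\<close> carries the multiplication to the componentwise one. The columns of the inverse
  are the idempotents.\<close>

lemma semisimple_idempotent_basis:
  assumes "semisimple_algebra mu"
  obtains F :: "complex^'n^'n" and \<epsilon> :: "'n \<Rightarrow> complex^'n" where
    "\<And>i j. mu (\<epsilon> i) (\<epsilon> j) = (if i = j then \<epsilon> i else 0)"
    "\<And>v. v = (\<Sum>i\<in>UNIV. (F *v v) $ i *s \<epsilon> i)"
    "\<And>i j. (F *v \<epsilon> j) $ i = (if i = j then 1 else 0)"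
proof -
  let ?f = "\<lambda>(r::complex^'n) v. \<Sum>k\<in>UNIV. r $ k * v $ k"
  define R where "R = {r. character mu e (?f r)}"
  have char_R: "\<exists>r\<in>R. \<xi> = ?f r" if "character mu e \<xi>" for \<xi>
  proof -
    have lin: "Vector_Spaces.linear (*s) (*) \<xi>" using that by (simp add: character_def)
    have eq: "\<xi> = ?f (\<chi> k. \<xi> (axis k 1))"
      by (rule ext, subst linear_form_sum_axis[OF lin]) (simp add: mult.commute)
    have "character mu e (?f (\<chi> k. \<xi> (axis k 1)))" by (subst eq[symmetric]) (rule that)
    then show ?thesis using eq unfolding R_def by blast
  qed
  obtain B where B: "B \<subseteq> R" "vec.independent B" "R \<subseteq> vec.span B"
    using vec.maximal_independent_subset[of R] by blast
  have "det (matrix (mu 0)) = 0"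
  proof (rule ccontr)
    assume "det (matrix (mu 0)) \<noteq> 0"
    then obtain v where "matrix (mu 0) *v v = e" using det_nonzero_solve by blast
    then show False using alg_unit_nonzero by (simp add: alg_matrix alg_zero)
  qed
  then obtain \<xi>0 where "character mu e \<xi>0" using exists_character by blast
  then obtain r0 where r0: "r0 \<in> R" using char_R by blast
  have "0 \<notin> R" by (auto simp: R_def character_def)
  have "B \<noteq> {}"
  proof
    assume "B = {}"
    then have "r0 = 0" using r0 B(3) by auto
    then show False using r0 \<open>0 \<notin> R\<close> by simp
  qed
  have finB: "finite B" using B(2) vec.finiteI_independent by blast
  have "card B \<le> vec.dim (UNIV :: (complex^'n) set)"
    using B(2) by (intro vec.independent_card_le_dim) auto
  then have "card B \<le> card (UNIV :: 'n set)" unfolding vec_dim_card .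
  then obtain f :: "_ \<Rightarrow> 'n" where f: "inj_on f B"
    using card_le_inj[OF finB finite_class.finite_UNIV] by blast
  obtain b0 where "b0 \<in> B" using \<open>B \<noteq> {}\<close> by blast
  \<comment> \<open>There are at most \<open>n\<close> independent characters, so they are listed
    over the index type with \<open>b0\<close> as filler. Repetitions are conceivable at this stage;
    they do not affect the injectivity of \<open>F\<close>, which needs only that every element of
    \<open>B\<close> occurs.\<close>
  define r where "r = (\<lambda>i. if i \<in> f ` B then inv_into B f i else b0)"
  have rB: "range r = B"
  proof
    show "range r \<subseteq> B" using \<open>b0 \<in> B\<close> by (auto simp: r_def inv_into_into f)
    show "B \<subseteq> range r"
    proof
      fix b assume "b \<in> B"
      then have "r (f b) = b" using f by (simp add: r_def)
      then show "b \<in> range r" by (metis rangeI)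
    qed
  qed
  define F where "F = (\<chi> i k. r i $ k)"
  have F: "(F *v v) $ i = ?f (r i) v" for v i by (simp add: F_def matrix_vector_mult_def)
  have char: "character mu e (?f (r i))" for i
    using rB B(1) unfolding R_def by blast
  have inj: "v = 0" if Fv: "F *v v = 0" for v
  proof (rule semisimple_characters_separate[OF assms])
    have "?f b v = 0" if "b \<in> B" for b
    proof -
      have "b \<in> range r" using rB that by simp
      then obtain i where "b = r i" by blast
      then show ?thesis using F[of v i] Fv by simp
    qed
    then have B0: "B \<subseteq> {s. ?f s v = 0}" by blast
    have "vec.subspace {s. ?f s v = 0}"
    proof (unfold vec.subspace_def, intro conjI ballI allI)
      show "x + y \<in> {s. ?f s v = 0}" if "x \<in> {s. ?f s v = 0}" "y \<in> {s. ?f s v = 0}" for x y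
        using that by (simp add: distrib_right sum.distrib)
      show "c *s x \<in> {s. ?f s v = 0}" if "x \<in> {s. ?f s v = 0}" for c x
        using that by (simp add: mult.assoc sum_distrib_left[symmetric])
    qed simp
    then have "vec.span B \<subseteq> {s. ?f s v = 0}" by (rule vec.span_minimal[OF B0])
    then have R0: "R \<subseteq> {s. ?f s v = 0}" using B(3) by (rule subset_trans[rotated])
    fix \<xi> assume "character mu e \<xi>"
    then obtain s where s: "s \<in> R" "\<xi> = ?f s" using char_R by blast
    have "?f s v = 0" using R0 s(1) by auto
    then show "\<xi> v = 0" using s(2) by simp
  qed
  then obtain G where G: "G ** F = mat 1" using matrix_left_invertible_ker[of F] by auto
  then have FG: "F ** G = mat 1" using matrix_left_right_inverse by blast
  define \<epsilon> where "\<epsilon> = (\<lambda>j. column j G)"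
  have F\<epsilon>: "(F *v \<epsilon> j) $ i = (if i = j then 1 else 0)" for i j
  proof -
    have "(F *v \<epsilon> j) $ i = (F ** G) $ i $ j"
      by (simp add: \<epsilon>_def column_def matrix_vector_mult_def matrix_matrix_mult_def)
    then show ?thesis by (simp add: FG mat_def)
  qed
  have mult: "(F *v mu u v) $ i = (F *v u) $ i * (F *v v) $ i" for u v i
    using char[of i] unfolding F character_def by blast
  have "mu (\<epsilon> i) (\<epsilon> j) = (if i = j then \<epsilon> i else 0)" for i j
  proof -
    have "F *v (mu (\<epsilon> i) (\<epsilon> j) - (if i = j then \<epsilon> i else 0)) = 0"
      by (auto simp: vec_eq_iff matrix_vector_mult_diff_distrib mult F\<epsilon>)
    then show ?thesis using inj by force
  qed
  moreover have "v = (\<Sum>i\<in>UNIV. (F *v v) $ i *s \<epsilon> i)" for v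
  proof -
    have "v = G *v (F *v v)" by (simp add: matrix_vector_mul_assoc G)
    then show ?thesis unfolding \<epsilon>_def by (simp only: matrix_mult_sum[of G "F *v v", symmetric])
  qed
  ultimately show ?thesis using that F\<epsilon> by blast
qed

end

section \<open>Integral curves in complex time\<close>

lemma vholomorphic_Lipschitz:
  fixes f :: "complex^'k::finite \<Rightarrow> complex^'m::finite"
  assumes "vholomorphic_on f S" "cball z0 R \<subseteq> S"
  obtains L where "L \<ge> 0"
    "\<And>x y i. x \<in> cball z0 R \<Longrightarrow> y \<in> cball z0 R \<Longrightarrow> cmod (f x $ i - f y $ i) \<le> L * norm (x - y)"
proof -
  let ?D = "\<lambda>i j z. frechet_derivative (\<lambda>z. f z $ i) (at z) (axis j 1)"
  have "\<exists>B. \<forall>z\<in>cball z0 R. cmod (?D i j z) \<le> B" for i j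
  proof -
    have "continuous_on (cball z0 R) (?D i j)"
      using mholomorphic_continuous_on[OF mholomorphic_frechet_derivative] assms
        continuous_on_subset by blast
    then have "bounded (?D i j ` cball z0 R)"
      using compact_continuous_image compact_cball compact_imp_bounded by blast
    then show ?thesis unfolding bounded_iff by auto
  qed
  then obtain B where B: "\<And>i j z. z \<in> cball z0 R \<Longrightarrow> cmod (?D i j z) \<le> B i j" by metis
  define K where "K = (\<Sum>i\<in>UNIV. \<Sum>j\<in>UNIV. \<bar>B i j\<bar>)"
  have K: "(\<Sum>j\<in>UNIV. \<bar>B i j\<bar>) \<le> K" for i
    unfolding K_def by (rule member_le_sum) (auto intro: sum_nonneg)
  have "cmod (f x $ i - f y $ i) \<le> K * norm (x - y)" if "x \<in> cball z0 R" "y \<in> cball z0 R" for x y i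
  proof (rule differentiable_bound[OF convex_cball, of z0 R])
    fix z assume z: "z \<in> cball z0 R"
    show "((\<lambda>z. f z $ i) has_derivative frechet_derivative (\<lambda>z. f z $ i) (at z)) (at z within cball z0 R)"
      using mholomorphic_has_derivative assms z has_derivative_at_withinI by blast
    show "onorm (frechet_derivative (\<lambda>z. f z $ i) (at z)) \<le> K"
    proof (rule onorm_le)
      fix v :: "complex^'k"
      have "z \<in> S" using z assms(2) by blast
      then have lin: "Vector_Spaces.linear (*s) (*) (frechet_derivative (\<lambda>z. f z $ i) (at z))"
        using mholomorphic_linear[of "\<lambda>z. f z $ i" S z] assms(1) by blast
      have "cmod (frechet_derivative (\<lambda>z. f z $ i) (at z) v) = cmod (\<Sum>j\<in>UNIV. v $ j * ?D i j z)"
        by (rule arg_cong[where f = cmod]) (rule linear_form_sum_axis[OF lin])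
      also have "\<dots> \<le> (\<Sum>j\<in>UNIV. cmod (v $ j * ?D i j z))" by (rule norm_sum)
      also have "\<dots> \<le> (\<Sum>j\<in>UNIV. \<bar>B i j\<bar> * norm v)"
      proof (rule sum_mono)
        fix j
        have "cmod (?D i j z) \<le> \<bar>B i j\<bar>" using B[OF z, of i j] by linarith
        then show "cmod (v $ j * ?D i j z) \<le> \<bar>B i j\<bar> * norm v"
          unfolding norm_mult mult.commute[of "\<bar>B i j\<bar>"]
          by (intro mult_mono Finite_Cartesian_Product.norm_nth_le) auto
      qed
      also have "\<dots> \<le> K * norm v"
        using K[of i] by (simp add: sum_distrib_right[symmetric] mult_right_mono)
      finally show "cmod (frechet_derivative (\<lambda>z. f z $ i) (at z) v) \<le> K * norm v" .
    qed
  qed (use that in auto)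
  moreover have "K \<ge> 0" unfolding K_def by (intro sum_nonneg) auto
  ultimately show ?thesis using that by blast
qed

lemma norm_vec_le_card:
  fixes v :: "complex^'k::finite"
  assumes "\<And>i. cmod (v $ i) \<le> b"
  shows "norm v \<le> of_nat CARD('k) * b"
proof -
  have "norm v \<le> (\<Sum>i\<in>UNIV. cmod (v $ i))" unfolding norm_vec_def by (rule L2_set_le_sum) auto
  also have "\<dots> \<le> (\<Sum>i\<in>(UNIV :: 'k set). b)" using assms by (intro sum_mono)
  finally show ?thesis by simp
qed

text \<open>Picard iteration in complex time, integrating along the segment from 0. Since the
  integrands turn out to be holomorphic on a disc, this integral is a primitive and the iterates are
  holomorphic again.\<close>

fun picard :: "(complex^'k \<Rightarrow> complex^'k) \<Rightarrow> complex^'k \<Rightarrow> nat \<Rightarrow> complex \<Rightarrow> complex^'k" where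
  "picard f z 0 s = z"
| "picard f z (Suc n) s = (\<chi> i. z $ i + contour_integral (linepath 0 s) (\<lambda>w. f (picard f z n w) $ i))"

text \<open>Starting points are restricted to half the radius so that one time radius
  \<open>r\<close> serves all of them. The uniform bound obtained later by division depends on
  this.\<close>

lemma holomorphic_integral_curve:
  fixes f :: "complex^'k::finite \<Rightarrow> complex^'k"
  assumes f: "vholomorphic_on f S" and R: "cball z0 R \<subseteq> S" "R > 0"
  obtains r where "r > 0" "\<And>z. z \<in> cball z0 (R/2) \<Longrightarrow>
    \<exists>\<gamma>. \<gamma> 0 = z \<and> (\<forall>s\<in>ball 0 r. \<gamma> s \<in> cball z0 R \<and>
      (\<forall>i. ((\<lambda>s. \<gamma> s $ i) has_field_derivative f (\<gamma> s) $ i) (at s)))"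
proof -
  obtain L where L: "L \<ge> 0" "\<And>x y i. x \<in> cball z0 R \<Longrightarrow> y \<in> cball z0 R \<Longrightarrow>
      cmod (f x $ i - f y $ i) \<le> L * norm (x - y)"
    using vholomorphic_Lipschitz[OF f R(1)] by blast
  have "continuous_on (cball z0 R) f"
    using vholomorphic_continuous_on[OF f] R(1) continuous_on_subset by blast
  then have "bounded (f ` cball z0 R)"
    using compact_continuous_image compact_cball compact_imp_bounded by blast
  then obtain B0 where "\<forall>y\<in>f ` cball z0 R. norm y \<le> B0" unfolding bounded_iff by blast
  then have B0: "\<And>x. x \<in> cball z0 R \<Longrightarrow> norm (f x) \<le> B0" by blast
  define B where "B = max B0 0"
  have B: "B \<ge> 0" "\<And>x i. x \<in> cball z0 R \<Longrightarrow> cmod (f x $ i) \<le> B"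
  proof -
    show "B \<ge> 0" by (simp add: B_def)
    show "cmod (f x $ i) \<le> B" if "x \<in> cball z0 R" for x i
      using B0[OF that] Finite_Cartesian_Product.norm_nth_le[of "f x" i] unfolding B_def by linarith
  qed
  let ?N = "real CARD('k)"
  \<comment> \<open>The first bound keeps the iterates within \<open>R / 2\<close> of the starting
    point, the second makes the iteration contract by 1/2. The factor \<open>CARD('k)\<close> is the
    price of estimating norms by components; the summands 1 avoid a zero denominator.\<close>
  define r where "r = min (R / (2 * ?N * (B + 1))) (1 / (2 * ?N * (L + 1)))"
  have N: "?N > 0" by simp
  have r0: "r > 0" unfolding r_def using N B L R by (auto intro!: divide_pos_pos mult_pos_pos add_nonneg_pos)
  have rB: "?N * (B * r) \<le> R / 2"
  proof -
    have "r \<le> R / (2 * ?N * (B + 1))" by (simp add: r_def)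
    then have "r * (2 * ?N * (B + 1)) \<le> R"
      using N B by (simp add: pos_le_divide_eq add_nonneg_pos)
    moreover have "?N * (B * r) * 2 \<le> r * (2 * ?N * (B + 1))"
      using N B r0 by (simp add: algebra_simps)
    ultimately show ?thesis by linarith
  qed
  have rL: "?N * (L * r) \<le> 1 / 2"
  proof -
    have "r \<le> 1 / (2 * ?N * (L + 1))" by (simp add: r_def)
    then have "r * (2 * ?N * (L + 1)) \<le> 1"
      using N L(1) by (simp add: pos_le_divide_eq add_nonneg_pos)
    moreover have "?N * (L * r) * 2 \<le> r * (2 * ?N * (L + 1))"
      using N L r0 by (simp add: algebra_simps)
    ultimately show ?thesis by linarith
  qed
  have "\<exists>\<gamma>. \<gamma> 0 = z \<and> (\<forall>s\<in>ball 0 r. \<gamma> s \<in> cball z0 R \<and>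
      (\<forall>i. ((\<lambda>s. \<gamma> s $ i) has_field_derivative f (\<gamma> s) $ i) (at s)))"
    if z: "z \<in> cball z0 (R/2)" for z
  proof -
    define \<Gamma> where "\<Gamma> = picard f z"
    have \<Gamma>0: "\<Gamma> 0 s = z" for s by (simp add: \<Gamma>_def)
    have \<Gamma>Suc: "\<Gamma> (Suc n) s $ i = z $ i + contour_integral (linepath 0 s) (\<lambda>w. f (\<Gamma> n w) $ i)"
      for n s i by (simp add: \<Gamma>_def)
    have seg: "w \<in> ball 0 r" if "s \<in> ball 0 r" "w \<in> closed_segment 0 s" for s w :: complex
    proof -
      have "closed_segment 0 s \<subseteq> ball 0 r"
        by (rule closed_segment_subset[OF _ _ convex_ball]) (use that r0 in auto)
      then show ?thesis using that by blast
    qed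
    have main: "(\<forall>s\<in>ball 0 r. \<Gamma> n s \<in> cball z0 R) \<and> (\<forall>i. (\<lambda>w. f (\<Gamma> n w) $ i) holomorphic_on ball 0 r) \<and>
      (\<forall>s\<in>ball 0 r. \<forall>i. ((\<lambda>s. \<Gamma> (Suc n) s $ i) has_field_derivative f (\<Gamma> n s) $ i) (at s))" for n
    proof -
      have hol: "(\<lambda>w. f (\<Gamma> n w) $ i) holomorphic_on ball 0 r"
        if inb: "\<forall>s\<in>ball 0 r. \<Gamma> n s \<in> cball z0 R"
          and dif: "\<forall>s\<in>ball 0 r. \<forall>i. \<exists>d. ((\<lambda>s. \<Gamma> n s $ i) has_field_derivative d) (at s)" for n i
        unfolding holomorphic_on_open[OF open_ball]
      proof
        fix s :: complex assume s: "s \<in> ball 0 r"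
        obtain d where "\<And>i. ((\<lambda>s. \<Gamma> n s $ i) has_field_derivative d i) (at s)"
          using dif s by metis
        then have "\<And>i. ((\<lambda>s. \<Gamma> n s $ i) has_field_derivative (\<chi> i. d i) $ i) (at s)" by simp
        then show "\<exists>f'. ((\<lambda>w. f (\<Gamma> n w) $ i) has_field_derivative f') (at s)"
          using has_field_derivative_compose_curve[of "\<lambda>z. f z $ i" S "\<Gamma> n" s "\<chi> i. d i"] f R(1) inb s
          by blast
      qed
      have der: "((\<lambda>s. \<Gamma> (Suc n) s $ i) has_field_derivative f (\<Gamma> n s) $ i) (at s)"
        if h: "(\<lambda>w. f (\<Gamma> n w) $ i) holomorphic_on ball 0 r" and s: "s \<in> ball 0 r" for n i s
      proof -
        obtain G where G: "\<And>w. w \<in> ball 0 r \<Longrightarrow>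
            (G has_field_derivative f (\<Gamma> n w) $ i) (at w within ball 0 r)"
          using holomorphic_convex_primitive'[OF convex_ball open_ball h] by blast
        have eq: "z $ i + (G w - G 0) = \<Gamma> (Suc n) w $ i" if "w \<in> ball 0 r" for w
        proof -
          have "((\<lambda>w. f (\<Gamma> n w) $ i) has_contour_integral (G (pathfinish (linepath 0 w)) - G (pathstart (linepath 0 w))))
              (linepath 0 w)"
            by (rule contour_integral_primitive[OF G]) (use seg[OF that] in auto)
          then show ?thesis by (simp add: \<Gamma>Suc contour_integral_unique)
        qed
        have "(G has_field_derivative f (\<Gamma> n s) $ i) (at s)"
          using G[OF s] at_within_open[OF s open_ball] by simp
        then have "((\<lambda>w. z $ i + (G w - G 0)) has_field_derivative 0 + (f (\<Gamma> n s) $ i - 0)) (at s)"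
          by (intro DERIV_add DERIV_diff DERIV_const)
        then have "((\<lambda>w. z $ i + (G w - G 0)) has_field_derivative f (\<Gamma> n s) $ i) (at s)"
          by simp
        then show ?thesis by (rule has_field_derivative_transform_within_open[OF _ open_ball s eq])
      qed
      show ?thesis
      proof (induction n)
        case 0
        have "\<forall>s\<in>ball 0 r. \<Gamma> 0 s \<in> cball z0 R" using z R(2) by (auto simp: \<Gamma>0)
        moreover have "(\<lambda>w. f (\<Gamma> 0 w) $ i) holomorphic_on ball 0 r" for i by (simp add: \<Gamma>0)
        ultimately show ?case using der by blast
      next
        case (Suc n)
        have in_ball: "\<Gamma> (Suc n) s \<in> cball z0 R" if s: "s \<in> ball 0 r" for s
        proof -
          have "cmod (contour_integral (linepath 0 s) (\<lambda>w. f (\<Gamma> n w) $ i)) \<le> B * r" for i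
          proof -
            have "(\<lambda>w. f (\<Gamma> n w) $ i) contour_integrable_on linepath 0 s"
              using Suc seg[OF s] by (intro contour_integrable_continuous_linepath)
                (meson continuous_on_subset holomorphic_on_imp_continuous_on subsetI)
            then have "cmod (contour_integral (linepath 0 s) (\<lambda>w. f (\<Gamma> n w) $ i)) \<le> B * norm (s - 0)"
              by (rule contour_integral_bound_linepath) (use B Suc seg[OF s] in auto)
            also have "\<dots> \<le> B * r" using B(1) s by (intro mult_left_mono) auto
            finally show ?thesis .
          qed
          then have "norm (\<Gamma> (Suc n) s - z) \<le> ?N * (B * r)"
            by (intro norm_vec_le_card) (simp add: \<Gamma>Suc)
          then have "norm (\<Gamma> (Suc n) s - z) \<le> R / 2" using rB by linarith
          moreover have "norm (z - z0) \<le> R / 2" using z by (simp add: dist_norm norm_minus_commute)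
          ultimately have "norm (\<Gamma> (Suc n) s - z0) \<le> R"
            using norm_triangle_ineq[of "\<Gamma> (Suc n) s - z" "z - z0"] by simp
          then show ?thesis by (simp add: dist_norm norm_minus_commute)
        qed
        have "(\<lambda>w. f (\<Gamma> (Suc n) w) $ i) holomorphic_on ball 0 r" for i
          by (rule hol) (use in_ball Suc in blast)+
        then show ?case using in_ball der by blast
      qed
    qed
    then have in_ball: "\<And>n s. s \<in> ball 0 r \<Longrightarrow> \<Gamma> n s \<in> cball z0 R"
      and hol: "\<And>n i. (\<lambda>w. f (\<Gamma> n w) $ i) holomorphic_on ball 0 r"
      and der: "\<And>n s i. s \<in> ball 0 r \<Longrightarrow>
        ((\<lambda>s. \<Gamma> (Suc n) s $ i) has_field_derivative f (\<Gamma> n s) $ i) (at s)" by blast+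
    have int: "(\<lambda>w. f (\<Gamma> n w) $ i) contour_integrable_on linepath 0 s" if s: "s \<in> ball 0 r" for n s i
      using hol[of n i] seg[OF s] by (intro contour_integrable_continuous_linepath)
        (meson continuous_on_subset holomorphic_on_imp_continuous_on subsetI)
    \<comment> \<open>Two points of the ball are at distance at most \<open>2 * R\<close>, which
      starts the geometric bound; each further iteration gains the factor 1/2 from
      \<open>rL\<close>.\<close>
    have contr: "norm (\<Gamma> (Suc n) s - \<Gamma> n s) \<le> (2 * R) * (1/2)^n" if "s \<in> ball 0 r" for n s
      using that
    proof (induction n arbitrary: s)
      case 0
      have "dist z0 (\<Gamma> 1 s) \<le> R" "dist z0 (\<Gamma> 0 s) \<le> R" using in_ball[OF 0] by auto
      then have "dist (\<Gamma> 1 s) (\<Gamma> 0 s) \<le> R + R"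
        using dist_triangle[of "\<Gamma> 1 s" "\<Gamma> 0 s" z0] by (simp add: dist_commute)
      then show ?case by (simp add: dist_norm)
    next
      case (Suc n)
      have "cmod ((\<Gamma> (Suc (Suc n)) s - \<Gamma> (Suc n) s) $ i) \<le> L * ((2 * R) * (1/2)^n) * r" for i
      proof -
        have e1: "(\<Gamma> (Suc (Suc n)) s - \<Gamma> (Suc n) s) $ i
            = contour_integral (linepath 0 s) (\<lambda>w. f (\<Gamma> (Suc n) w) $ i - f (\<Gamma> n w) $ i)"
          by (simp add: \<Gamma>Suc contour_integral_diff[OF int[OF Suc.prems] int[OF Suc.prems]])
        have e2: "cmod (contour_integral (linepath 0 s) (\<lambda>w. f (\<Gamma> (Suc n) w) $ i - f (\<Gamma> n w) $ i))
            \<le> L * ((2 * R) * (1/2)^n) * norm (s - 0)"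
        proof (rule contour_integral_bound_linepath)
          show "(\<lambda>w. f (\<Gamma> (Suc n) w) $ i - f (\<Gamma> n w) $ i) contour_integrable_on linepath 0 s"
            by (intro contour_integrable_diff int Suc.prems)
          show "0 \<le> L * (2 * R * (1 / 2) ^ n)" using L R by simp
          fix w assume "w \<in> closed_segment 0 s"
          then have w: "w \<in> ball 0 r" using seg Suc.prems by blast
          have "cmod (f (\<Gamma> (Suc n) w) $ i - f (\<Gamma> n w) $ i) \<le> L * norm (\<Gamma> (Suc n) w - \<Gamma> n w)"
            by (intro L in_ball w)
          also have "\<dots> \<le> L * (2 * R * (1 / 2) ^ n)" by (intro mult_left_mono L Suc.IH w)
          finally show "cmod (f (\<Gamma> (Suc n) w) $ i - f (\<Gamma> n w) $ i) \<le> L * (2 * R * (1 / 2) ^ n)" .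
        qed
        have "L * ((2 * R) * (1/2)^n) * norm (s - 0) \<le> L * ((2 * R) * (1/2)^n) * r"
          using L R Suc.prems by (intro mult_left_mono) auto
        then show ?thesis unfolding e1 by (rule order_trans[OF e2])
      qed
      then have "norm (\<Gamma> (Suc (Suc n)) s - \<Gamma> (Suc n) s) \<le> ?N * (L * ((2 * R) * (1/2)^n) * r)"
        by (rule norm_vec_le_card)
      also have "\<dots> = (?N * (L * r)) * ((2 * R) * (1/2)^n)" by simp
      also have "\<dots> \<le> (1/2) * ((2 * R) * (1/2)^n)" using R by (intro mult_right_mono rL) auto
      finally show ?case by simp
    qed
    define \<gamma> where "\<gamma> = (\<lambda>s. z + (\<Sum>n. \<Gamma> (Suc n) s - \<Gamma> n s))"
    have "uniform_limit (ball 0 r) (\<lambda>n s. \<Sum>i<n. \<Gamma> (Suc i) s - \<Gamma> i s) (\<lambda>s. \<Sum>n. \<Gamma> (Suc n) s - \<Gamma> n s) sequentially"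
      by (rule Weierstrass_m_test[OF contr]) (auto intro!: summable_mult summable_geometric)
    then have "uniform_limit (ball 0 r) (\<lambda>n s. z + (\<Sum>i<n. \<Gamma> (Suc i) s - \<Gamma> i s)) \<gamma> sequentially"
      unfolding \<gamma>_def by (intro uniform_limit_intros)
    moreover have "z + (\<Sum>i<n. \<Gamma> (Suc i) s - \<Gamma> i s) = \<Gamma> n s" for n s
      using sum_lessThan_telescope[of "\<lambda>i. \<Gamma> i s" n] by (simp add: \<Gamma>0)
    ultimately have ulim: "uniform_limit (ball 0 r) \<Gamma> \<gamma> sequentially"
      by simp
    have lim: "(\<lambda>n. \<Gamma> n s) \<longlonglongrightarrow> \<gamma> s" if "s \<in> ball 0 r" for s
      by (rule tendsto_uniform_limitI[OF ulim that])
    have \<gamma>_in: "\<gamma> s \<in> cball z0 R" if "s \<in> ball 0 r" for s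
      using Lim_in_closed_set[OF closed_cball _ _ lim[OF that]] in_ball[OF that] by simp
    have "\<gamma> 0 = z"
    proof -
      have "\<Gamma> n 0 = z" for n by (cases n) (auto simp: \<Gamma>0 \<Gamma>Suc vec_eq_iff)
      then show ?thesis using lim[of 0] r0 by (simp add: LIMSEQ_const_iff)
    qed
    moreover have "((\<lambda>s. \<gamma> s $ i) has_field_derivative f (\<gamma> s) $ i) (at s)" if s: "s \<in> ball 0 r" for s i
    proof -
      obtain \<rho> where \<rho>: "\<rho> > 0" "cball s \<rho> \<subseteq> ball 0 r" using s open_ball open_contains_cball by metis
      have der': "((\<lambda>s. \<Gamma> (Suc n) s $ i) has_field_derivative f (\<Gamma> n w) $ i) (at w)"
        if "w \<in> cball s \<rho>" for n w using der \<rho>(2) that by blast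
      have cont: "continuous_on (cball s \<rho>) (\<lambda>s. \<Gamma> (Suc n) s $ i)" for n
        using der' by (meson DERIV_isCont continuous_at_imp_continuous_on)
      have "uniform_limit (cball s \<rho>) (\<lambda>n s. \<Gamma> n s $ i) (\<lambda>s. \<gamma> s $ i) sequentially"
        by (rule bounded_linear.uniform_limit[OF bounded_linear_vec_nth])
          (rule uniform_limit_on_subset[OF ulim \<rho>(2)])
      then have ul: "uniform_limit (cball s \<rho>) (\<lambda>n s. \<Gamma> (Suc n) s $ i) (\<lambda>s. \<gamma> s $ i) sequentially"
        unfolding uniform_limit_sequentially_iff by (meson le_SucI)
      \<comment> \<open>The derivative of iterate \<open>Suc n\<close> is the field along iterate
        \<open>n\<close>. The sequence is therefore shifted by one before Weierstrass' theorem on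
        uniform limits of holomorphic functions is applied.\<close>
      have ev: "eventually (\<lambda>n. continuous_on (cball s \<rho>) (\<lambda>s. \<Gamma> (Suc n) s $ i) \<and>
          (\<forall>w\<in>ball s \<rho>. ((\<lambda>s. \<Gamma> (Suc n) s $ i) has_field_derivative f (\<Gamma> n w) $ i) (at w))) sequentially"
        using cont der' by auto
      obtain g' where g': "((\<lambda>s. \<gamma> s $ i) has_field_derivative g' s) (at s)"
        "(\<lambda>n. f (\<Gamma> n s) $ i) \<longlonglongrightarrow> g' s"
        using has_complex_derivative_uniform_limit[OF ev ul sequentially_bot \<rho>(1)] \<rho>(1)
        by (metis centre_in_ball)
      have "isCont (\<lambda>z. f z $ i) (\<gamma> s)"
        using f \<gamma>_in[OF s] R(1) has_derivative_continuous mholomorphic_has_derivative by blast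
      then have "(\<lambda>n. f (\<Gamma> n s) $ i) \<longlonglongrightarrow> f (\<gamma> s) $ i"
        using isCont_tendsto_compose lim[OF s] by blast
      then have "g' s = f (\<gamma> s) $ i" using g'(2) LIMSEQ_unique by blast
      then show ?thesis using g'(1) by simp
    qed
    ultimately show ?thesis using \<gamma>_in by blast
  qed
  then show ?thesis using that r0 by blast
qed

section \<open>Division of holomorphic functions\<close>

text \<open>One zero is divided out at a time as a removable singularity. Distinctness ensures that
  the other points remain zeros of the quotient.\<close>

lemma holomorphic_divide_linear_factors:
  fixes q :: "complex \<Rightarrow> complex"
  assumes "finite I" "inj_on x I" "open S" "q holomorphic_on S"
    "\<And>i. i \<in> I \<Longrightarrow> x i \<in> S" "\<And>i. i \<in> I \<Longrightarrow> q (x i) = 0"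
  shows "\<exists>k. k holomorphic_on S \<and> (\<forall>s\<in>S. q s = (\<Prod>i\<in>I. s - x i) * k s)"
  using assms
proof (induction I arbitrary: q)
  case empty
  then show ?case by auto
next
  case (insert i I)
  let ?q = "\<lambda>z. if z = x i then deriv q (x i) else (q z - q (x i)) / (z - x i)"
  have qi: "q (x i) = 0" using insert.prems by blast
  have "?q holomorphic_on S"
    by (rule pole_lemma) (use insert.prems in \<open>auto simp: interior_open\<close>)
  moreover have "?q (x j) = 0" if "j \<in> I" for j
    using that insert.prems(1,5) insert.hyps qi by (auto simp: inj_on_def)
  ultimately obtain k where k: "k holomorphic_on S" "\<forall>s\<in>S. ?q s = (\<Prod>i\<in>I. s - x i) * k s"
    using insert.IH[of ?q] insert.prems by auto
  have "q s = (\<Prod>i\<in>insert i I. s - x i) * k s" if "s \<in> S" for s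
  proof (cases "s = x i")
    case True
    then show ?thesis using insert.hyps qi by simp
  next
    case False
    then have "q s = (s - x i) * ?q s" using qi by simp
    then show ?thesis using k(2) that insert.hyps by (simp add: mult.assoc)
  qed
  then show ?case using k(1) by blast
qed

text \<open>The point \<open>s0\<close> excludes \<open>g = 0\<close> identically, so on the smaller
  compact disc \<open>g\<close> has finitely many zeros. There the quotient, bounded by
  \<open>C\<close>, has removable singularities.\<close>

lemma holomorphic_divide_bounded:
  fixes f g :: "complex \<Rightarrow> complex"
  assumes "f holomorphic_on ball 0 R" "g holomorphic_on ball 0 R" "0 < r" "r < R"
    and le: "\<And>s. s \<in> ball 0 R \<Longrightarrow> cmod (f s) \<le> C * cmod (g s)"
    and nz: "s0 \<in> ball 0 R" "g s0 \<noteq> 0"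
  shows "\<exists>k. k holomorphic_on ball 0 r \<and> (\<forall>s\<in>ball 0 r. f s = g s * k s)"
proof -
  define X where "X = {s \<in> cball 0 r. g s = 0}"
  have "finite X"
  proof (cases "g constant_on ball 0 R")
    case True
    then have "g s = g s0" if "s \<in> ball 0 R" for s using that nz(1) unfolding constant_on_def by metis
    then have "X = {}" using nz(2) assms(4) by (auto simp: X_def)
    then show ?thesis by simp
  next
    case False
    have "cball 0 r \<subseteq> ball (0::complex) R" using assms(4) by auto
    then show ?thesis unfolding X_def
      by (rule holomorphic_compact_finite_zeros[OF assms(2) open_ball connected_ball compact_cball _ False])
  qed
  have sub: "ball 0 r \<subseteq> ball (0::complex) R" using assms(4) by auto
  have C: "C \<ge> 0"
  proof (rule ccontr)
    assume "\<not> C \<ge> 0"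
    then have "C * cmod (g s0) < 0" using nz(2) by (simp add: mult_neg_pos)
    then show False using le[OF nz(1)] norm_ge_zero[of "f s0"] by linarith
  qed
  have bd: "cmod (f s / g s) \<le> C" if "s \<in> ball 0 R" for s
    using le[OF that] C by (cases "g s = 0") (auto simp: norm_divide divide_simps)
  have "\<exists>k. k holomorphic_on ball 0 r \<and> (\<forall>s\<in>ball 0 r - (X \<inter> ball 0 r). k s = f s / g s)"
  proof (rule removable_singularities)
    show "finite (X \<inter> ball 0 r)" using \<open>finite X\<close> by simp
    show "X \<inter> ball 0 r \<subseteq> interior (ball 0 r)" by (simp add: interior_open)
    show "(\<lambda>s. f s / g s) holomorphic_on ball 0 r - (X \<inter> ball 0 r)"
      by (intro holomorphic_on_divide holomorphic_on_subset[OF assms(1)] holomorphic_on_subset[OF assms(2)])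
        (use sub in \<open>auto simp: X_def\<close>)
    fix z assume "z \<in> X \<inter> ball 0 r"
    then have "eventually (\<lambda>s. s \<in> ball 0 R) (at z)"
      using sub by (intro eventually_at_in_open') auto
    then show "(\<lambda>s. f s / g s) \<in> O[at z](\<lambda>_. 1)"
    proof (intro bigoI[of _ C], eventually_elim)
      case (elim s)
      then show ?case using bd[of s] by simp
    qed
  qed
  then obtain k where k: "k holomorphic_on ball 0 r" "\<And>s. s \<in> ball 0 r - X \<Longrightarrow> k s = f s / g s" by blast
  have "f s = g s * k s" if "s \<in> ball 0 r" for s
  proof (cases "s \<in> X")
    case True
    then have "g s = 0" by (simp add: X_def)
    moreover have "f s = 0" using le[of s] that sub \<open>g s = 0\<close> by auto
    ultimately show ?thesis by simp
  next
    case False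
    then have "g s \<noteq> 0" using that by (auto simp: X_def)
    then show ?thesis using k(2)[of s] False that by simp
  qed
  then show ?thesis using k(1) by blast
qed

text \<open>The zeros in a compact disc are finite in number, so their absolute values cannot
  exhaust an interval of radii.\<close>

lemma exists_zero_free_circle:
  fixes g :: "complex \<Rightarrow> complex"
  assumes "g holomorphic_on ball 0 R" "s0 \<in> ball 0 R" "g s0 \<noteq> 0"
  obtains r where "0 < r" "r < R" "\<And>s. cmod s = r \<Longrightarrow> g s \<noteq> 0"
proof -
  have R: "R > 0" using assms(2) by (metis ball_eq_empty empty_iff not_le)
  define X where "X = {s \<in> cball 0 (R/2). g s = 0}"
  have sub: "cball 0 (R/2) \<subseteq> ball (0::complex) R" using R by auto
  have "finite X"
  proof (cases "g constant_on ball 0 R")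
    case True
    then have "g s = g s0" if "s \<in> ball 0 R" for s using that assms(2) unfolding constant_on_def by metis
    then have "g s \<noteq> 0" if "s \<in> cball 0 (R/2)" for s using that subsetD[OF sub that] assms(3) by metis
    then have "X = {}" unfolding X_def by blast
    then show ?thesis by simp
  next
    case False
    show ?thesis unfolding X_def
      by (rule holomorphic_compact_finite_zeros[OF assms(1) open_ball connected_ball compact_cball sub False])
  qed
  then have "finite (cmod ` X)" by simp
  moreover have "infinite {0<..<R/2}" using R by (simp add: infinite_Ioo)
  ultimately obtain r where r: "r \<in> {0<..<R/2}" "r \<notin> cmod ` X"
    by (meson finite_subset subsetI)
  show ?thesis
  proof
    show "0 < r" "r < R" using r(1) R by auto
    show "g s \<noteq> 0" if "cmod s = r" for s
      using r that by (auto simp: X_def image_iff)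
  qed
qed

lemma holomorphic_on_line:
  fixes f :: "complex^'k::finite \<Rightarrow> complex"
  assumes "mholomorphic_on f S" "\<And>s. s \<in> T \<Longrightarrow> z + s *s v \<in> S" "open T"
  shows "(\<lambda>s. f (z + s *s v)) holomorphic_on T"
  unfolding holomorphic_on_open[OF assms(3)]
  using has_field_derivative_line[OF assms(1)] assms(2) by blast

text \<open>By uniform continuity on a compact product, nearby functions stay above half the minimum
  that is attained on the circle at \<open>z0\<close>.\<close>

lemma uniform_lower_bound_sphere:
  fixes \<phi> :: "'a::euclidean_space \<Rightarrow> complex \<Rightarrow> complex"
  assumes "open N" "z0 \<in> N" "continuous_on (N \<times> sphere 0 r) (\<lambda>(z, s). \<phi> z s)"
    and "\<And>s. s \<in> sphere 0 r \<Longrightarrow> \<phi> z0 s \<noteq> 0" "r > 0"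
  obtains d c where "d > 0" "c > 0" "ball z0 d \<subseteq> N"
    "\<And>z s. z \<in> ball z0 d \<Longrightarrow> s \<in> sphere 0 r \<Longrightarrow> cmod (\<phi> z s) \<ge> c"
proof -
  obtain R where R: "R > 0" "cball z0 R \<subseteq> N" using assms(1,2) open_contains_cball by blast
  let ?K = "cball z0 R \<times> sphere (0::complex) r"
  have contK: "continuous_on ?K (\<lambda>(z, s). \<phi> z s)"
    by (rule continuous_on_subset[OF assms(3)]) (use R in auto)
  have uc: "uniformly_continuous_on ?K (\<lambda>(z, s). \<phi> z s)"
    by (intro compact_uniformly_continuous contK compact_Times) auto
  have "continuous_on (sphere 0 r) (\<lambda>s. (\<lambda>(z, s). \<phi> z s) (z0, s))"
    by (rule continuous_on_compose2[OF contK]) (use R in \<open>auto intro!: continuous_intros\<close>)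
  then have cont0: "continuous_on (sphere 0 r) (\<lambda>s. cmod (\<phi> z0 s))" by (simp add: continuous_on_norm)
  have ne: "sphere (0::complex) r \<noteq> {}" using assms(5) by simp
  obtain s1 where s1: "s1 \<in> sphere 0 r" "\<And>s. s \<in> sphere 0 r \<Longrightarrow> cmod (\<phi> z0 s1) \<le> cmod (\<phi> z0 s)"
    using continuous_attains_inf[OF compact_sphere ne cont0] by blast
  define c where "c = cmod (\<phi> z0 s1) / 2"
  have c: "c > 0" using assms(4) s1(1) by (simp add: c_def)
  obtain d where d: "d > 0" "\<And>x y. x \<in> ?K \<Longrightarrow> y \<in> ?K \<Longrightarrow> dist y x < d \<Longrightarrow>
      dist ((\<lambda>(z, s). \<phi> z s) y) ((\<lambda>(z, s). \<phi> z s) x) < c"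
    using uc c unfolding uniformly_continuous_on_def by metis
  show ?thesis
  proof
    show "min d R > 0" "c > 0" using d R c by auto
    show "ball z0 (min d R) \<subseteq> N" using R by auto
    fix z s assume z: "z \<in> ball z0 (min d R)" and s: "s \<in> sphere (0::complex) r"
    have "dist (z, s) (z0, s) < d" using z by (simp add: dist_Pair_Pair dist_commute)
    moreover have "(z, s) \<in> ?K" "(z0, s) \<in> ?K" using z s R by auto
    ultimately have "dist (\<phi> z s) (\<phi> z0 s) < c" using d(2)[of "(z0, s)" "(z, s)"] by simp
    moreover have "2 * c \<le> cmod (\<phi> z0 s)" using s1(2)[OF s] by (simp add: c_def)
    moreover have "cmod (\<phi> z0 s) \<le> cmod (\<phi> z s) + dist (\<phi> z s) (\<phi> z0 s)"
      using norm_triangle_ineq[of "\<phi> z s" "\<phi> z0 s - \<phi> z s"] by (simp add: dist_norm norm_minus_commute)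
    ultimately show "cmod (\<phi> z s) \<ge> c" by linarith
  qed
qed

text \<open>The quotient is the Cauchy integral over circles in complex lines that meet the zero set only inside.\<close>

lemma mholomorphic_divide_bounded:
  fixes G h :: "complex^'k::finite \<Rightarrow> complex"
  assumes G: "mholomorphic_on G N" and h: "mholomorphic_on h N" and z0: "z0 \<in> N"
    and le: "\<And>z. z \<in> N \<Longrightarrow> cmod (G z) \<le> C * cmod (h z)"
    and dense: "\<And>V. open V \<Longrightarrow> V \<subseteq> N \<Longrightarrow> V \<noteq> {} \<Longrightarrow> \<exists>z\<in>V. h z \<noteq> 0"
  obtains d k where "d > 0" "ball z0 d \<subseteq> N" "mholomorphic_on k (ball z0 d)"
    "\<And>z. z \<in> ball z0 d \<Longrightarrow> G z = h z * k z"
proof -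
  obtain R where R: "R > 0" "ball z0 R \<subseteq> N"
    using z0 mholomorphic_on_open[OF G] open_contains_ball by blast
  have "\<exists>z1\<in>ball z0 (R/4) - {z0}. h z1 \<noteq> 0"
  proof -
    have "ball z0 (R/4) - {z0} \<noteq> {}"
    proof
      assume "ball z0 (R/4) - {z0} = {}"
      moreover have "z0 \<in> ball z0 (R/4)" using R(1) by simp
      ultimately have "ball z0 (R/4) = {z0}" by blast
      then have "open {z0}" using open_ball[of z0 "R/4"] by simp
      then show False using not_open_singleton by blast
    qed
    moreover have "open (ball z0 (R/4) - {z0})" by (intro open_delete open_ball)
    moreover have "ball z0 (R/4) \<subseteq> ball z0 R" using R(1) by (intro subset_ball) simp
    then have "ball z0 (R/4) - {z0} \<subseteq> N" using R(2) by blast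
    ultimately show ?thesis using dense by blast
  qed
  then obtain z1 where z1: "z1 \<in> ball z0 (R/4)" "z1 \<noteq> z0" "h z1 \<noteq> 0" by blast
  \<comment> \<open>The point \<open>z1\<close> is reached at parameter 1 on this line, which makes
    \<open>h\<close> not identically zero along it. The choice of \<open>z1\<close> within
    \<open>R / 4\<close> keeps the parameters below 2 within \<open>R / 2\<close> of the starting
    point, so lines starting in the half ball stay in \<open>N\<close>.\<close>
  define v where "v = z1 - z0"
  have v: "norm v < R / 4" using z1(1) by (simp add: v_def dist_norm norm_minus_commute)
  have line: "z + s *s v \<in> N" if "z \<in> ball z0 (R/2)" "s \<in> ball 0 2" for z s
  proof -
    have "norm (s *s v) \<le> 2 * norm v"
      unfolding norm_vector_smult using that(2) by (intro mult_right_mono) auto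
    then have "norm (s *s v) < R / 2" using v by linarith
    then have "dist z0 (z + s *s v) < R"
      using that(1) norm_triangle_ineq4[of "z0 - z" "s *s v"] by (simp add: dist_norm diff_diff_eq)
    then show ?thesis using R by auto
  qed
  have holh: "(\<lambda>s. h (z + s *s v)) holomorphic_on ball 0 2" if "z \<in> ball z0 (R/2)" for z
    by (rule holomorphic_on_line[OF h]) (use line[OF that] in auto)
  have holG: "(\<lambda>s. G (z + s *s v)) holomorphic_on ball 0 2" if "z \<in> ball z0 (R/2)" for z
    by (rule holomorphic_on_line[OF G]) (use line[OF that] in auto)
  have z0R: "z0 \<in> ball z0 (R/2)" using R by simp
  have "h (z0 + 1 *s v) \<noteq> 0" using z1 by (simp add: v_def)
  then obtain r where r: "0 < r" "r < 2" "\<And>s. cmod s = r \<Longrightarrow> h (z0 + s *s v) \<noteq> 0"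
    using exists_zero_free_circle[OF holh[OF z0R], of 1] by auto
  have cont_line: "continuous_on (ball z0 (R/2) \<times> sphere 0 r) (\<lambda>(z, s). f (z + s *s v))"
    if "mholomorphic_on f N" for f
  proof -
    have "continuous_on (ball z0 (R/2) \<times> sphere (0::complex) r) (\<lambda>p. f (fst p + snd p *s v))"
      by (rule continuous_on_compose2[OF mholomorphic_continuous_on[OF that]])
        (use line r in \<open>auto intro!: continuous_intros continuous_on_vector_smult\<close>)
    then show ?thesis by (simp add: case_prod_beta)
  qed
  obtain d c where d: "d > 0" "c > 0" "ball z0 d \<subseteq> ball z0 (R/2)"
    "\<And>z s. z \<in> ball z0 d \<Longrightarrow> s \<in> sphere 0 r \<Longrightarrow> cmod (h (z + s *s v)) \<ge> c"
    by (rule uniform_lower_bound_sphere[OF open_ball z0R cont_line[OF h]]) (use r in auto)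
  define \<gamma> where "\<gamma> = (\<lambda>t. of_real r * exp (2 * of_real pi * \<i> * of_real t))"
  have \<gamma>: "cmod (\<gamma> t) = r" for t
    using r by (simp add: \<gamma>_def norm_mult)
  have hnz: "h (z + \<gamma> t *s v) \<noteq> 0" if "z \<in> ball z0 d" for z t
  proof -
    have "cmod (h (z + \<gamma> t *s v)) \<ge> c" using d(4)[OF that, of "\<gamma> t"] \<gamma> by simp
    then show ?thesis using d(2) by auto
  qed
  have \<gamma>2: "\<gamma> t \<in> ball 0 2" for t using \<gamma> r by simp
  define k where "k = (\<lambda>z. integral {0..1} (\<lambda>t. G (z + \<gamma> t *s v) / h (z + \<gamma> t *s v)))"
  have shift: "mholomorphic_on (\<lambda>z. f (z + \<gamma> t *s v)) (ball z0 d)" if "mholomorphic_on f N" for f t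
  proof (rule mholomorphic_compose[OF that])
    show "vholomorphic_on (\<lambda>z. z + \<gamma> t *s v) (ball z0 d)"
      by (auto intro!: mholomorphic_add mholomorphic_component mholomorphic_const)
    show "(\<lambda>z. z + \<gamma> t *s v) ` ball z0 d \<subseteq> N" using line \<gamma>2 d(3) by blast
  qed
  have "mholomorphic_on k (ball z0 d)"
    unfolding k_def
  proof (rule mholomorphic_integral[OF open_ball])
    show "mholomorphic_on (\<lambda>z. G (z + \<gamma> t *s v) / h (z + \<gamma> t *s v)) (ball z0 d)" for t
      by (intro mholomorphic_divide shift G h hnz)
    have cont: "continuous_on (ball z0 d \<times> {0..1}) (\<lambda>p. f (fst p + \<gamma> (snd p) *s v))"
      if "mholomorphic_on f N" for f
    proof (rule continuous_on_compose2[OF mholomorphic_continuous_on[OF that]])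
      show "continuous_on (ball z0 d \<times> {0..1}) (\<lambda>p. fst p + \<gamma> (snd p) *s v)"
        unfolding \<gamma>_def by (intro continuous_intros continuous_on_vector_smult)
      show "(\<lambda>p. fst p + \<gamma> (snd p) *s v) ` (ball z0 d \<times> {0..1}) \<subseteq> N"
        using line \<gamma>2 d(3) by auto
    qed
    have "continuous_on (ball z0 d \<times> {0..1}) (\<lambda>p. G (fst p + \<gamma> (snd p) *s v) / h (fst p + \<gamma> (snd p) *s v))"
      by (rule continuous_on_divide[OF cont[OF G] cont[OF h]]) (use hnz in auto)
    then show "continuous_on (ball z0 d \<times> {0..1}) (\<lambda>(z, t). G (z + \<gamma> t *s v) / h (z + \<gamma> t *s v))"
      by (simp add: case_prod_beta)
  qed
  moreover have "G z = h z * k z" if z: "z \<in> ball z0 d" for z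
  proof -
    have zR: "z \<in> ball z0 (R/2)" using z d(3) by blast
    \<comment> \<open>The closed disc bounded by the circle has to lie inside a disc on which the
      quotient exists, and that disc again has to be smaller than the domain of radius 2; hence the
      midpoint.\<close>
    define r' where "r' = (r + 2) / 2"
    have r': "0 < r'" "r < r'" "r' < 2" using r by (auto simp: r'_def)
    have "\<exists>\<kappa>. \<kappa> holomorphic_on ball 0 r' \<and> (\<forall>s\<in>ball 0 r'. G (z + s *s v) = h (z + s *s v) * \<kappa> s)"
    proof (rule holomorphic_divide_bounded[OF holG[OF zR] holh[OF zR] r'(1,3)])
      show "cmod (G (z + s *s v)) \<le> C * cmod (h (z + s *s v))" if "s \<in> ball 0 2" for s
        using le line[OF zR that] by blast
      show "\<gamma> 0 \<in> ball 0 2" by (rule \<gamma>2)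
      show "h (z + \<gamma> 0 *s v) \<noteq> 0" by (rule hnz[OF z])
    qed
    then obtain \<kappa> where \<kappa>: "\<kappa> holomorphic_on ball 0 r'"
      "\<And>s. s \<in> ball 0 r' \<Longrightarrow> G (z + s *s v) = h (z + s *s v) * \<kappa> s" by blast
    have "\<kappa> 0 = integral {0..1} (\<lambda>t. \<kappa> (\<gamma> t))"
      unfolding \<gamma>_def by (rule Cauchy_integral_unit_interval(1)[OF \<kappa>(1) open_ball _ r(1)]) (use r' in auto)
    also have "\<dots> = k z"
      unfolding k_def
    proof (rule integral_cong)
      fix t :: real
      have "\<gamma> t \<in> ball 0 r'" using \<gamma> r' by simp
      then show "\<kappa> (\<gamma> t) = G (z + \<gamma> t *s v) / h (z + \<gamma> t *s v)"
        using \<kappa>(2) hnz[OF z, of t] by simp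
    qed
    finally have "\<kappa> 0 = k z" .
    then show ?thesis using \<kappa>(2)[of 0] r' by simp
  qed
  moreover have "ball z0 (R/2) \<subseteq> ball z0 R" using R(1) by (intro subset_ball) simp
  then have "ball z0 d \<subseteq> N" using d(3) R(2) by blast
  ultimately show ?thesis using that d(1) by blast
qed

section \<open>Division by the determinant of the Euler field\<close>

text \<open>With the plus sign the \<open>u i\<close> are the eigenvalues of \<open>M\<close>
  themselves and the roots in \<open>s\<close> are \<open>- u i\<close>. The sign is that of the
  flow of the unit field, which adds its time parameter to the eigenvalues.\<close>

definition simple_spectrum :: "complex^'n^'n::finite \<Rightarrow> bool" where
  "simple_spectrum M \<longleftrightarrow> (\<exists>u :: 'n \<Rightarrow> complex. inj u \<and> (\<forall>s. det (M + mat s) = (\<Prod>i\<in>UNIV. s + u i)))"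

lemma mat_component: "mat s $ i $ j = (if i = j then s else 0)"
  by (simp add: mat_def)

lemma mat_mult_component:
  fixes N :: "complex^'n::finite^'n"
  shows "(mat t ** N) $ i $ j = t * N $ i $ j"
proof -
  have "(mat t ** N) $ i $ j = (\<Sum>k\<in>UNIV. (if i = k then t else 0) * N $ k $ j)"
    by (simp add: matrix_matrix_mult_def mat_component)
  also have "\<dots> = (\<Sum>k\<in>UNIV. if i = k then t * N $ k $ j else 0)" by (rule sum.cong) auto
  finally show ?thesis by simp
qed

text \<open>With \<open>s = 1 / t\<close> the determinant is, up to a power of \<open>t\<close>,
  that of \<open>1 + t M\<close>, which is nonzero for small \<open>t\<close>.\<close>

lemma exists_det_nonzero:
  fixes M :: "complex^'n::finite^'n"
  shows "\<exists>s. det (M + mat s) \<noteq> 0"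
proof -
  have "continuous_on UNIV (\<lambda>t :: complex. det (\<chi> i j. mat 1 $ i $ j + t * M $ i $ j))"
    using has_field_derivative_det_affine[of "mat 1" M]
    by (meson DERIV_isCont continuous_at_imp_continuous_on)
  then have cont: "isCont (\<lambda>t :: complex. det (\<chi> i j. mat 1 $ i $ j + t * M $ i $ j)) 0"
    by (simp add: continuous_on_eq_continuous_at)
  have nz: "det (\<chi> i j. mat 1 $ i $ j + 0 * M $ i $ j) \<noteq> 0"
    by (simp flip: mat_def)
  obtain e where e: "e > 0"
    "\<And>t. dist 0 t < e \<Longrightarrow> det (\<chi> i j. mat 1 $ i $ j + t * M $ i $ j) \<noteq> 0"
    using continuous_at_avoid[OF cont nz] by blast
  define t where "t = complex_of_real (e / 2)"
  have t: "t \<noteq> 0" "dist 0 t < e" using e(1) by (auto simp: t_def)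
  have "(\<chi> i j. mat 1 $ i $ j + t * M $ i $ j) = mat t ** (M + mat (1 / t))"
    using t(1) by (simp add: vec_eq_iff mat_mult_component distrib_left) (simp add: mat_component)
  then have "det (mat t :: complex^'n^'n) * det (M + mat (1 / t)) \<noteq> 0" using e(2)[OF t(2)] by (simp add: det_mul)
  then show ?thesis by auto
qed

text \<open>The situation in one chart: \<open>MM\<close> is the matrix of \<open>E \<circ>\<close>
  and \<open>ef\<close> the unit field in coordinates. The condition \<open>translation\<close>
  says, for every \<open>s\<close>, that the derivative of \<open>det (MM + s)\<close> along the
  unit field is its derivative in \<open>s\<close>. The division theorem uses nothing else about the
  F-manifold.\<close>

locale euler_matrix =
  fixes \<Omega> :: "(complex^'n::finite) set" and MM :: "complex^'n \<Rightarrow> complex^'n^'n"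
    and ef :: "complex^'n \<Rightarrow> complex^'n"
  assumes MM_hol: "\<And>i j. mholomorphic_on (\<lambda>z. MM z $ i $ j) \<Omega>"
    and ef_hol: "vholomorphic_on ef \<Omega>"
    and translation: "\<And>z s. z \<in> \<Omega> \<Longrightarrow>
      Ddet (MM z + mat s) (\<chi> i j. frechet_derivative (\<lambda>z. MM z $ i $ j) (at z) (ef z))
      = Ddet (MM z + mat s) (mat 1)"
    and dense_simple: "\<And>V. open V \<Longrightarrow> V \<subseteq> \<Omega> \<Longrightarrow> V \<noteq> {} \<Longrightarrow> \<exists>z\<in>V. simple_spectrum (MM z)"
begin

abbreviation h :: "complex^'n \<Rightarrow> complex" where "h z \<equiv> det (MM z)"

text \<open>By \<open>translation\<close> at \<open>s = 0\<close> the derivative along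
  \<open>ef\<close> is that of the characteristic polynomial at 0, so \<open>0\<close> is an
  eigenvalue of algebraic multiplicity one.\<close>

definition good :: "complex^'n \<Rightarrow> bool" where
  "good z \<longleftrightarrow> z \<in> \<Omega> \<and> h z = 0 \<and> frechet_derivative h (at z) (ef z) \<noteq> 0"

lemma open_domain: "open \<Omega>"
  using MM_hol mholomorphic_on_open by blast

lemma h_hol: "mholomorphic_on h \<Omega>"
  by (intro mholomorphic_det open_domain MM_hol)

text \<open>Moving a time \<open>t\<close> along the curve and shifting back by \<open>t\<close>
  leaves the determinant unchanged: the derivative of \<open>K\<close> vanishes by
  \<open>translation\<close>. The claim compares \<open>t = s\<close> with
  \<open>t = 0\<close>.\<close>

lemma det_along_integral_curve:
  assumes "\<gamma> 0 = z" "\<And>s. s \<in> ball 0 r \<Longrightarrow> \<gamma> s \<in> \<Omega>"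
    and der: "\<And>s i. s \<in> ball 0 r \<Longrightarrow> ((\<lambda>s. \<gamma> s $ i) has_field_derivative ef (\<gamma> s) $ i) (at s)"
    and s: "s \<in> ball 0 r"
  shows "h (\<gamma> s) = det (MM z + mat s)"
proof -
  define K where "K = (\<lambda>t. det (MM (\<gamma> t) + mat (s - t)))"
  have "(K has_field_derivative 0) (at t within ball 0 r)" if t: "t \<in> ball 0 r" for t
  proof -
    let ?D = "\<chi> i j. frechet_derivative (\<lambda>z. MM z $ i $ j) (at (\<gamma> t)) (ef (\<gamma> t))"
    have "(K has_field_derivative Ddet (MM (\<gamma> t) + mat (s - t)) (?D - mat 1)) (at t)"
      unfolding K_def
    proof (rule has_field_derivative_det)
      fix i j
      have "((\<lambda>t. MM (\<gamma> t) $ i $ j) has_field_derivative ?D $ i $ j) (at t)"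
        using has_field_derivative_compose_curve[OF MM_hol, of \<gamma> t "ef (\<gamma> t)"] assms(2)[OF t] der[OF t] by simp
      moreover have "((\<lambda>t. if i = j then s - t else 0) has_field_derivative - (mat 1 $ i $ j)) (at t)"
        by (auto simp: mat_component intro!: derivative_eq_intros)
      ultimately have "((\<lambda>t. MM (\<gamma> t) $ i $ j + (if i = j then s - t else 0)) has_field_derivative
          ?D $ i $ j + - (mat 1 $ i $ j)) (at t)" by (rule DERIV_add)
      then show "((\<lambda>t. (MM (\<gamma> t) + mat (s - t)) $ i $ j) has_field_derivative (?D - mat 1) $ i $ j) (at t)"
        by (simp add: mat_component)
    qed
    moreover have "Ddet (MM (\<gamma> t) + mat (s - t)) (?D - mat 1) = 0"
      using translation[OF assms(2)[OF t]] by (simp add: Ddet_diff)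
    ultimately show ?thesis using has_field_derivative_at_within by force
  qed
  then obtain c where c: "\<And>t. t \<in> ball 0 r \<Longrightarrow> K t = c"
    using has_field_derivative_zero_constant[OF convex_ball, of 0 r K] by auto
  have "0 \<in> ball 0 r" using s by (metis centre_in_ball dist_0_norm mem_ball norm_ge_zero order_le_less_trans)
  then have "K s = K 0" using c s by metis
  moreover have "mat 0 = (0 :: complex^'n^'n)" by (simp add: vec_eq_iff mat_component)
  ultimately show ?thesis by (simp add: K_def assms(1))
qed

text \<open>Along the curve \<open>h\<close> is a polynomial in time with simple roots. Its time
  derivative at a root is nonzero, and this is the derivative of \<open>h\<close> along the unit
  field.\<close>

lemma good_on_integral_curve:
  fixes u :: "'n \<Rightarrow> complex"
  assumes "\<gamma> 0 = z" "\<And>s. s \<in> ball 0 r \<Longrightarrow> \<gamma> s \<in> \<Omega>"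
    and der: "\<And>s i. s \<in> ball 0 r \<Longrightarrow> ((\<lambda>s. \<gamma> s $ i) has_field_derivative ef (\<gamma> s) $ i) (at s)"
    and u: "inj u" "\<And>s. det (MM z + mat s) = (\<Prod>i\<in>UNIV. s + u i)" and k: "- u k \<in> ball 0 r"
  shows "good (\<gamma> (- u k))"
proof -
  let ?s = "- u k"
  define Q where "Q = (\<lambda>s. \<Prod>i\<in>UNIV - {k}. s + u i)"
  have hQ: "h (\<gamma> s) = (s + u k) * Q s" if "s \<in> ball 0 r" for s
  proof -
    have "h (\<gamma> s) = (\<Prod>i\<in>UNIV. s + u i)"
      using det_along_integral_curve[OF assms(1-3) that] u(2) by simp
    also have "\<dots> = (s + u k) * Q s" unfolding Q_def by (rule prod.remove) auto
    finally show ?thesis .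
  qed
  have "((\<lambda>s. h (\<gamma> s)) has_field_derivative frechet_derivative h (at (\<gamma> ?s)) (ef (\<gamma> ?s))) (at ?s)"
    by (rule has_field_derivative_compose_curve[OF h_hol assms(2)[OF k] der[OF k]])
  then have 1: "((\<lambda>s. (s + u k) * Q s) has_field_derivative frechet_derivative h (at (\<gamma> ?s)) (ef (\<gamma> ?s))) (at ?s)"
    by (rule has_field_derivative_transform_within_open[OF _ open_ball k hQ])
  have "Q holomorphic_on UNIV" unfolding Q_def by (intro holomorphic_intros)
  then obtain Q' where "(Q has_field_derivative Q') (at ?s)"
    by (metis UNIV_I field_differentiable_def holomorphic_on_imp_differentiable_at open_UNIV)
  then have 2: "((\<lambda>s. (s + u k) * Q s) has_field_derivative Q ?s) (at ?s)"
    by (auto intro!: derivative_eq_intros)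
  have "Q ?s \<noteq> 0" using u(1) by (auto simp: Q_def inj_def)
  then have "frechet_derivative h (at (\<gamma> ?s)) (ef (\<gamma> ?s)) \<noteq> 0" using DERIV_unique[OF 1 2] by simp
  moreover have "h (\<gamma> ?s) = 0" using hQ[OF k] by simp
  ultimately show ?thesis using assms(2)[OF k] by (simp add: good_def)
qed

definition integral_curve :: "complex \<Rightarrow> real \<Rightarrow> (complex^'n) set \<Rightarrow> complex^'n \<Rightarrow> (complex \<Rightarrow> complex^'n) \<Rightarrow> bool" where
  "integral_curve a r S z \<gamma> \<longleftrightarrow> \<gamma> a = z \<and> (\<forall>s\<in>ball a r. \<gamma> s \<in> S \<and>
      (\<forall>i. ((\<lambda>s. \<gamma> s $ i) has_field_derivative ef (\<gamma> s) $ i) (at s)))"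

lemma integral_curveD:
  assumes "integral_curve a r S z \<gamma>"
  shows "\<gamma> a = z" "\<And>s. s \<in> ball a r \<Longrightarrow> \<gamma> s \<in> S"
    "\<And>s i. s \<in> ball a r \<Longrightarrow> ((\<lambda>s. \<gamma> s $ i) has_field_derivative ef (\<gamma> s) $ i) (at s)"
  using assms unfolding integral_curve_def by blast+

lemma integral_curve_exists:
  assumes "cball z0 R \<subseteq> \<Omega>" "R > 0"
  obtains r where "r > 0"
    "\<And>z. z \<in> cball z0 (R/2) \<Longrightarrow> \<exists>\<gamma>. integral_curve 0 r (cball z0 R) z \<gamma>"
  unfolding integral_curve_def using holomorphic_integral_curve[OF ef_hol assms] by blast

text \<open>A simple spectrum may contain \<open>0\<close>. A short move along the integral curve
  shifts the eigenvalues away from it, since \<open>h\<close> is there a polynomial with finitely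
  many roots.\<close>

lemma dense_nonzero:
  assumes "open V" "V \<subseteq> \<Omega>" "V \<noteq> {}"
  shows "\<exists>z\<in>V. h z \<noteq> 0"
proof -
  obtain z where z: "z \<in> V" "simple_spectrum (MM z)" using dense_simple[OF assms] by blast
  obtain R where R: "R > 0" "cball z R \<subseteq> V" using assms(1) z(1) open_contains_cball by blast
  have "cball z R \<subseteq> \<Omega>" using R(2) assms(2) by blast
  then obtain r where r: "r > 0"
    "\<And>w. w \<in> cball z (R/2) \<Longrightarrow> \<exists>\<gamma>. integral_curve 0 r (cball z R) w \<gamma>"
    using integral_curve_exists R(1) by blast
  have "z \<in> cball z (R/2)" using R by simp
  then obtain \<gamma> where "integral_curve 0 r (cball z R) z \<gamma>" using r(2) by blast
  note \<gamma> = integral_curveD[OF this]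
  have \<gamma>\<Omega>: "\<And>s. s \<in> ball 0 r \<Longrightarrow> \<gamma> s \<in> \<Omega>" using \<gamma>(2) R(2) assms(2) by blast
  obtain u :: "'n \<Rightarrow> complex" where u: "\<And>s. det (MM z + mat s) = (\<Prod>i\<in>UNIV. s + u i)"
    using z(2) unfolding simple_spectrum_def by blast
  have "infinite (ball (0::complex) r)" using r(1) by (simp add: uncountable_infinite uncountable_ball)
  then obtain s where s: "s \<in> ball 0 r" "s \<notin> range (\<lambda>i. - u i)"
    by (meson finite_class.finite_UNIV finite_imageI finite_subset subsetI)
  have "h (\<gamma> s) = (\<Prod>i\<in>UNIV. s + u i)"
    using det_along_integral_curve[OF \<gamma>(1) \<gamma>\<Omega> \<gamma>(3) s(1)] u by simp
  moreover have "s + u i \<noteq> 0" for i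
    using s(2) by (metis add_eq_0_iff2 rangeI)
  ultimately have "h (\<gamma> s) \<noteq> 0" by simp
  then show ?thesis using \<gamma>(2)[OF s(1)] R(2) by blast
qed

lemma dense_eq:
  fixes f g :: "complex^'n \<Rightarrow> complex"
  assumes "continuous_on N f" "continuous_on N g" "open N" "N \<subseteq> \<Omega>"
    "\<And>z. z \<in> N \<Longrightarrow> h z \<noteq> 0 \<Longrightarrow> f z = g z" "z \<in> N"
  shows "f z = g z"
proof (rule ccontr)
  assume ne: "f z \<noteq> g z"
  have "continuous_on N (\<lambda>z. f z - g z)" by (intro continuous_intros assms)
  then have "open (N \<inter> (\<lambda>z. f z - g z) -` (- {0}))"
    using continuous_open_preimage[OF _ assms(3)] open_Compl[OF closed_singleton] by blast
  moreover have "z \<in> N \<inter> (\<lambda>z. f z - g z) -` (- {0})" using ne assms(6) by simp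
  ultimately obtain w where "w \<in> N \<inter> (\<lambda>z. f z - g z) -` (- {0})" "h w \<noteq> 0"
    using dense_nonzero[of "N \<inter> (\<lambda>z. f z - g z) -` (- {0})"] assms(4) by blast
  then show False using assms(5) by auto
qed

text \<open>If \<open>z\<close> has simple spectrum, then \<open>s \<mapsto> G (\<gamma> s) / h (\<gamma> s)\<close> is holomorphic along the integral
  curve through \<open>z\<close>, and the maximum principle bounds its value at \<open>0\<close> by the values far away
  from the zeros of the denominator, which is the characteristic polynomial at \<open>z\<close>.\<close>

lemma quotient_bounded:
  assumes G: "mholomorphic_on G N" and N: "N \<subseteq> \<Omega>" "z0 \<in> N"
    and good: "\<And>z. z \<in> N \<Longrightarrow> good z \<Longrightarrow> G z = 0"
  obtains d C where "d > 0" "ball z0 d \<subseteq> N" "\<And>z. z \<in> ball z0 d \<Longrightarrow> cmod (G z) \<le> C * cmod (h z)"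
proof -
  have oN: "open N" by (rule mholomorphic_on_open[OF G])
  obtain R where R: "R > 0" "cball z0 R \<subseteq> N" using oN N(2) open_contains_cball by blast
  have "cball z0 R \<subseteq> \<Omega>" using R(2) N(1) by blast
  then obtain r where r: "r > 0"
    "\<And>w. w \<in> cball z0 (R/2) \<Longrightarrow> \<exists>\<gamma>. integral_curve 0 r (cball z0 R) w \<gamma>"
    using integral_curve_exists R(1) by blast
  have "continuous_on (cball z0 R) G"
    using mholomorphic_continuous_on[OF G] R(2) continuous_on_subset by blast
  then have "bounded (G ` cball z0 R)"
    using compact_continuous_image compact_cball compact_imp_bounded by blast
  then obtain B where "\<forall>y\<in>G ` cball z0 R. norm y \<le> B" unfolding bounded_iff by blast
  then have B: "\<And>z. z \<in> cball z0 R \<Longrightarrow> cmod (G z) \<le> B" by blast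
  define H where "H = (\<lambda>z s. det (MM z + mat s))"
  have H_entire: "(H z) holomorphic_on S" for z S
  proof -
    have "(\<chi> i j. MM z $ i $ j + s * (mat 1) $ i $ j) = MM z + mat s" for s
      by (simp add: vec_eq_iff mat_component)
    then have "(H z has_field_derivative Ddet (MM z + mat s) (mat 1)) (at s)" for s
      using has_field_derivative_det_affine[of "MM z" "mat 1" s] by (simp add: H_def)
    then show ?thesis
      by (meson field_differentiable_at_within field_differentiable_def holomorphic_on_def)
  qed
  have "\<exists>s\<in>ball 0 r. H z0 s \<noteq> 0"
  proof (rule ccontr)
    assume no: "\<not> ?thesis"
    have "H z0 s = 0" for s
    proof (rule analytic_continuation[of "H z0" UNIV "ball 0 r" 0])
      show "(0::complex) islimpt ball 0 r" using r(1) by (simp add: islimpt_ball)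
    qed (use no H_entire r(1) in auto)
    then show False using exists_det_nonzero[of "MM z0"] by (simp add: H_def)
  qed
  then obtain s1 where s1: "s1 \<in> ball 0 r" "H z0 s1 \<noteq> 0" by blast
  obtain \<rho> where \<rho>: "0 < \<rho>" "\<rho> < r" "\<And>s. cmod s = \<rho> \<Longrightarrow> H z0 s \<noteq> 0"
    using exists_zero_free_circle[OF H_entire s1] by blast
  have ballR: "ball z0 (R/2) \<subseteq> cball z0 R"
    by (rule subset_trans[OF subset_ball ball_subset_cball]) (use R(1) in simp)
  have contH: "continuous_on (ball z0 (R/2) \<times> sphere 0 \<rho>) (\<lambda>(z, s). H z s)"
  proof -
    have sub: "ball z0 (R/2) \<subseteq> \<Omega>" using ballR R(2) N(1) by blast
    have entry: "continuous_on (ball z0 (R/2) \<times> sphere (0::complex) \<rho>) (\<lambda>p. MM (fst p) $ i $ j)" for i j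
      by (rule continuous_on_compose2[OF mholomorphic_continuous_on[OF MM_hol]])
        (use sub in \<open>auto intro!: continuous_intros\<close>)
    have "continuous_on (ball z0 (R/2) \<times> sphere (0::complex) \<rho>)
        (\<lambda>p. (MM (fst p) + mat (snd p)) $ i $ j)" for i j
    proof -
      have "continuous_on (ball z0 (R/2) \<times> sphere (0::complex) \<rho>) (\<lambda>p. if i = j then snd p else 0)"
        by (cases "i = j") (auto intro!: continuous_intros)
      then show ?thesis using continuous_on_add[OF entry[of i j]] by (simp add: mat_component)
    qed
    then have "continuous_on (ball z0 (R/2) \<times> sphere (0::complex) \<rho>) (\<lambda>p. det (MM (fst p) + mat (snd p)))"
      unfolding det_def
      by (intro continuous_on_sum continuous_on_mult continuous_on_const continuous_on_prod)
    then show ?thesis by (simp add: H_def case_prod_beta)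
  qed
  \<comment> \<open>Only the polynomial at \<open>z0\<close> was made free of zeros on the circle,
    but the bound \<open>c\<close> holds for all nearby \<open>z\<close>. This makes the constant
    \<open>C = B / c\<close> independent of \<open>z\<close> and of how close its roots are to each
    other.\<close>
  obtain d c where d: "d > 0" "c > 0" "ball z0 d \<subseteq> ball z0 (R/2)"
    "\<And>z s. z \<in> ball z0 d \<Longrightarrow> s \<in> sphere 0 \<rho> \<Longrightarrow> cmod (H z s) \<ge> c"
    by (rule uniform_lower_bound_sphere[OF open_ball _ contH]) (use R \<rho> in auto)
  have dN: "ball z0 d \<subseteq> N" using d(3) ballR R(2) by blast
  define C where "C = B / c"
  have simple: "cmod (G z) \<le> C * cmod (h z)" if z: "z \<in> ball z0 d" and ss: "simple_spectrum (MM z)" for z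
  proof -
    have "z \<in> cball z0 (R/2)" using z d(3) by auto
    then obtain \<gamma> where "integral_curve 0 r (cball z0 R) z \<gamma>" using r(2) by blast
    note \<gamma> = integral_curveD[OF this]
    have \<gamma>N: "\<And>s. s \<in> ball 0 r \<Longrightarrow> \<gamma> s \<in> N" using \<gamma>(2) R(2) by blast
    have \<gamma>\<Omega>: "\<And>s. s \<in> ball 0 r \<Longrightarrow> \<gamma> s \<in> \<Omega>" using \<gamma>N N(1) by blast
    obtain u :: "'n \<Rightarrow> complex" where u: "inj u" "\<And>s. H z s = (\<Prod>i\<in>UNIV. s + u i)"
      using ss unfolding simple_spectrum_def H_def by blast
    define q where "q = (\<lambda>s. G (\<gamma> s))"
    have "q holomorphic_on ball 0 r"
      unfolding holomorphic_on_open[OF open_ball] q_def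
    proof
      fix s :: complex assume s: "s \<in> ball 0 r"
      show "\<exists>f'. ((\<lambda>s. G (\<gamma> s)) has_field_derivative f') (at s)"
        using has_field_derivative_compose_curve[OF G \<gamma>N[OF s] \<gamma>(3)[OF s]] by blast
    qed
    \<comment> \<open>Only roots inside the disc are times on the curve. There the curve meets good
      points, so \<open>q\<close> vanishes and these factors divide it. The remaining factors
      \<open>P\<close> have no zero in the disc, and \<open>k / P\<close> is the quotient of
      \<open>q\<close> by the characteristic polynomial.\<close>
    define I where "I = {i. - u i \<in> ball 0 r}"
    have "\<exists>k. k holomorphic_on ball 0 r \<and> (\<forall>s\<in>ball 0 r. q s = (\<Prod>i\<in>I. s - (- u i)) * k s)"
    proof (rule holomorphic_divide_linear_factors[OF _ _ open_ball \<open>q holomorphic_on ball 0 r\<close>])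
      show "inj_on (\<lambda>i. - u i) I" using u(1) by (auto simp: inj_on_def inj_def)
      show "q (- u i) = 0" if "i \<in> I" for i
      proof -
        have ui: "- u i \<in> ball 0 r" using that by (simp add: I_def)
        have "good (\<gamma> (- u i))"
          by (rule good_on_integral_curve[OF \<gamma>(1) \<gamma>\<Omega> \<gamma>(3) u(1) _ ui]) (use u(2) in \<open>auto simp: H_def\<close>)
        then show ?thesis unfolding q_def by (rule good[OF \<gamma>N[OF ui]])
      qed
    qed (auto simp: I_def)
    then obtain k where k: "k holomorphic_on ball 0 r" "\<And>s. s \<in> ball 0 r \<Longrightarrow> q s = (\<Prod>i\<in>I. s + u i) * k s"
      by auto
    define P where "P = (\<lambda>s. \<Prod>i\<in>- I. s + u i)"
    have HP: "H z s = (\<Prod>i\<in>I. s + u i) * P s" for s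
    proof -
      have "(\<Prod>i\<in>I \<union> - I. s + u i) = (\<Prod>i\<in>I. s + u i) * P s"
        unfolding P_def by (rule prod.union_disjoint) auto
      then show ?thesis by (simp add: u(2))
    qed
    have P0: "P s \<noteq> 0" if s: "s \<in> ball 0 r" for s
    proof
      assume "P s = 0"
      then obtain i where i: "i \<notin> I" "s + u i = 0" by (auto simp: P_def)
      then have "s = - u i" by (simp add: add_eq_0_iff2)
      then show False using i(1) s unfolding I_def by blast
    qed
    have kP: "(\<lambda>s. k s / P s) holomorphic_on ball 0 r"
      by (intro holomorphic_on_divide k(1) P0) (auto simp: P_def intro!: holomorphic_intros)
    have qH: "q s = H z s * (k s / P s)" if "s \<in> ball 0 r" for s
      using k(2)[OF that] HP[of s] P0[OF that] by simp
    have sub: "cball 0 \<rho> \<subseteq> ball (0::complex) r" using \<rho>(2) by auto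
    have "cmod (k 0 / P 0) \<le> C"
    proof (rule maximum_modulus_frontier[where S = "cball 0 \<rho>" and f = "\<lambda>s. k s / P s"])
      show "(\<lambda>s. k s / P s) holomorphic_on interior (cball 0 \<rho>)"
        by (rule holomorphic_on_subset[OF kP]) (use \<rho>(2) in auto)
      show "continuous_on (closure (cball 0 \<rho>)) (\<lambda>s. k s / P s)"
        using holomorphic_on_imp_continuous_on[OF holomorphic_on_subset[OF kP sub]] by simp
      show "0 \<in> cball (0::complex) \<rho>" using \<rho>(1) by simp
      fix s :: complex assume "s \<in> frontier (cball 0 \<rho>)"
      then have s: "s \<in> sphere 0 \<rho>" by (simp add: frontier_cball)
      then have sr: "s \<in> ball 0 r" using \<rho>(2) by auto
      have Hc: "c \<le> cmod (H z s)" by (rule d(4)[OF z s])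
      then have "H z s \<noteq> 0" using d(2) by auto
      then have "cmod (k s / P s) = cmod (q s) / cmod (H z s)"
        using qH[OF sr] by (simp add: norm_mult norm_divide)
      also have "\<dots> \<le> B / c"
        unfolding q_def using B \<gamma>(2)[OF sr] Hc d(2) by (intro frac_le) (auto intro: order_trans[OF norm_ge_zero])
      finally show "cmod (k s / P s) \<le> C" by (simp add: C_def)
    qed auto
    then have "cmod (k 0 / P 0) * cmod (h z) \<le> C * cmod (h z)" by (rule mult_right_mono) simp
    moreover have "G z = h z * (k 0 / P 0)"
    proof -
      have "mat 0 = (0 :: complex^'n^'n)" by (simp add: vec_eq_iff mat_component)
      then have "H z 0 = h z" by (simp add: H_def)
      then show ?thesis using qH[of 0] r(1) \<gamma>(1) by (simp add: q_def)
    qed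
    then have "cmod (G z) = cmod (k 0 / P 0) * cmod (h z)" by (simp only: norm_mult mult.commute)
    ultimately show ?thesis by simp
  qed
  have "cmod (G z) \<le> C * cmod (h z)" if z: "z \<in> ball z0 d" for z
  proof (rule ccontr)
    assume no: "\<not> ?thesis"
    let ?f = "\<lambda>z. cmod (G z) - C * cmod (h z)"
    have "continuous_on (ball z0 d) ?f"
      using continuous_on_subset[OF mholomorphic_continuous_on[OF G] dN]
        continuous_on_subset[OF mholomorphic_continuous_on[OF h_hol] subset_trans[OF dN N(1)]]
      by (intro continuous_intros)
    then have "open (ball z0 d \<inter> ?f -` {0<..})"
      by (rule continuous_open_preimage) auto
    moreover have "z \<in> ball z0 d \<inter> ?f -` {0<..}" using z no by simp
    moreover have "ball z0 d \<inter> ?f -` {0<..} \<subseteq> \<Omega>" using dN N(1) by blast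
    ultimately obtain w where "w \<in> ball z0 d \<inter> ?f -` {0<..}" "simple_spectrum (MM w)"
      using dense_simple[of "ball z0 d \<inter> ?f -` {0<..}"] by blast
    then show False using simple[of w] by simp
  qed
  then show ?thesis using that d(1) dN by blast
qed

lemma division:
  assumes G: "mholomorphic_on G N" and N: "N \<subseteq> \<Omega>" "z0 \<in> N"
    and good: "\<And>z. z \<in> N \<Longrightarrow> good z \<Longrightarrow> G z = 0"
  obtains d k where "d > 0" "ball z0 d \<subseteq> N" "mholomorphic_on k (ball z0 d)"
    "\<And>z. z \<in> ball z0 d \<Longrightarrow> G z = h z * k z"
proof -
  obtain d C where d: "d > 0" "ball z0 d \<subseteq> N" "\<And>z. z \<in> ball z0 d \<Longrightarrow> cmod (G z) \<le> C * cmod (h z)"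
    using quotient_bounded[OF assms] by blast
  have z0: "z0 \<in> ball z0 d" using d(1) by simp
  have d\<Omega>: "ball z0 d \<subseteq> \<Omega>" using d(2) N(1) by blast
  obtain d' k where "d' > 0" "ball z0 d' \<subseteq> ball z0 d" "mholomorphic_on k (ball z0 d')"
    "\<And>z. z \<in> ball z0 d' \<Longrightarrow> G z = h z * k z"
    by (rule mholomorphic_divide_bounded[OF mholomorphic_on_subset[OF G open_ball d(2)]
        mholomorphic_on_subset[OF h_hol open_ball d\<Omega>] z0 d(3) dense_nonzero])
      (use d\<Omega> in auto)
  then show ?thesis using that d(2) by (meson subset_trans)
qed

text \<open>By Cramer's rule the determinant with column \<open>k\<close> replaced by
  \<open>X\<close> is \<open>h\<close> times the \<open>k\<close>-th component of a solution. At a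
  good point some solution exists and \<open>h\<close> vanishes, so this determinant is zero there
  and \<open>division\<close> applies. The quotients solve the system where
  \<open>h \<noteq> 0\<close>, and by density everywhere.\<close>

lemma vector_division:
  assumes X: "vholomorphic_on X N" and N: "N \<subseteq> \<Omega>" "z0 \<in> N"
    and good: "\<And>z. z \<in> N \<Longrightarrow> good z \<Longrightarrow> \<exists>y. X z = MM z *v y"
  obtains d Y where "d > 0" "ball z0 d \<subseteq> N" "vholomorphic_on Y (ball z0 d)"
    "\<And>z. z \<in> ball z0 d \<Longrightarrow> X z = MM z *v Y z"
proof -
  have oN: "open N" using mholomorphic_on_open X by blast
  define G where "G = (\<lambda>k z. det (\<chi> i j. if j = k then X z $ i else MM z $ i $ j))"
  have "mholomorphic_on (\<lambda>z. (\<chi> i j. if j = k then X z $ i else MM z $ i $ j) $ i $ j) N" for k i j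
    using X mholomorphic_on_subset[OF MM_hol oN N(1)] by (cases "j = k") auto
  then have G: "mholomorphic_on (G k) N" for k
    unfolding G_def by (intro mholomorphic_det oN)
  have G_eq: "G k z = y $ k * h z" if "X z = MM z *v y" for k z y
    unfolding G_def that by (rule cramer_lemma)
  \<comment> \<open>Radius and quotient are packed into a pair so that one choice over
    \<open>k\<close> yields both.\<close>
  have "\<exists>d\<kappa>. fst d\<kappa> > 0 \<and> ball z0 (fst d\<kappa>) \<subseteq> N \<and> mholomorphic_on (snd d\<kappa>) (ball z0 (fst d\<kappa>)) \<and>
      (\<forall>z\<in>ball z0 (fst d\<kappa>). G k z = h z * (snd d\<kappa>) z)" for k
  proof -
    have "G k z = 0" if z: "z \<in> N" "good z" for z
    proof -
      obtain y where "X z = MM z *v y" using good[OF z] by blast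
      then have "G k z = y $ k * h z" by (rule G_eq)
      then show ?thesis using z(2) by (simp add: good_def)
    qed
    then obtain d \<kappa> where "d > 0" "ball z0 d \<subseteq> N" "mholomorphic_on \<kappa> (ball z0 d)"
      "\<And>z. z \<in> ball z0 d \<Longrightarrow> G k z = h z * \<kappa> z"
      using division[OF G N] by blast
    then show ?thesis by (intro exI[of _ "(d, \<kappa>)"]) auto
  qed
  then obtain p where p: "\<And>k. fst (p k) > 0 \<and> ball z0 (fst (p k)) \<subseteq> N \<and>
      mholomorphic_on (snd (p k)) (ball z0 (fst (p k))) \<and>
      (\<forall>z\<in>ball z0 (fst (p k)). G k z = h z * (snd (p k)) z)" by metis
  define d where "d = Min (range (\<lambda>k. fst (p k)))"
  have d: "d > 0" unfolding d_def using p by (subst Min_gr_iff) auto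
  have dk: "ball z0 d \<subseteq> ball z0 (fst (p k))" for k
    unfolding d_def by (intro subset_ball Min_le) auto
  define Y where "Y = (\<lambda>z. \<chi> k. snd (p k) z)"
  have dN: "ball z0 d \<subseteq> N" using dk p by blast
  have Y: "vholomorphic_on Y (ball z0 d)"
  proof
    fix k
    have "mholomorphic_on (snd (p k)) (ball z0 d)"
      using p[of k] by (intro mholomorphic_on_subset[OF _ open_ball dk]) blast
    then show "mholomorphic_on (\<lambda>z. Y z $ k) (ball z0 d)" by (simp add: Y_def)
  qed
  have GY: "G k z = h z * Y z $ k" if "z \<in> ball z0 d" for z k
    using p[of k] dk[of k] that by (auto simp: Y_def)
  have "X z $ i = (MM z *v Y z) $ i" if z: "z \<in> ball z0 d" for z i
  proof (rule dense_eq[OF _ _ open_ball _ _ z])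
    show "continuous_on (ball z0 d) (\<lambda>z. X z $ i)"
      using continuous_on_subset[OF mholomorphic_continuous_on dN] X by blast
    have "mholomorphic_on (\<lambda>z. \<Sum>j\<in>UNIV. MM z $ i $ j * Y z $ j) (ball z0 d)"
      using Y mholomorphic_on_subset[OF MM_hol open_ball subset_trans[OF dN N(1)]]
      by (intro mholomorphic_sum mholomorphic_mult) auto
    then show "continuous_on (ball z0 d) (\<lambda>z. (MM z *v Y z) $ i)"
      unfolding matrix_vector_mult_def by (simp add: mholomorphic_continuous_on)
    show "ball z0 d \<subseteq> \<Omega>" using dN N(1) by blast
    fix w assume w: "w \<in> ball z0 d" and hw: "h w \<noteq> 0"
    obtain y where y: "MM w *v y = X w" using det_nonzero_solve[OF hw] by blast
    have "Y w $ k = y $ k" for k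
      using GY[OF w, of k] G_eq[OF y[symmetric], of k] hw by simp
    then have "Y w = y" by (simp add: vec_eq_iff)
    then show "X w $ i = (MM w *v Y w) $ i" using y by simp
  qed
  then have "X z = MM z *v Y z" if "z \<in> ball z0 d" for z using that by (simp add: vec_eq_iff)
  then show ?thesis using that d dN Y by blast
qed

end

section \<open>Calculus in charts\<close>

locale atlas =
  fixes A :: "('a, 'k::finite) chart set"
  assumes atlas: "complex_atlas A"
begin

abbreviation mtop :: "'a topology" where "mtop \<equiv> atlas_topology A"

lemmas openin_iff = openin_atlas_topology[OF atlas]

definition transition :: "('a, 'k) chart \<Rightarrow> ('a, 'k) chart \<Rightarrow> complex^'k \<Rightarrow> complex^'k" where
  "transition c d z = snd d (chart_inv c z)"

definition jacobian :: "('a, 'k) chart \<Rightarrow> ('a, 'k) chart \<Rightarrow> 'a \<Rightarrow> complex^'k \<Rightarrow> complex^'k" where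
  "jacobian c d p = frechet_derivative (transition c d) (at (snd c p))"

lemma chart_inj: "c \<in> A \<Longrightarrow> inj_on (snd c) (fst c)"
  using atlas by (simp add: complex_atlas_def)

lemma chart_inv_chart [simp]: "c \<in> A \<Longrightarrow> p \<in> fst c \<Longrightarrow> chart_inv c (snd c p) = p"
  by (simp add: chart_inv_def chart_inj)

lemma chart_chart_inv:
  assumes "z \<in> snd c ` fst c"
  shows "snd c (chart_inv c z) = z" "chart_inv c z \<in> fst c"
  using assms unfolding chart_inv_def by (auto intro: f_inv_into_f inv_into_into)

lemma transition_hol:
  assumes "c \<in> A" "d \<in> A"
  shows "vholomorphic_on (transition c d) (snd c ` (fst c \<inter> fst d))"
  using assms atlas unfolding complex_atlas_def transition_def by blast

lemma open_overlap: "c \<in> A \<Longrightarrow> d \<in> A \<Longrightarrow> open (snd c ` (fst c \<inter> fst d))"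
  using transition_hol mholomorphic_on_open by blast

lemma openin_chart: "c \<in> A \<Longrightarrow> openin mtop (fst c)"
  unfolding openin_iff carr_def using open_overlap by (auto simp: Int_commute)

lemma open_chart_image: "openin mtop U \<Longrightarrow> c \<in> A \<Longrightarrow> open (snd c ` (U \<inter> fst c))"
  unfolding openin_iff by blast

lemma open_chart_range: "c \<in> A \<Longrightarrow> open (snd c ` fst c)"
  using open_overlap[of c c] by simp

lemma topspace_carr: "topspace mtop = carr A"
proof
  show "topspace mtop \<subseteq> carr A" unfolding topspace_def using openin_iff by auto
  have "openin mtop (\<Union>(fst ` A))" using openin_chart by (intro openin_Union) blast
  then have "openin mtop (carr A)" by (simp add: carr_def)
  then show "carr A \<subseteq> topspace mtop" by (rule openin_subset)
qed

lemma openin_subset_carr: "openin mtop U \<Longrightarrow> U \<subseteq> carr A"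
  unfolding openin_iff by blast

lemma chart_at_in: "p \<in> carr A \<Longrightarrow> chart_at A p \<in> A \<and> p \<in> fst (chart_at A p)"
  unfolding chart_at_def carr_def by (rule someI_ex) blast

lemma transition_self: "c \<in> A \<Longrightarrow> z \<in> snd c ` fst c \<Longrightarrow> transition c c z = z"
  by (simp add: transition_def chart_chart_inv)

lemma transition_chart: "c \<in> A \<Longrightarrow> p \<in> fst c \<Longrightarrow> transition c d (snd c p) = snd d p"
  by (simp add: transition_def)

lemma transition_derivative:
  assumes "c \<in> A" "d \<in> A" "p \<in> fst c" "p \<in> fst d"
  shows "(transition c d has_derivative jacobian c d p) (at (snd c p))"
    "Vector_Spaces.linear (*s) (*s) (jacobian c d p)"
  unfolding jacobian_def
  using vholomorphic_has_derivative[OF transition_hol[OF assms(1,2)], of "snd c p"] assms(3,4) by blast+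

lemma jacobian_self:
  assumes "c \<in> A" "p \<in> fst c"
  shows "jacobian c c p v = v"
proof -
  have "((\<lambda>z. z) has_derivative (\<lambda>v. v)) (at (snd c p))" by (rule has_derivative_ident)
  then have "(transition c c has_derivative (\<lambda>v. v)) (at (snd c p))"
    by (rule has_derivative_transform_within_open[OF _ open_chart_range[OF assms(1)]])
      (use assms transition_self in auto)
  then show ?thesis using transition_derivative(1)[OF assms(1,1,2,2)] has_derivative_unique by metis
qed

lemma jacobian_compose:
  assumes "c \<in> A" "d \<in> A" "b \<in> A" "p \<in> fst c" "p \<in> fst d" "p \<in> fst b"
  shows "jacobian d b p (jacobian c d p v) = jacobian c b p v"
proof -
  have "((\<lambda>z. transition d b (transition c d z)) has_derivative
      (\<lambda>v. jacobian d b p (jacobian c d p v))) (at (snd c p))"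
    by (rule has_derivative_compose[OF transition_derivative(1)])
      (use assms transition_derivative(1)[of d b p] transition_chart in auto)
  moreover have "transition d b (transition c d z) = transition c b z"
    if "z \<in> snd c ` (fst c \<inter> fst d)" for z
    using that assms by (auto simp: transition_def)
  ultimately have "(transition c b has_derivative (\<lambda>v. jacobian d b p (jacobian c d p v))) (at (snd c p))"
    using has_derivative_transform_within_open[OF _ open_overlap[OF assms(1,2)]] assms by blast
  then show ?thesis using transition_derivative(1)[of c b p] assms has_derivative_unique by metis
qed

lemma jacobian_inverse:
  assumes "c \<in> A" "d \<in> A" "p \<in> fst c" "p \<in> fst d"
  shows "jacobian d c p (jacobian c d p v) = v"
  using jacobian_compose[of c d c p v] jacobian_self assms by simp

text \<open>The inverse of \<open>coords A c p\<close>: it takes coordinates in the chart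
  \<open>c\<close> to a tangent vector, which is encoded by its coordinates in the chart chosen at
  \<open>p\<close>.\<close>

definition tangent :: "('a, 'k) chart \<Rightarrow> 'a \<Rightarrow> complex^'k \<Rightarrow> complex^'k" where
  "tangent c p = jacobian c (chart_at A p) p"

lemma coords_eq: "coords A c p = jacobian (chart_at A p) c p"
  by (rule ext) (simp add: coords_def jacobian_def transition_def[abs_def])

lemma coord_vector_eq: "coord_vector A c i p = tangent c p (axis i 1)"
  by (simp add: coord_vector_def tangent_def jacobian_def transition_def[abs_def])

context
  fixes c p assumes c: "c \<in> A" and p: "p \<in> fst c"
begin

lemma chart_point_carr: "p \<in> carr A"
  using c p by (auto simp: carr_def)

lemma coords_tangent: "coords A c p (tangent c p v) = v"
  unfolding coords_eq tangent_def using jacobian_inverse c p chart_at_in[OF chart_point_carr] by simp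

lemma tangent_coords: "tangent c p (coords A c p v) = v"
  unfolding coords_eq tangent_def using jacobian_inverse c p chart_at_in[OF chart_point_carr] by simp

lemma coords_linear: "Vector_Spaces.linear (*s) (*s) (coords A c p)"
  unfolding coords_eq using transition_derivative(2) c p chart_at_in[OF chart_point_carr] by simp

lemma tangent_linear: "Vector_Spaces.linear (*s) (*s) (tangent c p)"
  unfolding tangent_def using transition_derivative(2) c p chart_at_in[OF chart_point_carr] by simp

lemma coords_change: "d \<in> A \<Longrightarrow> p \<in> fst d \<Longrightarrow> coords A d p v = jacobian c d p (coords A c p v)"
  unfolding coords_eq using jacobian_compose c p chart_at_in[OF chart_point_carr] by simp

lemma coords_inj: "coords A c p v = coords A c p w \<longleftrightarrow> v = w"
  using tangent_coords by metis

lemma field_in_chart_point: "field_in_chart A c X (snd c p) = coords A c p (X p)"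
  by (simp add: field_in_chart_def c p)

end

lemma coords_chart_at:
  assumes "p \<in> carr A"
  shows "coords A (chart_at A p) p v = v"
  unfolding coords_eq using jacobian_self chart_at_in[OF assms] by simp

subsection \<open>Holomorphic functions and vector fields\<close>

lemma openin_chart_preimage:
  assumes c: "c \<in> A" and V: "open V" "V \<subseteq> snd c ` fst c"
  shows "openin mtop (chart_inv c ` V)" "chart_inv c ` V \<subseteq> fst c" "snd c ` (chart_inv c ` V) = V"
proof -
  note inv = chart_chart_inv[OF subsetD[OF V(2)]]
  show sub: "chart_inv c ` V \<subseteq> fst c" using inv(2) by blast
  show "snd c ` (chart_inv c ` V) = V" using inv(1) by (simp add: image_image)
  have "open (snd d ` (chart_inv c ` V \<inter> fst d))" if d: "d \<in> A" for d
  proof -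
    have "snd d ` (chart_inv c ` V \<inter> fst d)
        = snd d ` (fst d \<inter> fst c) \<inter> transition d c -` V"
    proof (intro equalityI subsetI)
      fix w assume "w \<in> snd d ` (chart_inv c ` V \<inter> fst d)"
      then obtain z where z: "z \<in> V" "chart_inv c z \<in> fst d" "w = snd d (chart_inv c z)" by blast
      then have "chart_inv c z \<in> fst c" "snd c (chart_inv c z) = z" using inv by auto
      then show "w \<in> snd d ` (fst d \<inter> fst c) \<inter> transition d c -` V"
        using z d by (auto simp: transition_def)
    next
      fix w assume "w \<in> snd d ` (fst d \<inter> fst c) \<inter> transition d c -` V"
      then obtain q where q: "q \<in> fst d" "q \<in> fst c" "w = snd d q" "transition d c w \<in> V" by blast
      then have "snd c q \<in> V" using d by (simp add: transition_def)
      then have "q \<in> chart_inv c ` V" using c q(2) by (metis chart_inv_chart imageI)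
      then show "w \<in> snd d ` (chart_inv c ` V \<inter> fst d)" using q by blast
    qed
    moreover have "open (snd d ` (fst d \<inter> fst c) \<inter> transition d c -` V)"
      by (rule continuous_open_preimage[OF vholomorphic_continuous_on[OF transition_hol[OF d c]]
            open_overlap[OF d c] V(1)])
    ultimately show ?thesis by simp
  qed
  then show "openin mtop (chart_inv c ` V)"
    unfolding openin_iff using sub c by (auto simp: carr_def)
qed

lemma hol_functions_openin: "f \<in> holomorphic_functions A U \<Longrightarrow> openin mtop U"
  by (simp add: holomorphic_functions_def)

lemma hol_functions_chart:
  "f \<in> holomorphic_functions A U \<Longrightarrow> c \<in> A \<Longrightarrow>
    mholomorphic_on (\<lambda>z. f (chart_inv c z)) (snd c ` (U \<inter> fst c))"
  by (simp add: holomorphic_functions_def)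

lemma vector_fields_openin: "X \<in> vector_fields A U \<Longrightarrow> openin mtop U"
  by (simp add: vector_fields_def)

lemma vector_fields_chart:
  "X \<in> vector_fields A U \<Longrightarrow> c \<in> A \<Longrightarrow> vholomorphic_on (field_in_chart A c X) (snd c ` (U \<inter> fst c))"
  by (simp add: vector_fields_def)

lemma hol_functions_subset:
  assumes "f \<in> holomorphic_functions A U" "openin mtop V" "V \<subseteq> U"
  shows "f \<in> holomorphic_functions A V"
proof -
  have "mholomorphic_on (\<lambda>z. f (chart_inv c z)) (snd c ` (V \<inter> fst c))" if c: "c \<in> A" for c
    by (rule mholomorphic_on_subset[OF hol_functions_chart[OF assms(1) c] open_chart_image[OF assms(2) c]])
      (use assms(3) in blast)
  then show ?thesis using assms(2) by (simp add: holomorphic_functions_def)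
qed

lemma vector_fields_subset:
  assumes "X \<in> vector_fields A U" "openin mtop V" "V \<subseteq> U"
  shows "X \<in> vector_fields A V"
proof -
  have "mholomorphic_on (\<lambda>z. field_in_chart A c X z $ i) (snd c ` (V \<inter> fst c))" if c: "c \<in> A" for c i
    by (rule mholomorphic_on_subset[OF _ open_chart_image[OF assms(2) c], of _ "snd c ` (U \<inter> fst c)"])
      (use vector_fields_chart[OF assms(1) c] assms(3) in blast)+
  then show ?thesis using assms(2) by (simp add: vector_fields_def)
qed

lemma hol_functions_cong:
  assumes "f \<in> holomorphic_functions A U" "\<And>p. p \<in> U \<Longrightarrow> f p = g p"
  shows "g \<in> holomorphic_functions A U"
proof -
  have "mholomorphic_on (\<lambda>z. g (chart_inv c z)) (snd c ` (U \<inter> fst c))" if c: "c \<in> A" for c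
    by (rule mholomorphic_on_cong[OF hol_functions_chart[OF assms(1) c]]) (use assms(2) c in auto)
  then show ?thesis using hol_functions_openin[OF assms(1)] by (simp add: holomorphic_functions_def)
qed

lemma vector_fields_cong:
  assumes "X \<in> vector_fields A U" "\<And>p. p \<in> U \<Longrightarrow> X p = Y p"
  shows "Y \<in> vector_fields A U"
proof -
  have "mholomorphic_on (\<lambda>z. field_in_chart A c Y z $ i) (snd c ` (U \<inter> fst c))" if c: "c \<in> A" for c i
  proof (rule mholomorphic_on_cong)
    show "mholomorphic_on (\<lambda>z. field_in_chart A c X z $ i) (snd c ` (U \<inter> fst c))"
      using vector_fields_chart[OF assms(1) c] by blast
  qed (use assms(2) c in \<open>auto simp: field_in_chart_def\<close>)
  then show ?thesis using vector_fields_openin[OF assms(1)] by (simp add: vector_fields_def)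
qed

lemma chart_image_local:
  assumes "\<And>p. p \<in> U \<Longrightarrow> \<exists>V. p \<in> V \<and> V \<subseteq> U \<and> mholomorphic_on f (snd c ` (V \<inter> fst c))"
  shows "mholomorphic_on f (snd c ` (U \<inter> fst c))"
proof (rule mholomorphic_on_local)
  fix z assume "z \<in> snd c ` (U \<inter> fst c)"
  then obtain p where p: "p \<in> U" "p \<in> fst c" "z = snd c p" by blast
  then obtain V where "p \<in> V" "V \<subseteq> U" "mholomorphic_on f (snd c ` (V \<inter> fst c))" using assms by blast
  then show "\<exists>T. z \<in> T \<and> T \<subseteq> snd c ` (U \<inter> fst c) \<and> mholomorphic_on f T"
    using p by (intro exI[of _ "snd c ` (V \<inter> fst c)"]) auto
qed

lemma openin_local:
  assumes "\<And>p. p \<in> U \<Longrightarrow> \<exists>V. p \<in> V \<and> V \<subseteq> U \<and> openin mtop V"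
  shows "openin mtop U"
  using assms by (subst openin_subopen) blast

lemma hol_functions_local:
  assumes "\<And>p. p \<in> U \<Longrightarrow> \<exists>V. p \<in> V \<and> V \<subseteq> U \<and> f \<in> holomorphic_functions A V"
  shows "f \<in> holomorphic_functions A U"
proof -
  have "openin mtop U" using assms hol_functions_openin by (intro openin_local) blast
  moreover have "mholomorphic_on (\<lambda>z. f (chart_inv c z)) (snd c ` (U \<inter> fst c))" if "c \<in> A" for c
    using assms hol_functions_chart[OF _ that] by (intro chart_image_local) blast
  ultimately show ?thesis by (simp add: holomorphic_functions_def)
qed

lemma transition_image:
  assumes "c \<in> A" "d \<in> A" "U \<subseteq> fst c"
  shows "transition d c ` (snd d ` (U \<inter> fst d)) \<subseteq> snd c ` U"
  using assms by (auto simp: transition_def)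

text \<open>On a set inside one chart domain that chart suffices as a test: the other local
  expressions arise by composing with holomorphic coordinate changes.\<close>

lemma hol_functions_chartI:
  assumes c: "c \<in> A" and U: "openin mtop U" "U \<subseteq> fst c"
    and f: "mholomorphic_on (\<lambda>z. f (chart_inv c z)) (snd c ` U)"
  shows "f \<in> holomorphic_functions A U"
proof -
  have "mholomorphic_on (\<lambda>z. f (chart_inv d z)) (snd d ` (U \<inter> fst d))" if d: "d \<in> A" for d
  proof -
    have "vholomorphic_on (transition d c) (snd d ` (U \<inter> fst d))"
      using transition_hol[OF d c] mholomorphic_on_subset[OF _ open_chart_image[OF U(1) d]] U(2) by blast
    then have "mholomorphic_on (\<lambda>z. f (chart_inv c (transition d c z))) (snd d ` (U \<inter> fst d))"
      by (rule mholomorphic_compose[OF f _ transition_image[OF c d U(2)]])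
    then show ?thesis
      by (rule mholomorphic_on_cong) (use c d U in \<open>auto simp: transition_def subset_iff\<close>)
  qed
  then show ?thesis using U by (simp add: holomorphic_functions_def)
qed

text \<open>In another chart the components are multiplied by the Jacobian of the coordinate change,
  whose entries are holomorphic by \<open>mholomorphic_frechet_derivative\<close>. Hence one chart
  suffices as a test here too.\<close>

lemma vector_fields_chartI:
  assumes c: "c \<in> A" and U: "openin mtop U" "U \<subseteq> fst c"
    and X: "vholomorphic_on (field_in_chart A c X) (snd c ` U)"
  shows "X \<in> vector_fields A U"
proof -
  have "mholomorphic_on (\<lambda>z. field_in_chart A d X z $ i) (snd d ` (U \<inter> fst d))" if d: "d \<in> A" for d i
  proof -
    let ?S = "snd d ` (U \<inter> fst d)"
    have oS: "open ?S" by (rule open_chart_image[OF U(1) d])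
    have tr: "vholomorphic_on (transition d c) ?S"
      using transition_hol[OF d c] mholomorphic_on_subset[OF _ oS] U(2) by blast
    have im: "transition d c ` ?S \<subseteq> snd c ` U" by (rule transition_image[OF c d U(2)])
    let ?D = "\<lambda>j z. frechet_derivative (\<lambda>z. transition c d z $ i) (at z) (axis j 1)"
    have D: "mholomorphic_on (\<lambda>z. ?D j (transition d c z)) ?S" for j
    proof (rule mholomorphic_compose[OF mholomorphic_frechet_derivative tr])
      show "mholomorphic_on (\<lambda>z. transition c d z $ i) (snd c ` (fst c \<inter> fst d))"
        using transition_hol[OF c d] by blast
      show "transition d c ` ?S \<subseteq> snd c ` (fst c \<inter> fst d)"
        using U(2) d by (auto simp: transition_def)
    qed
    have Xc: "mholomorphic_on (\<lambda>z. field_in_chart A c X (transition d c z) $ j) ?S" for j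
      by (rule mholomorphic_compose[OF _ tr im]) (use X in blast)
    have "mholomorphic_on (\<lambda>z. \<Sum>j\<in>UNIV. field_in_chart A c X (transition d c z) $ j * ?D j (transition d c z)) ?S"
      by (intro mholomorphic_sum oS mholomorphic_mult D Xc)
    then show ?thesis
    proof (rule mholomorphic_on_cong)
      fix z assume "z \<in> ?S"
      then obtain q where q: "q \<in> U" "q \<in> fst d" "z = snd d q" by blast
      have qc: "q \<in> fst c" using q U(2) by blast
      have qin: "snd c q \<in> snd c ` (fst c \<inter> fst d)" using q qc by blast
      have "field_in_chart A d X z $ i = jacobian c d q (coords A c q (X q)) $ i"
        using q d c qc by (simp add: field_in_chart_point coords_change[OF c qc d q(2)])
      also have "\<dots> = frechet_derivative (\<lambda>z. transition c d z $ i) (at (snd c q)) (coords A c q (X q))"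
        unfolding jacobian_def by (rule vholomorphic_has_derivative(2)[OF transition_hol[OF c d] qin])
      also have "\<dots> = (\<Sum>j\<in>UNIV. coords A c q (X q) $ j * ?D j (snd c q))"
        by (rule linear_form_sum_axis, rule mholomorphic_linear[OF _ qin]) (use transition_hol[OF c d] in blast)
      finally show "(\<Sum>j\<in>UNIV. field_in_chart A c X (transition d c z) $ j * ?D j (transition d c z))
          = field_in_chart A d X z $ i"
        using q d c qc by (simp add: transition_chart field_in_chart_point)
    qed
  qed
  then show ?thesis using U by (simp add: vector_fields_def)
qed

definition chart_field :: "('a, 'k) chart \<Rightarrow> (complex^'k \<Rightarrow> complex^'k) \<Rightarrow> 'a \<Rightarrow> complex^'k" where
  "chart_field c f p = tangent c p (f (snd c p))"

lemma field_in_chart_chart_field: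
  assumes "c \<in> A" "z \<in> snd c ` fst c"
  shows "field_in_chart A c (chart_field c f) z = f z"
  using assms chart_chart_inv[OF assms(2)] by (simp add: field_in_chart_def chart_field_def coords_tangent)

lemma chart_field_in_vector_fields:
  assumes c: "c \<in> A" and U: "openin mtop U" "U \<subseteq> fst c" and f: "vholomorphic_on f (snd c ` U)"
  shows "chart_field c f \<in> vector_fields A U"
proof (rule vector_fields_chartI[OF c U])
  show "vholomorphic_on (field_in_chart A c (chart_field c f)) (snd c ` U)"
  proof
    fix i
    have "mholomorphic_on (\<lambda>z. f z $ i) (snd c ` U)" using f by blast
    then show "mholomorphic_on (\<lambda>z. field_in_chart A c (chart_field c f) z $ i) (snd c ` U)"
      by (rule mholomorphic_on_cong) (use U(2) in \<open>auto simp: field_in_chart_chart_field[OF c]\<close>)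
  qed
qed

lemma coord_vector_in_vector_fields:
  assumes "c \<in> A"
  shows "coord_vector A c i \<in> vector_fields A (fst c)"
proof -
  have "chart_field c (\<lambda>_. axis i 1) \<in> vector_fields A (fst c)"
    by (rule chart_field_in_vector_fields[OF assms openin_chart[OF assms]])
      (auto intro: mholomorphic_const open_chart_range assms)
  then show ?thesis by (rule vector_fields_cong) (simp add: chart_field_def coord_vector_eq)
qed

text \<open>The definition of \<open>differential\<close> uses the chart chosen at \<open>p\<close>,
  which may jump with \<open>p\<close>. The chain rule moves it to a fixed chart, where the
  dependence on the point can be studied.\<close>

lemma differential_chart:
  assumes f: "f \<in> holomorphic_functions A U" and p: "p \<in> U" "c \<in> A" "p \<in> fst c"
  shows "differential A f p v
    = frechet_derivative (\<lambda>z. f (chart_inv c z)) (at (snd c p)) (coords A c p v)"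
proof -
  let ?d = "chart_at A p"
  have d: "?d \<in> A" "p \<in> fst ?d" using chart_at_in chart_point_carr p by auto
  have pc: "snd c p \<in> snd c ` (U \<inter> fst c)" using p by blast
  have 1: "((\<lambda>z. f (chart_inv c z)) has_derivative
      frechet_derivative (\<lambda>z. f (chart_inv c z)) (at (snd c p))) (at (snd c p))"
    by (rule mholomorphic_has_derivative[OF hol_functions_chart[OF f p(2)] pc])
  have 2: "((\<lambda>z. f (chart_inv c (transition ?d c z))) has_derivative
      (\<lambda>v. frechet_derivative (\<lambda>z. f (chart_inv c z)) (at (snd c p)) (jacobian ?d c p v))) (at (snd ?d p))"
    by (rule has_derivative_compose[OF transition_derivative(1)[OF d(1) p(2) d(2) p(3)]])
      (simp add: transition_chart[OF d] 1)
  have eq: "f (chart_inv c (transition ?d c z)) = f (chart_inv ?d z)"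
    if "z \<in> snd ?d ` (fst ?d \<inter> fst c)" for z
    using that d p by (auto simp: transition_def)
  have "snd ?d p \<in> snd ?d ` (fst ?d \<inter> fst c)" using d p by blast
  from has_derivative_transform_within_open[OF 2 open_overlap[OF d(1) p(2)] this eq]
  have "((\<lambda>z. f (chart_inv ?d z)) has_derivative
      (\<lambda>v. frechet_derivative (\<lambda>z. f (chart_inv c z)) (at (snd c p)) (jacobian ?d c p v))) (at (snd ?d p))" .
  then have "frechet_derivative (\<lambda>z. f (chart_inv ?d z)) (at (snd ?d p))
      = (\<lambda>v. frechet_derivative (\<lambda>z. f (chart_inv c z)) (at (snd c p)) (jacobian ?d c p v))"
    using frechet_derivative_at by metis
  then show ?thesis by (simp add: differential_def coords_eq)
qed

lemma differential_linear:
  assumes "f \<in> holomorphic_functions A U" "p \<in> U"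
  shows "Vector_Spaces.linear (*s) (*) (differential A f p)"
proof -
  have pc: "p \<in> carr A" using assms openin_subset_carr hol_functions_openin by blast
  have c: "chart_at A p \<in> A" "p \<in> fst (chart_at A p)" using chart_at_in[OF pc] by auto
  have "differential A f p = frechet_derivative (\<lambda>z. f (chart_inv (chart_at A p) z)) (at (snd (chart_at A p) p))"
    by (rule ext) (simp add: differential_def)
  then show ?thesis
    using mholomorphic_linear[OF hol_functions_chart[OF assms(1) c(1)], of "snd (chart_at A p) p"] assms(2) c(2)
    by auto
qed

end

section \<open>Holomorphic idempotents\<close>

lemma has_derivative_vec_lambda:
  fixes f :: "'m::finite \<Rightarrow> 'a::real_normed_vector \<Rightarrow> complex"
  assumes "\<And>k. (f k has_derivative f' k) (at x)"
  shows "((\<lambda>x. \<chi> k. f k x) has_derivative (\<lambda>h. \<chi> k. f' k h)) (at x)"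
  unfolding has_derivative_componentwise_within[of "\<lambda>x. \<chi> k. f k x"]
proof
  fix b :: "complex^'m" assume "b \<in> Basis"
  then obtain k u where b: "b = axis k u" unfolding Basis_vec_def by auto
  have "((\<lambda>x. f k x \<bullet> u) has_derivative (\<lambda>h. f' k h \<bullet> u)) (at x)"
    by (rule has_derivative_inner_left[OF assms])
  then show "((\<lambda>x. (\<chi> k. f k x) \<bullet> b) has_derivative (\<lambda>h. (\<chi> k. f' k h) \<bullet> b)) (at x)"
    by (simp add: b inner_axis)
qed

definition smult_alg :: "('n \<Rightarrow> 'n \<Rightarrow> 'n \<Rightarrow> complex) \<Rightarrow> complex^'n::finite \<Rightarrow> complex^'n \<Rightarrow> complex^'n" where
  "smult_alg a u v = (\<chi> k. \<Sum>i\<in>UNIV. \<Sum>j\<in>UNIV. a i j k * (u $ i * v $ j))"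

text \<open>The implicit function theorem for the equation \<open>v \<circ> v = v\<close>.\<close>

lemma holomorphic_idempotent:
  fixes a :: "'n::finite \<Rightarrow> 'n \<Rightarrow> 'n \<Rightarrow> complex^'n \<Rightarrow> complex" and \<epsilon> :: "complex^'n"
  defines "mu \<equiv> \<lambda>z. smult_alg (\<lambda>i j k. a i j k z)"
  assumes a: "\<And>i j k. mholomorphic_on (a i j k) S" and z0: "z0 \<in> S"
    and idem: "mu z0 \<epsilon> \<epsilon> = \<epsilon>" and inj: "\<And>v. mu z0 v \<epsilon> + mu z0 \<epsilon> v = v \<Longrightarrow> v = 0"
  obtains V f where "open V" "z0 \<in> V" "V \<subseteq> S" "vholomorphic_on f V" "f z0 = \<epsilon>"
    "\<forall>z\<in>V. mu z (f z) (f z) = f z"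
proof -
  have oS: "open S" using a mholomorphic_on_open by blast
  \<comment> \<open>The map \<open>(z, v) \<mapsto> (z, v \<circ> v - v)\<close>: inverting it near
    \<open>(z0, \<epsilon>)\<close> solves the idempotent equation with \<open>z\<close> as a
    parameter.\<close>
  define F where "F = (\<lambda>x :: (complex^'n) \<times> (complex^'n).
      (fst x, \<chi> k. (\<Sum>i\<in>UNIV. \<Sum>j\<in>UNIV. a i j k (fst x) * (snd x $ i * snd x $ j)) - snd x $ k))"
  define D where "D = (\<lambda>(x :: (complex^'n) \<times> (complex^'n)) h :: (complex^'n) \<times> (complex^'n).
      (fst h, \<chi> k. (\<Sum>i\<in>UNIV. \<Sum>j\<in>UNIV. a i j k (fst x) * (snd x $ i * snd h $ j + snd h $ i * snd x $ j)
        + frechet_derivative (a i j k) (at (fst x)) (fst h) * (snd x $ i * snd x $ j)) - snd h $ k))"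
  let ?U = "S \<times> (UNIV :: (complex^'n) set)"
  have oU: "open ?U" using oS by (intro open_Times) auto
  have comp: "((\<lambda>x. snd x $ i) has_derivative (\<lambda>h. snd h $ i)) (at x)"
    for i and x :: "(complex^'n) \<times> (complex^'n)"
    by (rule bounded_linear_imp_has_derivative)
      (rule bounded_linear_compose[OF bounded_linear_vec_nth bounded_linear_snd])
  have FD: "(F has_derivative D x) (at x)" if x: "x \<in> ?U" for x
  proof -
    have fx: "fst x \<in> S" using x by auto
    have afd: "((\<lambda>x. a i j k (fst x)) has_derivative
        (\<lambda>h. frechet_derivative (a i j k) (at (fst x)) (fst h))) (at x)" for i j k
      by (rule has_derivative_compose[OF has_derivative_fst[OF has_derivative_ident]
          mholomorphic_has_derivative[OF a fx]])
    show ?thesis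
      unfolding F_def D_def
      by (intro has_derivative_Pair has_derivative_fst has_derivative_ident has_derivative_vec_lambda
          has_derivative_diff has_derivative_sum has_derivative_mult comp afd)
  qed
  have bl: "bounded_linear (D x)" if "x \<in> ?U" for x using has_derivative_bounded_linear[OF FD[OF that]] .
  define B where "B = (\<lambda>x. Blinfun (D x))"
  have B: "blinfun_apply (B x) = D x" if "x \<in> ?U" for x
    unfolding B_def by (rule bounded_linear_Blinfun_apply[OF bl[OF that]])
  have contB: "continuous_on ?U B"
  proof (rule continuous_on_blinfun_componentwise)
    fix h :: "(complex^'n) \<times> (complex^'n)"
    have cfst: "continuous_on ?U (\<lambda>x. \<phi> (fst x))" if "mholomorphic_on \<phi> S" for \<phi>
      by (rule continuous_on_compose2[OF mholomorphic_continuous_on[OF that]])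
        (auto intro!: continuous_intros)
    have csnd: "continuous_on ?U (\<lambda>x. snd x $ i)" for i
      by (intro continuous_intros)
    have "continuous_on ?U (\<lambda>x. D x h)"
      unfolding D_def
      by (intro continuous_on_Pair continuous_on_const continuous_on_vec_lambda continuous_on_diff
          continuous_on_sum continuous_on_add continuous_on_mult csnd cfst a mholomorphic_frechet_derivative)
    then show "continuous_on ?U (\<lambda>x. blinfun_apply (B x) h)"
      by (rule continuous_on_eq) (simp add: B)
  qed
  let ?x0 = "(z0, \<epsilon>)"
  have x0: "?x0 \<in> ?U" using z0 by simp
  \<comment> \<open>The derivative is block triangular. A kernel vector has first component 0, and
    on the second component the derivative is
    \<open>v \<circ> \<epsilon> + \<epsilon> \<circ> v - v\<close>, injective by assumption.\<close>
  have "inj (D ?x0)"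
  proof (rule linear_injective_0[THEN iffD2, OF bounded_linear.linear[OF bl[OF x0]], rule_format])
    show "h = 0" if h: "D ?x0 h = 0" for h
    proof -
      have h1: "fst h = 0" using arg_cong[OF h, of fst] by (simp add: D_def)
      have d0: "frechet_derivative (a i j k) (at z0) 0 = 0" for i j k
        using linear_form_bounded_linear[OF mholomorphic_linear[OF a z0]] linear_simps(3) by blast
      have "(\<chi> k. (\<Sum>i\<in>UNIV. \<Sum>j\<in>UNIV. a i j k z0 * (\<epsilon> $ i * snd h $ j + snd h $ i * \<epsilon> $ j)) - snd h $ k) = 0"
        using arg_cong[OF h, of snd] by (simp add: D_def h1 d0)
      then have "mu z0 (snd h) \<epsilon> + mu z0 \<epsilon> (snd h) = snd h"
        by (simp add: vec_eq_iff mu_def smult_alg_def distrib_left sum.distrib add.commute)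
      then have "snd h = 0" by (rule inj)
      then show "h = 0" using h1 by (simp add: prod_eq_iff)
    qed
  qed
  then obtain g0 where g0: "linear g0" "g0 \<circ> D ?x0 = id"
    using linear_injective_left_inverse[OF bounded_linear.linear[OF bl[OF x0]]] by blast
  have blg0: "bounded_linear g0" using g0(1) linear_conv_bounded_linear by blast
  have inv: "Blinfun g0 o\<^sub>L B ?x0 = id_blinfun"
  proof (rule blinfun_eqI)
    fix h
    show "blinfun_apply (Blinfun g0 o\<^sub>L B ?x0) h = blinfun_apply id_blinfun h"
      using fun_cong[OF g0(2), of h] by (simp add: bounded_linear_Blinfun_apply[OF blg0] B[OF x0])
  qed
  obtain U' V g g' where IFT: "open U'" "U' \<subseteq> ?U" "?x0 \<in> U'" "open V" "F ?x0 \<in> V" "homeomorphism U' V F g"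
    "\<And>y. y \<in> V \<Longrightarrow> (g has_derivative g' y) (at y)"
    "\<And>y. y \<in> V \<Longrightarrow> g' y = Hilbert_Choice.inv (blinfun_apply (B (g y)))"
    "\<And>y. y \<in> V \<Longrightarrow> bij (blinfun_apply (B (g y)))"
    by (rule inverse_function_theorem[OF oU _ contB x0 inv, of F]) (use FD B in auto)
  have Fx0: "F ?x0 = (z0, 0)"
    using idem by (simp add: F_def vec_eq_iff mu_def smult_alg_def)
  define W where "W = (\<lambda>z. (z, 0 :: complex^'n)) -` V"
  have "continuous_on UNIV (\<lambda>z. (z, 0 :: complex^'n))" by (intro continuous_intros)
  then have oW: "open W" unfolding W_def using IFT(4) open_vimage by blast
  have z0W: "z0 \<in> W" using IFT(5) Fx0 by (simp add: W_def)
  \<comment> \<open>The second argument 0 is the value of \<open>v \<circ> v - v\<close>; the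
    inverse preserves the first component.\<close>
  define f where "f = (\<lambda>z. snd (g (z, 0)))"
  have gU: "g (z, 0) \<in> U'" "F (g (z, 0)) = (z, 0)" if "z \<in> W" for z
    using that IFT(6) unfolding homeomorphism_def W_def by auto
  have gz: "g (z, 0) = (z, f z)" if "z \<in> W" for z
    using gU(2)[OF that] by (simp add: F_def f_def prod_eq_iff)
  have WS: "W \<subseteq> S" using gU(1) gz IFT(2) by fastforce
  have "g (z0, 0) = ?x0" using IFT(3,6) Fx0 unfolding homeomorphism_def by metis
  then have fz0: "f z0 = \<epsilon>" by (simp add: f_def)
  have idem_f: "mu z (f z) (f z) = f z" if "z \<in> W" for z
    using gU(2)[OF that] unfolding gz[OF that] by (simp add: F_def vec_eq_iff mu_def smult_alg_def)
  have "vholomorphic_on f W"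
  proof
    fix k
    show "mholomorphic_on (\<lambda>z. f z $ k) W"
    proof (rule mholomorphic_onI[OF oW])
      fix z assume z: "z \<in> W"
      let ?y = "(z, 0 :: complex^'n)"
      have yV: "?y \<in> V" using z by (simp add: W_def)
      have gy: "g ?y \<in> ?U" using gU(1)[OF z] IFT(2) by blast
      have "((\<lambda>z. g (z, 0)) has_derivative (\<lambda>v. g' ?y (v, 0))) (at z)"
        by (rule has_derivative_compose[of "\<lambda>z. (z, 0)" "\<lambda>v. (v, 0)" z UNIV g "g' ?y", OF _ IFT(7)[OF yV]])
          (intro has_derivative_Pair has_derivative_ident has_derivative_const)
      then have gd: "((\<lambda>z. f z) has_derivative (\<lambda>v. snd (g' ?y (v, 0)))) (at z)"
        unfolding f_def by (rule has_derivative_snd)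
      then show "((\<lambda>z. f z $ k) has_derivative (\<lambda>v. snd (g' ?y (v, 0)) $ k)) (at z)"
        by (rule bounded_linear.has_derivative[OF bounded_linear_vec_nth])
      have bij: "bij (D (g ?y))" using IFT(9)[OF yV] B[OF gy] by simp
      have g'D: "g' ?y = Hilbert_Choice.inv (D (g ?y))" using IFT(8)[OF yV] B[OF gy] by simp
      \<comment> \<open>The inverse function theorem is real. Complex homogeneity of the derivative
        of the inverse is inherited from that of \<open>D\<close>.\<close>
      have hom: "D (g ?y) (c *s fst h, c *s snd h) = (c *s fst (D (g ?y) h), c *s snd (D (g ?y) h))" for c h
      proof -
        have "fst (g ?y) \<in> S" using gy by (cases "g ?y") auto
        then have "frechet_derivative (a i j k) (at (fst (g ?y))) (c *s v)
            = c * frechet_derivative (a i j k) (at (fst (g ?y))) v" for i j k v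
          using mholomorphic_linear[OF a] unfolding linear_form_iff by blast
        then show ?thesis
          by (simp add: D_def vec_eq_iff algebra_simps sum_distrib_left)
      qed
      have g'hom: "g' ?y (c *s v, 0) = (c *s fst (g' ?y (v, 0)), c *s snd (g' ?y (v, 0)))" for c v
      proof -
        have "D (g ?y) (g' ?y (v, 0)) = (v, 0)"
          unfolding g'D by (rule surj_f_inv_f[OF bij_is_surj[OF bij]])
        then have "D (g ?y) (c *s fst (g' ?y (v, 0)), c *s snd (g' ?y (v, 0))) = (c *s v, 0)"
          unfolding hom by simp
        then show ?thesis unfolding g'D using bij_is_inj[OF bij] by (metis inv_f_f)
      qed
      have lin: "linear (\<lambda>v. snd (g' ?y (v, 0)) $ k)"
        using bounded_linear.linear[OF has_derivative_bounded_linear[OF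
            bounded_linear.has_derivative[OF bounded_linear_vec_nth gd]]] .
      show "Vector_Spaces.linear (*s) (*) (\<lambda>v. snd (g' ?y (v, 0)) $ k)"
        unfolding linear_form_iff g'hom using linear_add[OF lin] by simp
    qed
  qed
  then show ?thesis using that oW z0W WS fz0 idem_f by blast
qed

lemma smult_alg_norm_le:
  fixes a :: "'n::finite \<Rightarrow> 'n \<Rightarrow> 'n \<Rightarrow> complex"
  assumes "\<And>i j k. cmod (a i j k) \<le> K"
  shows "norm (smult_alg a u v) \<le> (real CARD('n))^3 * K * (norm u * norm v)"
proof -
  have "cmod (smult_alg a u v $ k) \<le> (real CARD('n))^2 * K * (norm u * norm v)" for k
  proof -
    have "cmod (a i j k * (u $ i * v $ j)) \<le> K * (norm u * norm v)" for i j
      unfolding norm_mult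
      using order_trans[OF norm_ge_zero assms]
      by (intro mult_mono assms Finite_Cartesian_Product.norm_nth_le) auto
    then have "cmod (smult_alg a u v $ k) \<le> (\<Sum>i\<in>(UNIV::'n set). \<Sum>j\<in>(UNIV::'n set). K * (norm u * norm v))"
      unfolding smult_alg_def vec_lambda_beta by (intro sum_norm_le)
    then show ?thesis by (simp add: power2_eq_square mult.assoc)
  qed
  then have "norm (smult_alg a u v) \<le> CARD('n) * ((real CARD('n))^2 * K * (norm u * norm v))"
    by (rule norm_vec_le_card)
  then show ?thesis by (simp add: power3_eq_cube power2_eq_square mult.assoc)
qed

section \<open>Semisimple points of F-manifolds\<close>

lemma mat_mult_vec: "mat s *v (x :: complex^'n::finite) = s *s x"
proof -
  have "(mat s *v x) $ i = s * x $ i" for i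
  proof -
    have "(mat s *v x) $ i = (\<Sum>j\<in>UNIV. (if i = j then s else 0) * x $ j)"
      by (simp add: matrix_vector_mult_def mat_component)
    also have "\<dots> = (\<Sum>j\<in>UNIV. if i = j then s * x $ j else 0)" by (rule sum.cong) auto
    finally show ?thesis by simp
  qed
  then show ?thesis by (simp add: vec_eq_iff)
qed

lemma matrix_mult_axis:
  fixes M :: "complex^'n::finite^'m"
  shows "M *v axis i 1 = column i M"
proof -
  have "(M *v axis i 1) $ r = M $ r $ i" for r
  proof -
    have "(M *v axis i 1) $ r = (\<Sum>j\<in>UNIV. M $ r $ j * (if j = i then 1 else 0))"
      by (simp add: matrix_vector_mult_def axis_def)
    also have "\<dots> = (\<Sum>j\<in>UNIV. if j = i then M $ r $ j else 0)" by (rule sum.cong) auto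
    finally show ?thesis by simp
  qed
  then show ?thesis by (simp add: vec_eq_iff column_def)
qed

lemma conjugate_add_mat:
  fixes P M Q :: "complex^'n::finite^'n"
  assumes "P ** Q = mat 1"
  shows "P ** (M + mat s) ** Q = P ** M ** Q + mat s"
proof -
  have "(P ** (M + mat s) ** Q) *v x = (P ** M ** Q + mat s) *v x" for x
  proof -
    have "P *v (Q *v x) = x" by (simp add: matrix_vector_mul_assoc assms)
    then show ?thesis
      by (simp add: matrix_vector_mul_assoc[symmetric] matrix_vector_mult_add_rdistrib mat_mult_vec
          matrix_vector_right_distrib vector_scalar_commute)
  qed
  then show ?thesis by (simp add: matrix_eq)
qed

text \<open>The columns of \<open>Q\<close> are eigenvectors of both matrices, so conjugation by
  \<open>Q\<close> diagonalises them at once and \<open>Ddet_diagonal\<close> applies.\<close>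

lemma eigenbasis_det:
  fixes Q M N :: "complex^'n::finite^'n"
  assumes Q: "det Q \<noteq> 0" and M: "\<And>i. M *v column i Q = u i *s column i Q"
  shows "det (M + mat s) = (\<Prod>i\<in>UNIV. s + u i)"
    and "(\<And>i. N *v column i Q = x i *s column i Q) \<Longrightarrow>
      Ddet (M + mat s) N = (\<Sum>i\<in>UNIV. x i * (\<Prod>j\<in>UNIV - {i}. s + u j))"
proof -
  obtain P where P: "P ** Q = mat 1" "Q ** P = mat 1"
    using Q invertible_det_nz[of Q] unfolding invertible_def by blast
  have diag: "(P ** L ** Q) $ r $ i = (if r = i then y i else 0)"
    if "\<And>i. L *v column i Q = y i *s column i Q" for L y r i
  proof -
    have "(P ** L ** Q) *v axis i 1 = y i *s axis i 1"
    proof -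
      have "Q *v axis i 1 = column i Q" by (simp add: matrix_mult_axis)
      moreover have "P *v column i Q = axis i 1"
        unfolding calculation[symmetric] by (simp add: matrix_vector_mul_assoc P)
      ultimately show ?thesis
        by (simp add: matrix_vector_mul_assoc[symmetric] that vector_scalar_commute)
    qed
    then have "column i (P ** L ** Q) = y i *s axis i 1" by (simp add: matrix_mult_axis)
    then have "column i (P ** L ** Q) $ r = (y i *s axis i 1) $ r" by simp
    then show ?thesis by (auto simp: column_def axis_def)
  qed
  define L where "L = P ** (M + mat s) ** Q"
  have L: "L $ r $ i = (if r = i then s + u i else 0)" for r i
    unfolding L_def conjugate_add_mat[OF P(1)] using diag[OF M] by (simp add: mat_component)
  have "det (M + mat s) = det L"
  proof -
    have "det P * det Q = 1" using P(1) by (metis det_I det_mul)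
    then show ?thesis by (simp add: L_def det_mul mult.commute mult.left_commute)
  qed
  also have "\<dots> = (\<Prod>i\<in>UNIV. L $ i $ i)" by (rule det_diagonal_matrix) (simp add: L)
  finally show "det (M + mat s) = (\<Prod>i\<in>UNIV. s + u i)" by (simp add: L)
  assume N: "\<And>i. N *v column i Q = x i *s column i Q"
  have "Ddet (M + mat s) N = Ddet L (P ** N ** Q)"
    unfolding L_def by (rule Ddet_similar[OF P(1), symmetric])
  also have "\<dots> = (\<Sum>i\<in>UNIV. (P ** N ** Q) $ i $ i * (\<Prod>j\<in>UNIV - {i}. L $ j $ j))"
    by (rule Ddet_diagonal) (simp add: L)
  finally show "Ddet (M + mat s) N = (\<Sum>i\<in>UNIV. x i * (\<Prod>j\<in>UNIV - {i}. s + u j))"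
    by (simp add: L diag[OF N])
qed

section \<open>Lie brackets: locality and the Leibniz rule\<close>

context atlas
begin

lemma vector_field_derivative:
  assumes "X \<in> vector_fields A U" "p \<in> U"
  shows "(field_in_chart A (chart_at A p) X has_derivative
      frechet_derivative (field_in_chart A (chart_at A p) X) (at (snd (chart_at A p) p)))
      (at (snd (chart_at A p) p))"
    "Vector_Spaces.linear (*s) (*s)
      (frechet_derivative (field_in_chart A (chart_at A p) X) (at (snd (chart_at A p) p)))"
proof -
  have p: "p \<in> carr A" using assms openin_subset_carr vector_fields_openin by blast
  have "snd (chart_at A p) p \<in> snd (chart_at A p) ` (U \<inter> fst (chart_at A p))"
    using chart_at_in[OF p] assms(2) by blast
  from vholomorphic_has_derivative[OF vector_fields_chart[OF assms(1)] this] chart_at_in[OF p]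
  show "(field_in_chart A (chart_at A p) X has_derivative
      frechet_derivative (field_in_chart A (chart_at A p) X) (at (snd (chart_at A p) p)))
      (at (snd (chart_at A p) p))"
    "Vector_Spaces.linear (*s) (*s)
      (frechet_derivative (field_in_chart A (chart_at A p) X) (at (snd (chart_at A p) p)))"
    by blast+
qed

lemma field_derivative_cong:
  assumes "X \<in> vector_fields A U" "p \<in> U" "\<And>q. q \<in> U \<Longrightarrow> X q = Y q"
  shows "frechet_derivative (field_in_chart A (chart_at A p) Y) (at (snd (chart_at A p) p))
    = frechet_derivative (field_in_chart A (chart_at A p) X) (at (snd (chart_at A p) p))"
proof -
  let ?c = "chart_at A p"
  have p: "p \<in> carr A" using assms openin_subset_carr vector_fields_openin by blast
  have c: "?c \<in> A" "p \<in> fst ?c" using chart_at_in[OF p] by auto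
  have "(field_in_chart A ?c Y has_derivative
      frechet_derivative (field_in_chart A ?c X) (at (snd ?c p))) (at (snd ?c p))"
    by (rule has_derivative_transform_within_open[OF vector_field_derivative(1)[OF assms(1,2)]
          open_chart_image[OF vector_fields_openin[OF assms(1)] c(1)]])
      (use assms(2,3) c in \<open>auto simp: field_in_chart_def\<close>)
  then show ?thesis using frechet_derivative_at by metis
qed

lemma lie_bracket_cong:
  assumes "X \<in> vector_fields A U" "Y \<in> vector_fields A U" "p \<in> U"
    "\<And>q. q \<in> U \<Longrightarrow> X q = X' q" "\<And>q. q \<in> U \<Longrightarrow> Y q = Y' q"
  shows "lie_bracket A X' Y' p = lie_bracket A X Y p"
  using field_derivative_cong[OF assms(1,3,4)] field_derivative_cong[OF assms(2,3,5)] assms(3-5)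
  by (simp add: lie_bracket_def Let_def)

lemma lie_bracket_swap: "lie_bracket A X Y p = - lie_bracket A Y X p"
  by (simp add: lie_bracket_def Let_def)

lemma lie_bracket_smult:
  assumes X: "X \<in> vector_fields A U" and Y: "Y \<in> vector_fields A U"
    and u: "u \<in> holomorphic_functions A U" and p: "p \<in> U"
  shows "lie_bracket A X (\<lambda>q. u q *s Y q) p = differential A u p (X p) *s Y p + u p *s lie_bracket A X Y p"
proof -
  let ?c = "chart_at A p" let ?z = "snd (chart_at A p) p"
  have pc: "p \<in> carr A" using p X openin_subset_carr vector_fields_openin by blast
  have c: "?c \<in> A" "p \<in> fst ?c" using chart_at_in[OF pc] by auto
  let ?S = "snd ?c ` (U \<inter> fst ?c)"
  have zS: "?z \<in> ?S" using c p by blast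
  have oS: "open ?S" by (rule open_chart_image[OF vector_fields_openin[OF X] c(1)])
  let ?u = "\<lambda>z. u (chart_inv ?c z)"
  let ?Y = "field_in_chart A ?c Y" and ?X = "field_in_chart A ?c X"
  let ?D = "\<lambda>v. ?u ?z *s frechet_derivative ?Y (at ?z) v + frechet_derivative ?u (at ?z) v *s ?Y ?z"
  have du: "(?u has_derivative frechet_derivative ?u (at ?z)) (at ?z)"
    by (rule mholomorphic_has_derivative[OF hol_functions_chart[OF u c(1)] zS])
  have "((\<lambda>z. \<chi> i. ?u z * ?Y z $ i) has_derivative (\<lambda>v. \<chi> i. ?D v $ i)) (at ?z)"
  proof (rule has_derivative_vec_lambda)
    fix i
    have "((\<lambda>z. ?Y z $ i) has_derivative (\<lambda>v. frechet_derivative ?Y (at ?z) v $ i)) (at ?z)"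
      by (rule bounded_linear.has_derivative[OF bounded_linear_vec_nth vector_field_derivative(1)[OF Y p]])
    from has_derivative_mult[OF du this]
    show "((\<lambda>z. ?u z * ?Y z $ i) has_derivative (\<lambda>v. ?D v $ i)) (at ?z)" by simp
  qed
  moreover have "(\<lambda>z. \<chi> i. ?u z * ?Y z $ i) = (\<lambda>z. ?u z *s ?Y z)" by (simp add: vec_eq_iff fun_eq_iff)
  moreover have "(\<lambda>v. \<chi> i. ?D v $ i) = ?D" by (simp only: vec_lambda_eta)
  ultimately have D: "((\<lambda>z. ?u z *s ?Y z) has_derivative ?D) (at ?z)" by (simp only:)
  have "field_in_chart A ?c (\<lambda>q. u q *s Y q) z = ?u z *s ?Y z" if z: "z \<in> ?S" for z
  proof -
    obtain q where q: "q \<in> fst ?c" "z = snd ?c q" using z by blast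
    show ?thesis
      using coords_linear[OF c(1) q(1)] c q by (simp add: field_in_chart_point vlinear_iff)
  qed
  then have "(field_in_chart A ?c (\<lambda>q. u q *s Y q) has_derivative ?D) (at ?z)"
    using has_derivative_transform_within_open[OF D oS zS] by simp
  then have "frechet_derivative (field_in_chart A ?c (\<lambda>q. u q *s Y q)) (at ?z) = ?D"
    by (rule frechet_derivative_at[symmetric])
  moreover have "?Y ?z = Y p" using coords_chart_at[OF pc] c by (simp add: field_in_chart_point)
  moreover have "frechet_derivative ?X (at ?z) (u p *s Y p) = u p *s frechet_derivative ?X (at ?z) (Y p)"
    using vector_field_derivative(2)[OF X p] by (simp add: vlinear_iff)
  ultimately show ?thesis
    using c by (simp add: lie_bracket_def Let_def differential_def vec.scale_right_diff_distrib)
qed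

end

section \<open>Lie brackets of idempotent fields with each other and with the Euler field\<close>

locale F_mfd =
  fixes A :: "('a, 'n::finite) chart set"
    and m :: "'a \<Rightarrow> complex^'n \<Rightarrow> complex^'n \<Rightarrow> complex^'n"
    and e :: "'a \<Rightarrow> complex^'n"
  assumes F: "F_manifold A m e"

sublocale F_mfd \<subseteq> atlas A
proof unfold_locales
  have "connected_complex_manifold A" using F unfolding F_manifold_def by (rule conjunct1)
  then show "complex_atlas A" unfolding connected_complex_manifold_def by (rule conjunct1)
qed

context F_mfd
begin

lemmas F_conjuncts = F[unfolded F_manifold_def, THEN conjunct2]

lemma alg: "p \<in> carr A \<Longrightarrow> unital_algebra (m p) (e p)"
  unfolding unital_algebra_def using F_conjuncts[THEN conjunct1] by (rule bspec)

lemma field_mult_closed: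
  "X \<in> vector_fields A U \<Longrightarrow> Y \<in> vector_fields A U \<Longrightarrow> field_mult m X Y \<in> vector_fields A U"
  using F_conjuncts[THEN conjunct2, THEN conjunct1] by blast

lemma unit_field: "e \<in> vector_fields A (carr A)"
  using F_conjuncts[THEN conjunct2, THEN conjunct2] by (rule conjunct1)

lemma Hertling_Manin:
  assumes "X \<in> vector_fields A U" "Y \<in> vector_fields A U" "Z \<in> vector_fields A U" "W \<in> vector_fields A U" "p \<in> U"
  shows "lie_mult A m (field_mult m X Y) Z W p
    = m p (X p) (lie_mult A m Y Z W p) + m p (Y p) (lie_mult A m X Z W p)"
  using F_conjuncts[THEN conjunct2, THEN conjunct2, THEN conjunct2] assms by blast

text \<open>Multiplying \<open>x = 2 \<epsilon> x\<close> by \<open>\<epsilon>\<close> gives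
  \<open>\<epsilon> x = 2 \<epsilon> x\<close>, so \<open>\<epsilon> x = 0\<close>. In other words
  \<open>2 \<epsilon> - e\<close> is invertible; this kills the brackets below and is also the
  nondegeneracy condition of the implicit function theorem for idempotents.\<close>

lemma idempotent_double:
  assumes "p \<in> carr A" "m p \<epsilon> \<epsilon> = \<epsilon>" "x = m p \<epsilon> x + m p \<epsilon> x"
  shows "x = 0"
proof -
  note alg = alg[OF assms(1)]
  have "m p \<epsilon> x = m p \<epsilon> (m p \<epsilon> x + m p \<epsilon> x)" using assms(3) by simp
  also have "\<dots> = m p (m p \<epsilon> \<epsilon>) x + m p (m p \<epsilon> \<epsilon>) x"
    by (simp only: alg_add_right[OF alg] alg_assoc[OF alg])
  finally have "m p \<epsilon> x = m p \<epsilon> x + m p \<epsilon> x" by (simp only: assms(2))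
  then have "m p \<epsilon> x = 0" by simp
  then show ?thesis using assms(3) by simp
qed

context
  fixes U :: "'a set" and \<epsilon> :: "'n \<Rightarrow> 'a \<Rightarrow> complex^'n" and E :: "'a \<Rightarrow> complex^'n"
  assumes \<epsilon>: "\<And>i. \<epsilon> i \<in> vector_fields A U"
    and idem: "\<And>q i j. q \<in> U \<Longrightarrow> m q (\<epsilon> i q) (\<epsilon> j q) = (if i = j then \<epsilon> i q else 0)"
    and E: "euler_field_weight1 A m E"
begin

lemma idempotent_frame_carr: "q \<in> U \<Longrightarrow> q \<in> carr A"
  using openin_subset_carr vector_fields_openin \<epsilon> by blast

lemma euler_field_local: "E \<in> vector_fields A U"
  using E vector_fields_subset[OF _ vector_fields_openin[OF \<epsilon>]] idempotent_frame_carr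
  unfolding euler_field_weight1_def by blast

text \<open>The F-manifold identity with both fields equal to the idempotent
  \<open>\<epsilon> i\<close> says that the Lie derivative is twice its own product with
  \<open>\<epsilon> i\<close>.\<close>

lemma idempotent_lie_mult:
  assumes Z: "Z \<in> vector_fields A U" and W: "W \<in> vector_fields A U" and p: "p \<in> U"
  shows "lie_mult A m (\<epsilon> i) Z W p = 0"
proof (rule idempotent_double[OF idempotent_frame_carr[OF p]])
  show "m p (\<epsilon> i p) (\<epsilon> i p) = \<epsilon> i p" using idem[OF p] by simp
  have eq: "\<And>q. q \<in> U \<Longrightarrow> \<epsilon> i q = field_mult m (\<epsilon> i) (\<epsilon> i) q" using idem by (simp add: field_mult_def)
  have L: "lie_bracket A (field_mult m (\<epsilon> i) (\<epsilon> i)) Y p = lie_bracket A (\<epsilon> i) Y p"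
    if "Y \<in> vector_fields A U" for Y
    by (rule lie_bracket_cong[OF \<epsilon> that p eq]) auto
  have "lie_mult A m (field_mult m (\<epsilon> i) (\<epsilon> i)) Z W p = lie_mult A m (\<epsilon> i) Z W p"
    unfolding lie_mult_def field_mult_def[of m "lie_bracket A _ _"] field_mult_def[of m _ "lie_bracket A _ _"]
    by (simp only: L Z W field_mult_closed)
  then show "lie_mult A m (\<epsilon> i) Z W p
      = m p (\<epsilon> i p) (lie_mult A m (\<epsilon> i) Z W p) + m p (\<epsilon> i p) (lie_mult A m (\<epsilon> i) Z W p)"
    using Hertling_Manin[OF \<epsilon> \<epsilon> Z W p, of i i] by simp
qed

text \<open>Since the Lie derivative of the multiplication along \<open>\<epsilon> k\<close>
  vanishes, differentiating \<open>\<epsilon> i \<circ> \<epsilon> i = \<epsilon> i\<close> makes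
  the bracket twice its own product with \<open>\<epsilon> i\<close>.\<close>

lemma idempotents_commute:
  assumes p: "p \<in> U"
  shows "lie_bracket A (\<epsilon> k) (\<epsilon> i) p = 0"
proof (rule idempotent_double[OF idempotent_frame_carr[OF p]])
  show "m p (\<epsilon> i p) (\<epsilon> i p) = \<epsilon> i p" using idem[OF p] by simp
  have eq: "\<And>q. q \<in> U \<Longrightarrow> \<epsilon> i q = field_mult m (\<epsilon> i) (\<epsilon> i) q" using idem by (simp add: field_mult_def)
  have "lie_bracket A (\<epsilon> k) (field_mult m (\<epsilon> i) (\<epsilon> i)) p = lie_bracket A (\<epsilon> k) (\<epsilon> i) p"
    by (rule lie_bracket_cong[OF \<epsilon> \<epsilon> p _ eq]) auto
  then show "lie_bracket A (\<epsilon> k) (\<epsilon> i) p = m p (\<epsilon> i p) (lie_bracket A (\<epsilon> k) (\<epsilon> i) p)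
      + m p (\<epsilon> i p) (lie_bracket A (\<epsilon> k) (\<epsilon> i) p)"
    using idempotent_lie_mult[OF \<epsilon> \<epsilon> p, of k i i] alg_commute[OF alg[OF idempotent_frame_carr[OF p]]]
    by (simp add: lie_mult_def field_mult_def algebra_simps)
qed

text \<open>For \<open>x = [E, \<epsilon> k]\<close> the Euler condition reads
  \<open>x - 2 \<epsilon> x = \<epsilon>\<close>. Multiplying by \<open>\<epsilon>\<close> gives
  \<open>\<epsilon> x = - \<epsilon>\<close>, and inserting this
  \<open>x = - \<epsilon>\<close>.\<close>

lemma idempotent_euler_bracket:
  assumes p: "p \<in> U"
  shows "lie_bracket A (\<epsilon> k) E p = \<epsilon> k p"
proof -
  note alg = alg[OF idempotent_frame_carr[OF p]]
  have ee: "m p (\<epsilon> k p) (\<epsilon> k p) = \<epsilon> k p" using idem[OF p] by simp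
  have eq: "\<And>q. q \<in> U \<Longrightarrow> \<epsilon> k q = field_mult m (\<epsilon> k) (\<epsilon> k) q" using idem by (simp add: field_mult_def)
  define x where "x = lie_bracket A E (\<epsilon> k) p"
  have "lie_bracket A E (field_mult m (\<epsilon> k) (\<epsilon> k)) p = x"
    unfolding x_def by (rule lie_bracket_cong[OF euler_field_local \<epsilon> p _ eq]) auto
  moreover have "lie_mult A m E (\<epsilon> k) (\<epsilon> k) p = \<epsilon> k p"
    using conjunct2[OF E[unfolded euler_field_weight1_def], rule_format, OF \<epsilon> \<epsilon> p, of k k] ee
    by (simp only: field_mult_def)
  ultimately have x: "x - m p (\<epsilon> k p) x - m p (\<epsilon> k p) x = \<epsilon> k p"
    using alg_commute[OF alg, of x] by (simp add: lie_mult_def field_mult_def[of _ "lie_bracket A _ _"]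
      field_mult_def[of _ _ "lie_bracket A _ _"] x_def)
  then have "m p (\<epsilon> k p) (x - m p (\<epsilon> k p) x - m p (\<epsilon> k p) x) = \<epsilon> k p" using ee by simp
  moreover have "m p (\<epsilon> k p) (x - m p (\<epsilon> k p) x - m p (\<epsilon> k p) x) = - m p (\<epsilon> k p) x"
    by (simp only: alg_diff_right[OF alg] alg_assoc[OF alg, symmetric] ee) simp
  ultimately have "- m p (\<epsilon> k p) x = \<epsilon> k p" by (simp only:)
  then have "m p (\<epsilon> k p) x = - \<epsilon> k p" by (rule minus_equation_iff[THEN iffD1, symmetric])
  then have "x + \<epsilon> k p = 0" using x by (simp add: algebra_simps)
  then have "x = - \<epsilon> k p" by (simp only: eq_neg_iff_add_eq_0)
  then show ?thesis using lie_bracket_swap[of "\<epsilon> k" E p] by (simp add: x_def)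
qed

text \<open>The multiplication is invariant along \<open>\<epsilon> k\<close>, so
  \<open>[\<epsilon> k, E \<circ> \<epsilon> i] = [\<epsilon> k, E] \<circ> \<epsilon> i =
  \<epsilon> k \<circ> \<epsilon> i\<close>. On the other hand
  \<open>E \<circ> \<epsilon> i = u \<epsilon> i\<close>, and the Leibniz rule turns the left side
  into the derivative of \<open>u\<close> times \<open>\<epsilon> i\<close>.\<close>

lemma eigenvalue_derivative:
  assumes p: "p \<in> U" and u: "u \<in> holomorphic_functions A U"
    and Eu: "\<And>q. q \<in> U \<Longrightarrow> m q (E q) (\<epsilon> i q) = u q *s \<epsilon> i q" and nz: "\<epsilon> i p \<noteq> 0"
  shows "differential A u p (\<epsilon> k p) = (if k = i then 1 else 0)"
proof -
  note alg = alg[OF idempotent_frame_carr[OF p]]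
  have "lie_mult A m (\<epsilon> k) E (\<epsilon> i) p = 0" by (rule idempotent_lie_mult[OF euler_field_local \<epsilon> p])
  then have 1: "lie_bracket A (\<epsilon> k) (field_mult m E (\<epsilon> i)) p = m p (\<epsilon> k p) (\<epsilon> i p)"
    unfolding lie_mult_def field_mult_def[of m "lie_bracket A _ _"] field_mult_def[of m _ "lie_bracket A _ _"]
    by (simp add: idempotents_commute[OF p] idempotent_euler_bracket[OF p] alg_zero[OF alg])
  have "lie_bracket A (\<epsilon> k) (\<lambda>q. u q *s \<epsilon> i q) p = lie_bracket A (\<epsilon> k) (field_mult m E (\<epsilon> i)) p"
    by (rule lie_bracket_cong[OF \<epsilon> field_mult_closed[OF euler_field_local \<epsilon>] p])
      (simp_all add: field_mult_def Eu)
  then have "differential A u p (\<epsilon> k p) *s \<epsilon> i p = m p (\<epsilon> k p) (\<epsilon> i p)"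
    using lie_bracket_smult[OF \<epsilon> \<epsilon> u p, of k i] 1 by (simp add: idempotents_commute[OF p])
  then have "differential A u p (\<epsilon> k p) *s \<epsilon> i p = (if k = i then 1 else 0) *s \<epsilon> i p"
    using idem[OF p] by simp
  then show ?thesis using nz unfolding vec.scale_cancel_right by blast
qed

end

end

context F_mfd
begin

subsection \<open>Multiplication in charts\<close>

text \<open>The matrix \<open>matrix (m p u)\<close> refers to the chart chosen at \<open>p\<close>
  and need not vary holomorphically with \<open>p\<close>. In a fixed chart it does, and the two are
  conjugate, so determinants and \<open>Ddet\<close> agree.\<close>

definition mult_matrix :: "('a, 'n) chart \<Rightarrow> 'a \<Rightarrow> complex^'n \<Rightarrow> complex^'n^'n" where
  "mult_matrix c p u = matrix (\<lambda>v. coords A c p (m p u (tangent c p v)))"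

context
  fixes c p assumes c: "c \<in> A" and p: "p \<in> fst c"
begin

lemma mult_matrix_conjugate:
  "mult_matrix c p u = matrix (coords A c p) ** matrix (m p u) ** matrix (tangent c p)"
proof -
  note lin = coords_linear[OF c p] tangent_linear[OF c p] alg_linear[OF alg[OF chart_point_carr[OF c p]], of u]
  have 1: "matrix (m p u \<circ> tangent c p) = matrix (m p u) ** matrix (tangent c p)"
    by (rule matrix_compose_gen[OF lin(2,3)])
  have "matrix (coords A c p \<circ> (m p u \<circ> tangent c p)) = matrix (coords A c p) ** matrix (m p u \<circ> tangent c p)"
    by (rule matrix_compose_gen[OF Vector_Spaces.linear_compose[OF lin(2,3)] lin(1)])
  then have "mult_matrix c p u = matrix (coords A c p) ** (matrix (m p u) ** matrix (tangent c p))"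
    unfolding 1 unfolding mult_matrix_def o_def .
  then show ?thesis by (simp only: matrix_mul_assoc)
qed

lemma coords_tangent_matrix: "matrix (coords A c p) ** matrix (tangent c p) = mat 1"
proof -
  have "matrix (coords A c p \<circ> tangent c p) = matrix (coords A c p) ** matrix (tangent c p)"
    by (rule matrix_compose_gen[OF tangent_linear[OF c p] coords_linear[OF c p]])
  moreover have "coords A c p \<circ> tangent c p = (\<lambda>x. x)" by (rule ext) (simp add: coords_tangent[OF c p])
  moreover have "matrix (\<lambda>x. x) = (mat 1 :: complex^'n^'n)"
    by (simp add: matrix_def mat_def axis_def vec_eq_iff)
  ultimately show ?thesis by simp
qed

lemma det_mult_matrix: "det (mult_matrix c p u + mat s) = det (matrix (m p u) + mat s)"
proof -
  have "det (matrix (coords A c p)) * det (matrix (tangent c p)) = 1"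
    using coords_tangent_matrix by (metis det_I det_mul)
  then show ?thesis
    unfolding mult_matrix_conjugate conjugate_add_mat[OF coords_tangent_matrix, symmetric]
    by (simp add: det_mul mult.commute mult.left_commute)
qed

lemma Ddet_mult_matrix:
  "Ddet (mult_matrix c p u + mat s) (mult_matrix c p v) = Ddet (matrix (m p u) + mat s) (matrix (m p v))"
  unfolding mult_matrix_conjugate conjugate_add_mat[OF coords_tangent_matrix, symmetric]
  by (rule Ddet_similar[OF coords_tangent_matrix])

lemma mult_matrix_vec: "mult_matrix c p u *v v = coords A c p (m p u (tangent c p v))"
proof -
  have "Vector_Spaces.linear (*s) (*s) (\<lambda>v. coords A c p (m p u (tangent c p v)))"
    using coords_linear[OF c p] tangent_linear[OF c p] alg_linear[OF alg[OF chart_point_carr[OF c p]], of u]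
    by (simp add: vlinear_iff)
  then show ?thesis unfolding mult_matrix_def by (rule matrix_works)
qed

lemma mult_matrix_entry: "mult_matrix c p u $ i $ j = coords A c p (m p u (coord_vector A c j p)) $ i"
  by (simp add: mult_matrix_def matrix_def coord_vector_eq)

lemma mult_matrix_unit: "mult_matrix c p (e p) = mat 1"
proof -
  have "mult_matrix c p (e p) *v v = mat 1 *v v" for v
    by (simp add: mult_matrix_vec alg_unit[OF alg[OF chart_point_carr[OF c p]]] coords_tangent[OF c p])
  then show ?thesis by (simp add: matrix_eq)
qed

lemma mult_matrix_linear:
  "mult_matrix c p u $ i $ j = (\<Sum>k\<in>UNIV. coords A c p u $ k * mult_matrix c p (coord_vector A c k p) $ i $ j)"
proof -
  note alg = alg[OF chart_point_carr[OF c p]]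
  let ?D = "\<lambda>x. coords A c p (m p (tangent c p x) (coord_vector A c j p)) $ i"
  have "Vector_Spaces.linear (*s) (*) ?D"
    using coords_linear[OF c p] tangent_linear[OF c p]
    by (simp add: vlinear_iff linear_form_iff alg_add_left[OF alg] alg_smult_left[OF alg])
  then have "?D (coords A c p u) = (\<Sum>k\<in>UNIV. coords A c p u $ k * ?D (axis k 1))"
    by (rule linear_form_sum_axis)
  then show ?thesis by (simp add: mult_matrix_entry tangent_coords[OF c p] coord_vector_eq)
qed

end

lemma mult_matrix_field_hol:
  assumes c: "c \<in> A" and X: "X \<in> vector_fields A U"
  shows "mholomorphic_on (\<lambda>z. mult_matrix c (chart_inv c z) (X (chart_inv c z)) $ i $ j) (snd c ` (U \<inter> fst c))"
proof -
  let ?V = "U \<inter> fst c"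
  have V: "openin mtop ?V" using vector_fields_openin[OF X] openin_chart[OF c] by (rule openin_Int)
  have "field_mult m X (coord_vector A c j) \<in> vector_fields A ?V"
    by (intro field_mult_closed vector_fields_subset[OF X V]
        vector_fields_subset[OF coord_vector_in_vector_fields[OF c] V]) auto
  from vector_fields_chart[OF this c]
  have "mholomorphic_on (\<lambda>z. field_in_chart A c (field_mult m X (coord_vector A c j)) z $ i) (snd c ` ?V)"
    by simp
  then show ?thesis
    by (rule mholomorphic_on_cong)
      (use c in \<open>auto simp: field_in_chart_point field_mult_def mult_matrix_entry\<close>)
qed

subsection \<open>The characteristic polynomial of a vector field\<close>

definition charpoly_at :: "('a \<Rightarrow> complex^'n) \<Rightarrow> complex \<Rightarrow> 'a \<Rightarrow> complex" where
  "charpoly_at E s p = det (matrix (m p (E p)) + mat s)"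

lemma charpoly_at_hol:
  assumes X: "X \<in> vector_fields A U"
  shows "charpoly_at X s \<in> holomorphic_functions A U"
proof -
  have "mholomorphic_on (\<lambda>z. charpoly_at X s (chart_inv c z)) (snd c ` (U \<inter> fst c))" if c: "c \<in> A" for c
  proof -
    let ?S = "snd c ` (U \<inter> fst c)"
    have oS: "open ?S" by (rule open_chart_image[OF vector_fields_openin[OF X] c])
    have "mholomorphic_on (\<lambda>z. (mult_matrix c (chart_inv c z) (X (chart_inv c z)) + mat s) $ i $ j) ?S" for i j
      using mholomorphic_add[OF mult_matrix_field_hol[OF c X] mholomorphic_const[OF oS]] by simp
    then have "mholomorphic_on (\<lambda>z. det (mult_matrix c (chart_inv c z) (X (chart_inv c z)) + mat s)) ?S"
      by (rule mholomorphic_det[OF oS])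
    then show ?thesis
      by (rule mholomorphic_on_cong) (use c in \<open>auto simp: charpoly_at_def det_mult_matrix\<close>)
  qed
  then show ?thesis using vector_fields_openin[OF X] by (simp add: holomorphic_functions_def)
qed

subsection \<open>Frames of idempotents\<close>

definition idempotent_frame :: "'a \<Rightarrow> 'a set \<Rightarrow> ('n \<Rightarrow> 'a \<Rightarrow> complex^'n) \<Rightarrow> bool" where
  "idempotent_frame p U \<epsilon> \<longleftrightarrow> openin mtop U \<and> p \<in> U \<and> U \<subseteq> fst (chart_at A p) \<and>
    (\<forall>i. \<epsilon> i \<in> vector_fields A U) \<and>
    (\<forall>q\<in>U. \<forall>i j. m q (\<epsilon> i q) (\<epsilon> j q) = (if i = j then \<epsilon> i q else 0)) \<and>
    (\<forall>q\<in>U. det (\<chi> r i. coords A (chart_at A p) q (\<epsilon> i q) $ r) \<noteq> 0)"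

lemma idempotent_frameD:
  assumes "idempotent_frame p U \<epsilon>"
  shows "openin mtop U" "p \<in> U" "U \<subseteq> fst (chart_at A p)" "\<And>i. \<epsilon> i \<in> vector_fields A U"
    "\<And>q i j. q \<in> U \<Longrightarrow> m q (\<epsilon> i q) (\<epsilon> j q) = (if i = j then \<epsilon> i q else 0)"
    "\<And>q. q \<in> U \<Longrightarrow> det (\<chi> r i. coords A (chart_at A p) q (\<epsilon> i q) $ r) \<noteq> 0"
  using assms unfolding idempotent_frame_def by blast+

text \<open>The idempotents at \<open>p\<close> are continued one by one by the implicit function
  theorem. The product of two different ones is again idempotent and vanishes at \<open>p\<close>.
  An idempotent \<open>w\<close> satisfies \<open>norm w \<le> C * (norm w)^2\<close>, so a small
  one is zero; hence the continued idempotents stay orthogonal.\<close>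

lemma idempotent_frame_exists:
  assumes p: "p \<in> carr A" and ss: "semisimple_algebra (m p)"
  shows "\<exists>U \<epsilon>. idempotent_frame p U \<epsilon>"
proof -
  define c where "c = chart_at A p"
  have c: "c \<in> A" "p \<in> fst c" unfolding c_def using chart_at_in[OF p] by auto
  note algp = alg[OF p]
  obtain Fm :: "complex^'n^'n" and \<epsilon>0 :: "'n \<Rightarrow> complex^'n" where \<epsilon>0:
    "\<And>i j. m p (\<epsilon>0 i) (\<epsilon>0 j) = (if i = j then \<epsilon>0 i else 0)"
    "\<And>v. v = (\<Sum>i\<in>UNIV. (Fm *v v) $ i *s \<epsilon>0 i)"
    "\<And>i j. (Fm *v \<epsilon>0 j) $ i = (if i = j then 1 else 0)"
    by (rule semisimple_idempotent_basis[OF algp ss], rule that, assumption+)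
  let ?S = "snd c ` fst c"
  let ?z0 = "snd c p"
  have oS: "open ?S" by (rule open_chart_range[OF c(1)])
  have z0: "?z0 \<in> ?S" using c by blast
  define a where "a = (\<lambda>i j k z. mult_matrix c (chart_inv c z) (coord_vector A c i (chart_inv c z)) $ k $ j)"
  have a: "mholomorphic_on (a i j k) ?S" for i j k
    unfolding a_def using mult_matrix_field_hol[OF c(1) coord_vector_in_vector_fields[OF c(1)]] by simp
  have mu: "smult_alg (\<lambda>i j k. a i j k (snd c q)) u v = coords A c q (m q (tangent c q u) (tangent c q v))"
    if q: "q \<in> fst c" for q u v
  proof -
    have "smult_alg (\<lambda>i j k. a i j k (snd c q)) u v = mult_matrix c q (tangent c q u) *v v"
    proof (subst vec_eq_iff, intro allI)
      fix k
      have "(mult_matrix c q (tangent c q u) *v v) $ k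
          = (\<Sum>j\<in>UNIV. (\<Sum>i\<in>UNIV. u $ i * a i j k (snd c q)) * v $ j)"
        using c(1) q unfolding matrix_vector_mult_def
        by (simp add: mult_matrix_linear[OF c(1) q, of "tangent c q u"] coords_tangent[OF c(1) q] a_def)
      also have "\<dots> = (\<Sum>i\<in>UNIV. \<Sum>j\<in>UNIV. a i j k (snd c q) * (u $ i * v $ j))"
        unfolding sum_distrib_right by (subst sum.swap) (simp add: mult_ac)
      finally show "smult_alg (\<lambda>i j k. a i j k (snd c q)) u v $ k = (mult_matrix c q (tangent c q u) *v v) $ k"
        by (simp add: smult_alg_def)
    qed
    then show ?thesis by (simp add: mult_matrix_vec[OF c(1) q])
  qed
  have cid: "coords A c p v = v" for v unfolding c_def by (rule coords_chart_at[OF p])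
  then have tid: "tangent c p v = v" for v using tangent_coords[OF c] by metis
  have mup: "smult_alg (\<lambda>i j k. a i j k ?z0) u v = m p u v" for u v
    using mu[OF c(2)] by (simp add: cid tid)
  define P where "P = (\<lambda>i (Vf :: (complex^'n) set \<times> (complex^'n \<Rightarrow> complex^'n)).
      open (fst Vf) \<and> ?z0 \<in> fst Vf \<and> fst Vf \<subseteq> ?S \<and> vholomorphic_on (snd Vf) (fst Vf) \<and>
      snd Vf ?z0 = \<epsilon>0 i \<and> (\<forall>z\<in>fst Vf. smult_alg (\<lambda>i j k. a i j k z) (snd Vf z) (snd Vf z) = snd Vf z))"
  have "\<exists>Vf. P i Vf" for i
  proof -
    have 1: "smult_alg (\<lambda>i j k. a i j k ?z0) (\<epsilon>0 i) (\<epsilon>0 i) = \<epsilon>0 i" using \<epsilon>0(1)[of i i] mup by simp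
    have 2: "v = 0" if "smult_alg (\<lambda>i j k. a i j k ?z0) v (\<epsilon>0 i) + smult_alg (\<lambda>i j k. a i j k ?z0) (\<epsilon>0 i) v = v" for v
    proof (rule idempotent_double[OF p])
      show "m p (\<epsilon>0 i) (\<epsilon>0 i) = \<epsilon>0 i" using \<epsilon>0(1)[of i i] by simp
      show "v = m p (\<epsilon>0 i) v + m p (\<epsilon>0 i) v"
        using that unfolding mup alg_commute[OF algp, of v] by simp
    qed
    have "\<exists>V f. open V \<and> ?z0 \<in> V \<and> V \<subseteq> ?S \<and> vholomorphic_on f V \<and> f ?z0 = \<epsilon>0 i \<and>
        (\<forall>z\<in>V. smult_alg (\<lambda>i j k. a i j k z) (f z) (f z) = f z)"
      by (rule holomorphic_idempotent[OF a z0 1 2]) (assumption | intro exI conjI | assumption)+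
    then obtain V f where "open V \<and> ?z0 \<in> V \<and> V \<subseteq> ?S \<and> vholomorphic_on f V \<and> f ?z0 = \<epsilon>0 i \<and>
        (\<forall>z\<in>V. smult_alg (\<lambda>i j k. a i j k z) (f z) (f z) = f z)" by (elim exE)
    then have "P i (V, f)" unfolding P_def fst_conv snd_conv by blast
    then show ?thesis by (rule exI)
  qed
  then obtain Vf where "\<And>i. P i (Vf i)" by metis
  note Vf = this[unfolded P_def]
  define f where "f = (\<lambda>i. snd (Vf i))"
  define V where "V = (\<Inter>i. fst (Vf i))"
  have "open V" "?z0 \<in> V" unfolding V_def using Vf by auto
  moreover have "V \<subseteq> fst (Vf undefined)" unfolding V_def by blast
  then have "V \<subseteq> ?S" using Vf[of undefined] by blast
  ultimately have V: "open V" "?z0 \<in> V" "V \<subseteq> ?S" by blast+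
  have fV: "vholomorphic_on (f i) V" for i
  proof
    fix k
    show "mholomorphic_on (\<lambda>z. f i z $ k) V"
      by (rule mholomorphic_on_subset[OF _ V(1), of _ "fst (Vf i)"]) (use Vf[of i] in \<open>auto simp: f_def V_def\<close>)
  qed
  have f0: "f i ?z0 = \<epsilon>0 i" for i using Vf by (simp add: f_def)
  have fidem: "smult_alg (\<lambda>i j k. a i j k z) (f i z) (f i z) = f i z" if "z \<in> V" for i z
    using Vf[of i] that by (auto simp: f_def V_def)
  obtain R where R: "R > 0" "cball ?z0 R \<subseteq> V" using V open_contains_cball by blast
  have "\<exists>B. \<forall>z\<in>cball ?z0 R. cmod (a i j k z) \<le> B" for i j k
  proof -
    have "continuous_on (cball ?z0 R) (a i j k)"
      by (rule continuous_on_subset[OF mholomorphic_continuous_on[OF a]]) (use R V in blast)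
    then have "bounded (a i j k ` cball ?z0 R)"
      using compact_continuous_image compact_cball compact_imp_bounded by blast
    then show ?thesis unfolding bounded_iff by auto
  qed
  then obtain B where B: "\<And>i j k z. z \<in> cball ?z0 R \<Longrightarrow> cmod (a i j k z) \<le> B i j k" by metis
  define K where "K = (\<Sum>i\<in>UNIV. \<Sum>j\<in>UNIV. \<Sum>k\<in>UNIV. \<bar>B i j k\<bar>)"
  have K: "cmod (a i j k z) \<le> K" if "z \<in> cball ?z0 R" for i j k z
  proof -
    have "cmod (a i j k z) \<le> \<bar>B i j k\<bar>" using B[OF that, of i j k] by linarith
    also have "\<dots> \<le> (\<Sum>k\<in>UNIV. \<bar>B i j k\<bar>)" by (rule member_le_sum) auto
    also have "\<dots> \<le> (\<Sum>j\<in>UNIV. \<Sum>k\<in>UNIV. \<bar>B i j k\<bar>)"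
      by (rule member_le_sum[where f = "\<lambda>j. \<Sum>k\<in>UNIV. \<bar>B i j k\<bar>"]) (auto intro: sum_nonneg)
    also have "\<dots> \<le> K" unfolding K_def
      by (rule member_le_sum[where f = "\<lambda>i. \<Sum>j\<in>UNIV. \<Sum>k\<in>UNIV. \<bar>B i j k\<bar>"]) (auto intro: sum_nonneg)
    finally show ?thesis .
  qed
  have K0: "K \<ge> 0" unfolding K_def by (auto intro!: sum_nonneg)
  define C where "C = (real CARD('n))^3 * K"
  have C0: "C \<ge> 0" using K0 by (simp add: C_def)
  define w where "w = (\<lambda>i j z. smult_alg (\<lambda>i j k. a i j k z) (f i z) (f j z))"
  have wcont: "continuous_on V (w i j)" for i j
  proof -
    have "mholomorphic_on (\<lambda>z. w i j z $ k) V" for k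
      unfolding w_def smult_alg_def vec_lambda_beta
      using fV mholomorphic_on_subset[OF a V(1,3)]
      by (intro mholomorphic_sum V(1) mholomorphic_mult) auto
    then show ?thesis using vholomorphic_continuous_on[of "w i j" V] by blast
  qed
  define Q where "Q = (\<lambda>z. \<chi> r i. f i z $ r)"
  have Qcont: "continuous_on V (\<lambda>z. det (Q z))"
    by (rule mholomorphic_continuous_on[OF mholomorphic_det[OF V(1)]]) (use fV in \<open>simp add: Q_def\<close>)
  have Q0: "det (Q ?z0) \<noteq> 0"
  proof -
    have "Fm ** Q ?z0 = mat 1"
      using \<epsilon>0(3) by (auto simp: vec_eq_iff Q_def f0 matrix_matrix_mult_def matrix_vector_mult_def mat_def)
    then show ?thesis by (metis det_I det_mul mult_zero_right zero_neq_one)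
  qed
  \<comment> \<open>Products of norm below \<open>1 / (C + 1)\<close> are too small for nonzero
    idempotents; the summand 1 covers \<open>C = 0\<close>. The last condition keeps the frame
    linearly independent.\<close>
  define W where "W = ball ?z0 R \<inter> (\<Inter>i. \<Inter>j\<in>-{i}. V \<inter> w i j -` ball 0 (1 / (C + 1))) \<inter> (V \<inter> (\<lambda>z. det (Q z)) -` (- {0}))"
  have "open (V \<inter> w i j -` ball 0 (1 / (C + 1)))" for i j
    by (rule continuous_open_preimage[OF wcont V(1) open_ball])
  moreover have "open (V \<inter> (\<lambda>z. det (Q z)) -` (- {0}))"
    by (rule continuous_open_preimage[OF Qcont V(1)]) (simp add: open_Compl)
  ultimately have "open W"
    unfolding W_def by (intro open_Int[OF open_Int[OF open_ball]] open_INT ballI) auto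
  have wz0: "w i j ?z0 = 0" if "i \<noteq> j" for i j
    using \<epsilon>0(1)[of i j] that by (simp add: w_def f0 mup)
  have "?z0 \<in> W" unfolding W_def using R V Q0 wz0 C0 by auto
  have WV: "W \<subseteq> V" unfolding W_def by auto
  then have WS: "W \<subseteq> ?S" using V by blast
  define U where "U = chart_inv c ` W"
  note U = openin_chart_preimage[OF c(1) \<open>open W\<close> WS, folded U_def]
  have pU: "p \<in> U" unfolding U_def using \<open>?z0 \<in> W\<close> c by (metis chart_inv_chart imageI)
  define \<epsilon> where "\<epsilon> = (\<lambda>i. chart_field c (f i))"
  have \<epsilon>: "\<epsilon> i \<in> vector_fields A U" for i
    unfolding \<epsilon>_def
  proof (rule chart_field_in_vector_fields[OF c(1) U(1,2)])
    show "vholomorphic_on (f i) (snd c ` U)"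
      unfolding U(3) using fV[of i] mholomorphic_on_subset[OF _ \<open>open W\<close> WV] by blast
  qed
  have qW: "snd c q \<in> W" "q \<in> fst c" if "q \<in> U" for q
    using that U(2,3) by auto
  have c\<epsilon>: "coords A c q (\<epsilon> i q) = f i (snd c q)" if "q \<in> fst c" for q i
    using that c(1) by (simp add: \<epsilon>_def chart_field_def coords_tangent)
  have mult: "coords A c q (m q (\<epsilon> i q) (\<epsilon> j q)) = w i j (snd c q)" if q: "q \<in> fst c" for q i j
    using mu[OF q, of "f i (snd c q)" "f j (snd c q)"] by (simp add: w_def \<epsilon>_def chart_field_def)
  have idem: "m q (\<epsilon> i q) (\<epsilon> i q) = \<epsilon> i q" if q: "q \<in> U" for q i
  proof -
    have "coords A c q (m q (\<epsilon> i q) (\<epsilon> i q)) = coords A c q (\<epsilon> i q)"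
      using mult[OF qW(2)[OF q]] c\<epsilon>[OF qW(2)[OF q]] fidem[of "snd c q" i] qW(1)[OF q] WV by (auto simp: w_def)
    then show ?thesis using coords_inj[OF c(1) qW(2)[OF q]] by blast
  qed
  have orth: "m q (\<epsilon> i q) (\<epsilon> j q) = 0" if q: "q \<in> U" and ij: "i \<noteq> j" for q i j
  proof -
    let ?z = "snd c q"
    have qc: "q \<in> carr A" using openin_subset_carr[OF U(1)] q by blast
    let ?x = "m q (\<epsilon> i q) (\<epsilon> j q)"
    note alg = alg[OF qc]
    have "m q ?x ?x = m q (m q (\<epsilon> i q) (\<epsilon> i q)) (m q (\<epsilon> j q) (\<epsilon> j q))"
      using alg_assoc[OF alg] alg_left_commute[OF alg] by simp
    then have xx: "m q ?x ?x = ?x" using idem[OF q] by simp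
    have "w i j ?z = smult_alg (\<lambda>i j k. a i j k ?z) (w i j ?z) (w i j ?z)"
      using mu[OF qW(2)[OF q], of "w i j ?z" "w i j ?z"] mult[OF qW(2)[OF q], of i j, symmetric]
        xx tangent_coords[OF c(1) qW(2)[OF q]] by simp
    moreover have "norm (smult_alg (\<lambda>i j k. a i j k ?z) (w i j ?z) (w i j ?z)) \<le> C * (norm (w i j ?z) * norm (w i j ?z))"
      unfolding C_def by (rule smult_alg_norm_le) (use K qW(1)[OF q] in \<open>auto simp: W_def\<close>)
    ultimately have le: "norm (w i j ?z) \<le> (C * norm (w i j ?z)) * norm (w i j ?z)" by (simp add: mult.assoc)
    have "?z \<in> w i j -` ball 0 (1 / (C + 1))" using qW(1)[OF q] ij unfolding W_def by blast
    then have "norm (w i j ?z) * (C + 1) < 1" using C0 by (simp add: pos_less_divide_eq add_nonneg_pos)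
    then have "norm (w i j ?z) + C * norm (w i j ?z) < 1" by (simp add: algebra_simps)
    then have lt: "C * norm (w i j ?z) < 1" using norm_ge_zero[of "w i j ?z"] by linarith
    have "w i j ?z = 0"
    proof (rule ccontr)
      assume "w i j ?z \<noteq> 0"
      then have "(C * norm (w i j ?z)) * norm (w i j ?z) < 1 * norm (w i j ?z)"
        using lt by (intro mult_strict_right_mono) auto
      then show False using le by simp
    qed
    then have "coords A c q ?x = coords A c q 0"
      using mult[OF qW(2)[OF q], of i j] coords_linear[OF c(1) qW(2)[OF q]]
      by (metis vec.linear_0)
    then show ?thesis using coords_inj[OF c(1) qW(2)[OF q]] by blast
  qed
  have "idempotent_frame p U \<epsilon>"
    unfolding idempotent_frame_def
  proof (intro conjI allI ballI)
    show "openin mtop U" "p \<in> U" by (fact U(1), fact pU)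
    show "U \<subseteq> fst (chart_at A p)" using U(2) by (simp add: c_def)
    show "\<epsilon> i \<in> vector_fields A U" for i by (rule \<epsilon>)
    show "m q (\<epsilon> i q) (\<epsilon> j q) = (if i = j then \<epsilon> i q else 0)" if "q \<in> U" for q i j
      using idem[OF that, of i] orth[OF that, of i j] by (cases "i = j") simp_all
    show "det (\<chi> r i. coords A (chart_at A p) q (\<epsilon> i q) $ r) \<noteq> 0" if "q \<in> U" for q
      using qW(1)[OF that] c\<epsilon>[OF qW(2)[OF that]] unfolding W_def Q_def c_def[symmetric] by simp
  qed
  then show ?thesis by blast
qed

end

section \<open>The eigenvalues of the Euler field as local coordinates at semisimple points\<close>

lemma eventually_nonzero_of_derivative:
  fixes g :: "complex \<Rightarrow> complex"
  assumes "(g has_field_derivative d) (at 0)" "d \<noteq> 0"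
  shows "eventually (\<lambda>t. g t \<noteq> 0) (at 0)"
proof (cases "g 0 = 0")
  case False
  have "(g \<longlongrightarrow> g 0) (at 0)" using DERIV_isCont[OF assms(1)] by (simp add: isCont_def)
  then show ?thesis using False by (rule tendsto_imp_eventually_ne)
next
  case True
  have "((\<lambda>h. (g (0 + h) - g 0) / h) \<longlongrightarrow> d) (at 0)" using assms(1) by (rule DERIV_D)
  then have "eventually (\<lambda>h. (g (0 + h) - g 0) / h \<noteq> 0) (at 0)"
    using assms(2) by (rule tendsto_imp_eventually_ne)
  then show ?thesis by (rule eventually_mono) (use True in auto)
qed

lemma vlinear_sum:
  fixes L :: "complex^'k \<Rightarrow> complex^'m"
  assumes L: "Vector_Spaces.linear (*s) (*s) L" and "finite I"
  shows "L (\<Sum>i\<in>I. y i *s v i) = (\<Sum>i\<in>I. y i *s L (v i))"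
  using assms(2)
proof induction
  case empty
  have "L (0 *s 0) = 0 *s L 0" using L unfolding vlinear_iff by blast
  then show ?case by simp
qed (use L in \<open>simp add: vlinear_iff\<close>)

lemma inj_complex_finite: "\<exists>x :: 'n::finite \<Rightarrow> complex. inj x"
proof -
  obtain f :: "'n \<Rightarrow> nat" where "inj f" using finite_imp_inj_to_nat_seg[of "UNIV :: 'n set"] by auto
  then have "inj (\<lambda>i. complex_of_real (real (f i)))" by (auto simp: inj_def)
  then show ?thesis by blast
qed

context F_mfd
begin

text \<open>The directional derivatives along the columns of \<open>Q\<close> make the eigenvalues \<open>u\<close> of the Euler
  field local coordinates.\<close>

definition euler_eigenvalues ::
  "('a \<Rightarrow> complex^'n) \<Rightarrow> 'a \<Rightarrow> 'a set \<Rightarrow> ('n \<Rightarrow> 'a \<Rightarrow> complex) \<Rightarrow> complex^'n^'n \<Rightarrow> bool" where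
  "euler_eigenvalues E p U u Q \<longleftrightarrow> openin mtop U \<and> p \<in> U \<and>
    (\<forall>i. u i \<in> holomorphic_functions A U) \<and>
    (\<forall>q\<in>U. \<forall>s. charpoly_at E s q = (\<Prod>i\<in>UNIV. s + u i q)) \<and> det Q \<noteq> 0 \<and>
    (\<forall>x i. differential A (u i) p (Q *v x) = x $ i) \<and>
    (\<forall>x s. Ddet (matrix (m p (E p)) + mat s) (matrix (m p (Q *v x)))
      = (\<Sum>i\<in>UNIV. x $ i * (\<Prod>j\<in>UNIV - {i}. s + u j p)))"

lemma euler_eigenvaluesD:
  assumes "euler_eigenvalues E p U u Q"
  shows "openin mtop U" "p \<in> U"
    "\<And>i. u i \<in> holomorphic_functions A U"
    "\<And>q s. q \<in> U \<Longrightarrow> charpoly_at E s q = (\<Prod>i\<in>UNIV. s + u i q)" "det Q \<noteq> 0"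
    "\<And>x i. differential A (u i) p (Q *v x) = x $ i"
    "\<And>x s. Ddet (matrix (m p (E p)) + mat s) (matrix (m p (Q *v x)))
      = (\<Sum>i\<in>UNIV. x $ i * (\<Prod>j\<in>UNIV - {i}. s + u j p))"
  using assms unfolding euler_eigenvalues_def by blast+

lemma euler_eigenvalues_exist:
  assumes E: "euler_field_weight1 A m E" and p: "p \<in> carr A" and ss: "semisimple_algebra (m p)"
  shows "\<exists>U u Q. euler_eigenvalues E p U u Q"
proof -
  obtain U \<epsilon> where "idempotent_frame p U \<epsilon>" using idempotent_frame_exists[OF p ss] by blast
  note U = idempotent_frameD(1-3)[OF this] and \<epsilon> = idempotent_frameD(4)[OF this]
    and idem = idempotent_frameD(5)[OF this] and det = idempotent_frameD(6)[OF this]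
  define c where "c = chart_at A p"
  have c: "c \<in> A" "p \<in> fst c" unfolding c_def using chart_at_in[OF p] by auto
  have Uc: "U \<subseteq> fst c" using U(3) by (simp add: c_def)
  have Ucarr: "q \<in> carr A" if "q \<in> U" for q using openin_subset_carr[OF U(1)] that by blast
  have EU: "E \<in> vector_fields A U" by (rule euler_field_local[OF \<epsilon> idem E])
  define Qc where "Qc = (\<lambda>q. \<chi> r i. coords A c q (\<epsilon> i q) $ r)"
  have Qc: "det (Qc q) \<noteq> 0" if "q \<in> U" for q using det[OF that] by (simp add: Qc_def c_def)
  \<comment> \<open>The components of \<open>E\<close> in the idempotent frame, by Cramer's rule in
    a fixed chart; as quotients of determinants they are visibly holomorphic. They are also the
    eigenvalues of \<open>E \<circ>\<close>.\<close>
  define u where "u = (\<lambda>k q. det (\<chi> r i. if i = k then coords A c q (E q) $ r else Qc q $ r $ i) / det (Qc q))"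
  have Eq: "E q = (\<Sum>i\<in>UNIV. u i q *s \<epsilon> i q)" if q: "q \<in> U" for q
  proof -
    have qc: "q \<in> fst c" using q Uc by blast
    obtain y where y: "Qc q *v y = coords A c q (E q)" using det_nonzero_solve[OF Qc[OF q]] by blast
    have uy: "u k q = y $ k" for k
      unfolding u_def y[symmetric] cramer_lemma using Qc[OF q] by simp
    have "coords A c q (E q) = (\<Sum>i\<in>UNIV. y $ i *s coords A c q (\<epsilon> i q))"
      unfolding y[symmetric] matrix_mult_sum by (simp add: Qc_def column_def)
    then have "tangent c q (coords A c q (E q)) = (\<Sum>i\<in>UNIV. y $ i *s tangent c q (coords A c q (\<epsilon> i q)))"
      by (simp only: vlinear_sum[OF tangent_linear[OF c(1) qc] finite])
    then show ?thesis by (simp add: tangent_coords[OF c(1) qc] uy)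
  qed
  have u: "u k \<in> holomorphic_functions A U" for k
  proof (rule hol_functions_chartI[OF c(1) U(1) Uc])
    let ?S = "snd c ` U"
    have oS: "open ?S" using open_chart_image[OF U(1) c(1)] Uc by (simp add: Int_absorb2)
    have comp: "mholomorphic_on (\<lambda>z. coords A c (chart_inv c z) (X (chart_inv c z)) $ r) ?S"
      if "X \<in> vector_fields A U" for X r
      using vector_fields_chart[OF that c(1)] Uc by (simp add: field_in_chart_def Int_absorb2)
    have Qh: "mholomorphic_on (\<lambda>z. Qc (chart_inv c z) $ r $ i) ?S" for r i
      using comp[OF \<epsilon>] by (simp add: Qc_def)
    have "mholomorphic_on (\<lambda>z. (\<chi> r i. if i = k then coords A c (chart_inv c z) (E (chart_inv c z)) $ r
        else Qc (chart_inv c z) $ r $ i) $ r $ i) ?S" for r i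
      using comp[OF EU] Qh by (cases "i = k") simp_all
    then show "mholomorphic_on (\<lambda>z. u k (chart_inv c z)) ?S"
      unfolding u_def
      by (intro mholomorphic_divide mholomorphic_det oS Qh) (use Qc c Uc in auto)
  qed
  have Eu: "m q (E q) (\<epsilon> i q) = u i q *s \<epsilon> i q" if q: "q \<in> U" for q i
  proof -
    note alg = alg[OF Ucarr[OF q]]
    have "m q (E q) (\<epsilon> i q) = (\<Sum>k\<in>UNIV. u k q *s m q (\<epsilon> k q) (\<epsilon> i q))"
      by (subst Eq[OF q]) (simp add: alg_sum_left[OF alg] alg_smult_left[OF alg])
    also have "\<dots> = (\<Sum>k\<in>UNIV. if k = i then u i q *s \<epsilon> i q else 0)"
      by (rule sum.cong) (auto simp: idem[OF q])
    finally show ?thesis by simp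
  qed
  \<comment> \<open>Here the frame is expressed in the chart chosen at each \<open>q\<close>, as
    required for the eigenvectors of \<open>matrix (m q (E q))\<close>; \<open>Qc\<close> expresses
    it in the fixed chart, where it is holomorphic.\<close>
  define Q where "Q = (\<lambda>q. \<chi> r i. \<epsilon> i q $ r)"
  have colQ: "column i (Q q) = \<epsilon> i q" for i q by (simp add: Q_def column_def vec_eq_iff)
  have Q: "det (Q q) \<noteq> 0" if q: "q \<in> U" for q
  proof -
    have qc: "q \<in> fst c" using q Uc by blast
    have "matrix (coords A c q) ** Q q = Qc q"
    proof -
      have "(matrix (coords A c q) ** Q q) $ r $ i = (matrix (coords A c q) *v \<epsilon> i q) $ r" for r i
        by (simp add: matrix_matrix_mult_def matrix_vector_mult_def Q_def)
      then show ?thesis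
        using matrix_works[OF coords_linear[OF c(1) qc]] by (simp add: vec_eq_iff Qc_def)
    qed
    then have "det (matrix (coords A c q)) * det (Q q) \<noteq> 0" using Qc[OF q] by (simp add: det_mul[symmetric])
    then show ?thesis by simp
  qed
  have eig: "matrix (m q (E q)) *v column i (Q q) = u i q *s column i (Q q)" if "q \<in> U" for q i
    by (simp add: colQ alg_matrix[OF alg[OF Ucarr[OF that]]] Eu[OF that])
  note alg = alg[OF p]
  have Qx: "Q p *v x = (\<Sum>k\<in>UNIV. x $ k *s \<epsilon> k p)" for x
    unfolding matrix_mult_sum colQ ..
  have nz: "\<epsilon> i p \<noteq> 0" for i
  proof
    assume "\<epsilon> i p = 0"
    then have "Q p *v axis i 1 = 0" by (simp add: matrix_mult_axis colQ)
    moreover have "invertible (Q p)" using Q[OF U(2)] by (simp add: invertible_det_nz)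
    ultimately have "axis i (1::complex) = 0"
      unfolding invertible_def using matrix_left_invertible_ker[of "Q p"] by blast
    then show False by (simp add: axis_def vec_eq_iff) (metis zero_neq_one)
  qed
  have "euler_eigenvalues E p U u (Q p)"
    unfolding euler_eigenvalues_def
  proof (intro conjI allI ballI U(1,2) u)
    show "charpoly_at E s q = (\<Prod>i\<in>UNIV. s + u i q)" if "q \<in> U" for q s
      unfolding charpoly_at_def by (rule eigenbasis_det(1)[OF Q[OF that] eig[OF that]])
    show "det (Q p) \<noteq> 0" by (rule Q[OF U(2)])
    show "differential A (u i) p (Q p *v x) = x $ i" for x i
    proof -
      have lin: "Vector_Spaces.linear (*s) (*) (differential A (u i) p)"
        by (rule differential_linear[OF u U(2)])
      have sum: "differential A (u i) p (\<Sum>k\<in>I. x $ k *s \<epsilon> k p) = (\<Sum>k\<in>I. x $ k * differential A (u i) p (\<epsilon> k p))"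
        if "finite I" for I
        using that
      proof induction
        case empty
        have "differential A (u i) p (0 *s 0) = 0 * differential A (u i) p 0"
          using lin unfolding linear_form_iff by blast
        then show ?case by simp
      qed (use lin in \<open>simp add: linear_form_iff\<close>)
      have "differential A (u i) p (\<epsilon> k p) = (if k = i then 1 else 0)" for k
        by (rule eigenvalue_derivative[OF \<epsilon> idem E U(2) u Eu nz])
      then have "differential A (u i) p (Q p *v x) = (\<Sum>k\<in>UNIV. if k = i then x $ k else 0)"
        unfolding Qx sum[OF finite] by (intro sum.cong) auto
      then show ?thesis by simp
    qed
    show "Ddet (matrix (m p (E p)) + mat s) (matrix (m p (Q p *v x)))
      = (\<Sum>i\<in>UNIV. x $ i * (\<Prod>j\<in>UNIV - {i}. s + u j p))" for x s
    proof (rule eigenbasis_det(2)[OF Q[OF U(2)] eig[OF U(2)]])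
      fix i
      have "m p (Q p *v x) (\<epsilon> i p) = (\<Sum>k\<in>UNIV. x $ k *s m p (\<epsilon> k p) (\<epsilon> i p))"
        unfolding Qx by (simp add: alg_sum_left[OF alg] alg_smult_left[OF alg])
      also have "\<dots> = (\<Sum>k\<in>UNIV. if k = i then x $ i *s \<epsilon> i p else 0)"
        by (rule sum.cong) (auto simp: idem[OF U(2)])
      finally show "matrix (m p (Q p *v x)) *v column i (Q p) = x $ i *s column i (Q p)"
        by (simp add: colQ alg_matrix[OF alg])
    qed
  qed
  then show ?thesis by blast
qed

text \<open>Writing \<open>v = Q x\<close>, the product rule for \<open>\<Prod>i. s + u i\<close>
  and the simultaneous diagonalisation of \<open>E \<circ>\<close> and \<open>v \<circ>\<close> give
  the same sum, because the derivative of \<open>u i\<close> along \<open>v\<close> is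
  \<open>x $ i\<close>, the eigenvalue of \<open>v \<circ>\<close> on the idempotent
  \<open>i\<close>.\<close>

lemma charpoly_differential_semisimple:
  assumes E: "euler_field_weight1 A m E" and p: "p \<in> carr A" and ss: "semisimple_algebra (m p)"
  shows "differential A (charpoly_at E s) p v = Ddet (matrix (m p (E p)) + mat s) (matrix (m p v))"
proof -
  obtain U u Q where "euler_eigenvalues E p U u Q" using euler_eigenvalues_exist[OF E p ss] by blast
  note U = euler_eigenvaluesD(1,2)[OF this] and u = euler_eigenvaluesD(3)[OF this]
    and cp = euler_eigenvaluesD(4)[OF this] and Q = euler_eigenvaluesD(5)[OF this]
    and du = euler_eigenvaluesD(6)[OF this] and D = euler_eigenvaluesD(7)[OF this]
  obtain x where x: "Q *v x = v" using det_nonzero_solve[OF Q] by blast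
  let ?c = "chart_at A p" and ?z = "snd (chart_at A p) p"
  have c: "?c \<in> A" "p \<in> fst ?c" using chart_at_in[OF p] by auto
  let ?S = "snd ?c ` (U \<inter> fst ?c)"
  have oS: "open ?S" by (rule open_chart_image[OF U(1) c(1)])
  have zS: "?z \<in> ?S" using U c by blast
  let ?D = "\<lambda>v. \<Sum>i\<in>UNIV. (0 + frechet_derivative (\<lambda>z. u i (chart_inv ?c z)) (at ?z) v) *
      (\<Prod>j\<in>UNIV - {i}. s + u j (chart_inv ?c ?z))"
  have "((\<lambda>z. \<Prod>i\<in>UNIV. s + u i (chart_inv ?c z)) has_derivative ?D) (at ?z)"
    by (intro has_derivative_prod has_derivative_add has_derivative_const
        mholomorphic_has_derivative[OF hol_functions_chart[OF u c(1)] zS])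
  then have "((\<lambda>z. charpoly_at E s (chart_inv ?c z)) has_derivative ?D) (at ?z)"
    by (rule has_derivative_transform_within_open[OF _ oS zS]) (use c in \<open>auto simp: cp\<close>)
  then have "differential A (charpoly_at E s) p v = ?D v"
    unfolding differential_def by (rule fun_cong[OF frechet_derivative_at[symmetric]])
  also have "\<dots> = (\<Sum>i\<in>UNIV. differential A (u i) p v * (\<Prod>j\<in>UNIV - {i}. s + u j p))"
    using c by (simp add: differential_def)
  also have "\<dots> = (\<Sum>i\<in>UNIV. x $ i * (\<Prod>j\<in>UNIV - {i}. s + u j p))"
    unfolding x[symmetric] du ..
  finally show ?thesis unfolding D[symmetric] x .
qed

text \<open>Eigenvalues of \<open>E \<circ>\<close> may coincide even at a semisimple point. Being
  local coordinates, they can be given pairwise distinct derivatives \<open>x i\<close> in a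
  suitable direction \<open>w\<close>, so their differences are nonzero for small
  \<open>t \<noteq> 0\<close>.\<close>

lemma simple_spectrum_near_semisimple:
  assumes E: "euler_field_weight1 A m E" and ss: "semisimple_algebra (m p)"
    and W: "openin mtop W" "p \<in> W"
  shows "\<exists>q\<in>W. simple_spectrum (matrix (m q (E q)))"
proof -
  have p: "p \<in> carr A" using W openin_subset_carr by blast
  obtain U u Q where "euler_eigenvalues E p U u Q" using euler_eigenvalues_exist[OF E p ss] by blast
  note U = euler_eigenvaluesD(1,2)[OF this] and u = euler_eigenvaluesD(3)[OF this]
    and cp = euler_eigenvaluesD(4)[OF this] and du = euler_eigenvaluesD(6)[OF this]
  obtain x :: "'n \<Rightarrow> complex" where x: "inj x" using inj_complex_finite by blast
  define w where "w = Q *v (\<chi> i. x i)"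
  let ?c = "chart_at A p" and ?z = "snd (chart_at A p) p"
  have c: "?c \<in> A" "p \<in> fst ?c" using chart_at_in[OF p] by auto
  let ?S = "snd ?c ` (U \<inter> fst ?c)"
  have zS: "?z + 0 *s w \<in> ?S" using U c by auto
  define g where "g = (\<lambda>i t. u i (chart_inv ?c (?z + t *s w)))"
  have g: "(g i has_field_derivative x i) (at 0)" for i
  proof -
    have "(g i has_field_derivative frechet_derivative (\<lambda>z. u i (chart_inv ?c z)) (at (?z + 0 *s w)) w) (at 0)"
      unfolding g_def by (rule has_field_derivative_line[OF hol_functions_chart[OF u c(1)] zS])
    moreover have "frechet_derivative (\<lambda>z. u i (chart_inv ?c z)) (at (?z + 0 *s w)) w = x i"
      using du[of i "\<chi> i. x i"] by (simp add: differential_def w_def)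
    ultimately show ?thesis by simp
  qed
  have "eventually (\<lambda>t. g i t - g j t \<noteq> 0) (at 0)" if "i \<noteq> j" for i j
    by (rule eventually_nonzero_of_derivative[OF DERIV_diff[OF g g]]) (use x that in \<open>auto simp: inj_def\<close>)
  then have "eventually (\<lambda>t. i \<noteq> j \<longrightarrow> g i t - g j t \<noteq> 0) (at 0)" for i j
    by (cases "i = j") auto
  then have ev1: "eventually (\<lambda>t. \<forall>i j. i \<noteq> j \<longrightarrow> g i t - g j t \<noteq> 0) (at 0)"
    by (simp add: eventually_all_finite)
  let ?T = "snd ?c ` (W \<inter> U \<inter> fst ?c)"
  have oT: "open ?T" by (rule open_chart_image[OF openin_Int[OF W(1) U(1)] c(1)])
  have "continuous_on UNIV (\<lambda>t. ?z + t *s w)" by (intro continuous_intros continuous_on_vector_smult)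
  then have "open ((\<lambda>t. ?z + t *s w) -` ?T)" using oT open_vimage by blast
  moreover have "0 \<in> (\<lambda>t. ?z + t *s w) -` ?T" using W U c by auto
  ultimately have "eventually (\<lambda>t. t \<in> (\<lambda>t. ?z + t *s w) -` ?T) (at 0)" by (rule eventually_at_in_open')
  then have "eventually (\<lambda>t. (\<forall>i j. i \<noteq> j \<longrightarrow> g i t - g j t \<noteq> 0) \<and> ?z + t *s w \<in> ?T) (at 0)"
    using ev1 by eventually_elim simp
  from eventually_happens'[OF at_neq_bot this]
  obtain t where t: "(\<forall>i j. i \<noteq> j \<longrightarrow> g i t - g j t \<noteq> 0) \<and> ?z + t *s w \<in> ?T" by (rule exE)
  from t[THEN conjunct2] obtain q where q0: "?z + t *s w = snd ?c q" "q \<in> W \<inter> U \<inter> fst ?c" by (rule imageE)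
  then have q: "q \<in> W" "q \<in> U" "q \<in> fst ?c" by blast+
  have "inj (\<lambda>i. u i q)"
  proof (rule injI, rule ccontr)
    fix i j assume "u i q = u j q" "i \<noteq> j"
    then show False using t[THEN conjunct1, rule_format, of i j] c q by (simp add: g_def q0(1))
  qed
  then have "simple_spectrum (matrix (m q (E q)))"
    unfolding simple_spectrum_def using cp[OF q(2)] unfolding charpoly_at_def
    by (intro exI[of _ "\<lambda>i. u i q"]) simp
  then show ?thesis using q(1) by blast
qed

section \<open>Passage from the dense set of semisimple points to the whole manifold\<close>

context
  fixes E assumes massive: "massive A m" and E: "euler_field_weight1 A m E"
begin

lemma semisimple_dense:
  assumes "openin mtop W" "W \<noteq> {}"
  shows "\<exists>p\<in>W. semisimple_algebra (m p)"
proof -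
  obtain K where K: "nowhere_dense_in mtop K" "\<And>p. p \<in> carr A - K \<Longrightarrow> semisimple_algebra (m p)"
    "K \<subseteq> carr A"
    using massive unfolding massive_def analytic_subset_def by blast
  have "\<not> W \<subseteq> K"
  proof
    assume "W \<subseteq> K"
    then have "W \<subseteq> mtop closure_of K"
      using closure_of_subset[of K mtop] K(3) topspace_carr by simp
    then have "W \<subseteq> mtop interior_of (mtop closure_of K)" using assms(1) by (rule interior_of_maximal)
    then show False using K(1) assms(2) unfolding nowhere_dense_in_def by simp
  qed
  then show ?thesis using K(2) openin_subset_carr[OF assms(1)] by blast
qed

lemma simple_dense:
  assumes "openin mtop W" "W \<noteq> {}"
  shows "\<exists>q\<in>W. simple_spectrum (matrix (m q (E q)))"
  using semisimple_dense[OF assms] simple_spectrum_near_semisimple[OF E _ assms(1)] by blast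

lemma euler_vector_field: "E \<in> vector_fields A (carr A)"
  using E unfolding euler_field_weight1_def by (rule conjunct1)

lemma charpoly_hol: "charpoly_at E s \<in> holomorphic_functions A (carr A)"
  by (rule charpoly_at_hol[OF euler_vector_field])

lemma euler_matrix_hol:
  assumes c: "c \<in> A"
  shows "mholomorphic_on (\<lambda>z. mult_matrix c (chart_inv c z) (E (chart_inv c z)) $ i $ j) (snd c ` fst c)"
proof -
  have "fst c \<subseteq> carr A" using c by (auto simp: carr_def)
  then show ?thesis using mult_matrix_field_hol[OF c euler_vector_field] by (simp add: Int_absorb1)
qed

text \<open>Both sides are continuous, so the formula extends from the semisimple points.\<close>

lemma charpoly_differential:
  assumes p: "p \<in> carr A"
  shows "differential A (charpoly_at E s) p v = Ddet (matrix (m p (E p)) + mat s) (matrix (m p v))"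
proof -
  let ?c = "chart_at A p"
  have c: "?c \<in> A" "p \<in> fst ?c" using chart_at_in[OF p] by auto
  let ?S = "snd ?c ` fst ?c"
  have oS: "open ?S" by (rule open_chart_range[OF c(1)])
  have sub: "fst ?c \<subseteq> carr A" using c by (auto simp: carr_def)
  let ?M = "\<lambda>z. mult_matrix ?c (chart_inv ?c z) (E (chart_inv ?c z))"
  define N where "N = (\<lambda>z. \<chi> i j. \<Sum>k\<in>UNIV. v $ k *
      mult_matrix ?c (chart_inv ?c z) (coord_vector A ?c k (chart_inv ?c z)) $ i $ j)"
  \<comment> \<open>The vector \<open>v\<close>, given at \<open>p\<close> only, is extended with
    constant coordinates in the chart. The difference of the two sides becomes a continuous
    function, and it vanishes at the semisimple points.\<close>
  define f where "f = (\<lambda>z. frechet_derivative (\<lambda>z. charpoly_at E s (chart_inv ?c z)) (at z) v - Ddet (?M z + mat s) (N z))"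
  have diff: "f (snd ?c q) = differential A (charpoly_at E s) q (tangent ?c q v)
      - Ddet (matrix (m q (E q)) + mat s) (matrix (m q (tangent ?c q v)))" if q: "q \<in> fst ?c" for q
  proof -
    have "N (snd ?c q) = mult_matrix ?c q (tangent ?c q v)"
      using q c by (simp add: N_def vec_eq_iff mult_matrix_linear[OF c(1) q, of "tangent ?c q v"] coords_tangent[OF c(1) q])
    then have "Ddet (?M (snd ?c q) + mat s) (N (snd ?c q)) = Ddet (matrix (m q (E q)) + mat s) (matrix (m q (tangent ?c q v)))"
      using Ddet_mult_matrix[OF c(1) q] c q by simp
    moreover have "differential A (charpoly_at E s) q (tangent ?c q v)
        = frechet_derivative (\<lambda>z. charpoly_at E s (chart_inv ?c z)) (at (snd ?c q)) v"
      using differential_chart[OF charpoly_hol _ c(1) q] sub q coords_tangent[OF c(1) q] by auto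
    ultimately show ?thesis by (simp add: f_def)
  qed
  have cont1: "continuous_on ?S (\<lambda>z. frechet_derivative (\<lambda>z. charpoly_at E s (chart_inv ?c z)) (at z) v)"
    using mholomorphic_continuous_on[OF mholomorphic_frechet_derivative[OF hol_functions_chart[OF charpoly_hol c(1)]]]
      sub by (simp add: Int_absorb1)
  have "mholomorphic_on (\<lambda>z. Ddet (?M z + mat s) (N z)) ?S"
  proof -
    have "mholomorphic_on (\<lambda>z. (?M z + mat s) $ i $ j) ?S" for i j
      using mholomorphic_add[OF euler_matrix_hol[OF c(1)] mholomorphic_const[OF oS]] by simp
    moreover have "mholomorphic_on (\<lambda>z. N z $ i $ j) ?S" for i j
      unfolding N_def vec_lambda_beta
      using mult_matrix_field_hol[OF c(1) coord_vector_in_vector_fields[OF c(1)]]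
      by (intro mholomorphic_sum oS mholomorphic_cmult) simp
    ultimately show ?thesis
      unfolding Ddet_expand
      by (intro mholomorphic_sum oS mholomorphic_cmult mholomorphic_mult mholomorphic_prod)
  qed
  then have cont: "continuous_on ?S f"
    unfolding f_def by (intro continuous_on_diff cont1 mholomorphic_continuous_on)
  have "f (snd ?c p) = 0"
  proof (rule ccontr)
    assume "f (snd ?c p) \<noteq> 0"
    let ?V = "?S \<inter> f -` (- {0})"
    have V: "open ?V" by (rule continuous_open_preimage[OF cont oS]) (simp add: open_Compl)
    have "snd ?c p \<in> ?V" using c \<open>f (snd ?c p) \<noteq> 0\<close> by simp
    then have "chart_inv ?c ` ?V \<noteq> {}" by blast
    moreover have "openin mtop (chart_inv ?c ` ?V)" by (rule openin_chart_preimage(1)[OF c(1) V]) blast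
    ultimately obtain q where q: "q \<in> chart_inv ?c ` ?V" "semisimple_algebra (m q)"
      using semisimple_dense by blast
    obtain z where z: "z \<in> ?S" "f z \<noteq> 0" "q = chart_inv ?c z" using q(1) by blast
    have qc: "q \<in> fst ?c" "snd ?c q = z" using chart_chart_inv[OF z(1)] z(3) by auto
    have "q \<in> carr A" using qc(1) sub by blast
    then have "f (snd ?c q) = 0"
      unfolding diff[OF qc(1)] by (simp add: charpoly_differential_semisimple[OF E _ q(2)])
    then show False using z(2) qc(2) by simp
  qed
  then show ?thesis
    using diff[OF c(2)] tangent_coords[OF c, of v] coords_chart_at[OF p, of v] by simp
qed

text \<open>The condition \<open>translation\<close> is \<open>charpoly_differential\<close> in the
  direction \<open>e\<close>, where \<open>e \<circ>\<close> is the identity; density of simple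
  spectra comes from \<open>simple_dense\<close>.\<close>

lemma euler_matrix_chart:
  assumes c: "c \<in> A"
  shows "euler_matrix (snd c ` fst c) (\<lambda>z. mult_matrix c (chart_inv c z) (E (chart_inv c z))) (field_in_chart A c e)"
proof
  let ?S = "snd c ` fst c" and ?M = "\<lambda>z. mult_matrix c (chart_inv c z) (E (chart_inv c z))"
  have sub: "fst c \<subseteq> carr A" using c by (auto simp: carr_def)
  have oS: "open ?S" by (rule open_chart_range[OF c])
  show M: "mholomorphic_on (\<lambda>z. ?M z $ i $ j) ?S" for i j by (rule euler_matrix_hol[OF c])
  show "\<forall>i. mholomorphic_on (\<lambda>z. field_in_chart A c e z $ i) ?S"
    using vector_fields_chart[OF unit_field c] sub by (simp add: Int_absorb1)
  show "Ddet (?M z + mat s) (\<chi> i j. frechet_derivative (\<lambda>z. ?M z $ i $ j) (at z) (field_in_chart A c e z))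
      = Ddet (?M z + mat s) (mat 1)" if z: "z \<in> ?S" for z s
  proof -
    define q where "q = chart_inv c z"
    have q: "q \<in> fst c" "snd c q = z" unfolding q_def using chart_chart_inv[OF z] by auto
    have qc: "q \<in> carr A" using q sub by blast
    have "((\<lambda>z. det (?M z + mat s)) has_derivative
        (\<lambda>v. Ddet (?M z + mat s) (\<chi> i j. frechet_derivative (\<lambda>z. ?M z $ i $ j) (at z) v))) (at z)"
    proof (rule has_derivative_det)
      show "((\<lambda>z. (?M z + mat s) $ i $ j) has_derivative
          (\<lambda>v. (\<chi> i j. frechet_derivative (\<lambda>z. ?M z $ i $ j) (at z) v) $ i $ j)) (at z)" for i j
        using has_derivative_add[OF mholomorphic_has_derivative[OF M z] has_derivative_const] by simp
    qed
    moreover have "det (?M z + mat s) = charpoly_at E s (chart_inv c z)" if "z \<in> ?S" for z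
      using chart_chart_inv[OF that] c by (simp add: det_mult_matrix charpoly_at_def)
    ultimately have "((\<lambda>z. charpoly_at E s (chart_inv c z)) has_derivative
        (\<lambda>v. Ddet (?M z + mat s) (\<chi> i j. frechet_derivative (\<lambda>z. ?M z $ i $ j) (at z) v))) (at z)"
      by (rule has_derivative_transform_within_open[OF _ oS z])
    then have "Ddet (?M z + mat s) (\<chi> i j. frechet_derivative (\<lambda>z. ?M z $ i $ j) (at z) v)
        = frechet_derivative (\<lambda>z. charpoly_at E s (chart_inv c z)) (at z) v" for v
      by (rule fun_cong[OF frechet_derivative_at])
    then have "Ddet (?M z + mat s) (\<chi> i j. frechet_derivative (\<lambda>z. ?M z $ i $ j) (at z) (field_in_chart A c e z))
        = differential A (charpoly_at E s) q (e q)"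
      using differential_chart[OF charpoly_hol qc c q(1)] field_in_chart_point[OF c q(1), of e] q(2) by simp
    also have "\<dots> = Ddet (mult_matrix c q (E q) + mat s) (mult_matrix c q (e q))"
      unfolding charpoly_differential[OF qc] Ddet_mult_matrix[OF c q(1)] ..
    finally show ?thesis unfolding mult_matrix_unit[OF c q(1)] by (simp only: q_def)
  qed
  show "\<exists>z\<in>V. simple_spectrum (?M z)" if V: "open V" "V \<subseteq> ?S" "V \<noteq> {}" for V
  proof -
    have "chart_inv c ` V \<noteq> {}" using V(3) by simp
    then obtain q where q: "q \<in> chart_inv c ` V" "simple_spectrum (matrix (m q (E q)))"
      using simple_dense[OF openin_chart_preimage(1)[OF c V(1,2)]] by blast
    then obtain z where z: "z \<in> V" "q = chart_inv c z" by blast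
    have "q \<in> fst c" using chart_chart_inv(2)[OF subsetD[OF V(2) z(1)]] z(2) by simp
    then have "simple_spectrum (mult_matrix c q (E q))"
      using q(2) unfolding simple_spectrum_def by (simp add: det_mult_matrix[OF c])
    then show ?thesis using z by blast
  qed
qed

end

end

section \<open>Logarithmic vector fields of the discriminant\<close>

context atlas
begin

lemma openin_nonzero:
  assumes f: "f \<in> holomorphic_functions A U"
  shows "openin mtop {q \<in> U. f q \<noteq> 0}"
proof -
  have "open (snd c ` ({q \<in> U. f q \<noteq> 0} \<inter> fst c))" if c: "c \<in> A" for c
  proof -
    let ?S = "snd c ` (U \<inter> fst c)"
    have "snd c ` ({q \<in> U. f q \<noteq> 0} \<inter> fst c) = ?S \<inter> (\<lambda>z. f (chart_inv c z)) -` (- {0})"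
      using c by auto
    moreover have "open (?S \<inter> (\<lambda>z. f (chart_inv c z)) -` (- {0}))"
      by (rule continuous_open_preimage[OF mholomorphic_continuous_on[OF hol_functions_chart[OF f c]]
            open_chart_image[OF hol_functions_openin[OF f] c]]) (simp add: open_Compl)
    ultimately show ?thesis by simp
  qed
  moreover have "U \<subseteq> carr A" by (rule openin_subset_carr[OF hol_functions_openin[OF f]])
  ultimately show ?thesis unfolding openin_iff by blast
qed

lemma component_hol:
  assumes X: "X \<in> vector_fields A U" and c: "c \<in> A" and U: "U \<subseteq> fst c"
  shows "(\<lambda>q. coords A c q (X q) $ i) \<in> holomorphic_functions A U"
proof (rule hol_functions_chartI[OF c vector_fields_openin[OF X] U])
  show "mholomorphic_on (\<lambda>z. coords A c (chart_inv c z) (X (chart_inv c z)) $ i) (snd c ` U)"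
    using vector_fields_chart[OF X c] U by (simp add: field_in_chart_def Int_absorb2)
qed

lemma vector_eq_coord_sum:
  assumes "c \<in> A" "q \<in> fst c"
  shows "v = (\<Sum>i\<in>UNIV. coords A c q v $ i *s coord_vector A c i q)"
proof -
  have "tangent c q (\<Sum>i\<in>UNIV. coords A c q v $ i *s axis i 1)
      = (\<Sum>i\<in>UNIV. coords A c q v $ i *s tangent c q (axis i 1))"
    by (rule vlinear_sum[OF tangent_linear[OF assms] finite])
  then show ?thesis
    by (simp only: vector_eq_sum_axis[symmetric] tangent_coords[OF assms] coord_vector_eq)
qed

lemma differential_mult:
  assumes a: "a \<in> holomorphic_functions A W" and b: "b \<in> holomorphic_functions A W"
    and p: "p \<in> W" and g: "\<And>q. q \<in> W \<Longrightarrow> g q = a q * b q"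
  shows "differential A g p v = a p * differential A b p v + differential A a p v * b p"
proof -
  let ?c = "chart_at A p" and ?z = "snd (chart_at A p) p"
  have W: "openin mtop W" by (rule hol_functions_openin[OF a])
  have c: "?c \<in> A" "p \<in> fst ?c" using chart_at_in openin_subset_carr[OF W] p by blast+
  let ?S = "snd ?c ` (W \<inter> fst ?c)"
  have zS: "?z \<in> ?S" using p c by blast
  let ?D = "\<lambda>f. frechet_derivative (\<lambda>z. f (chart_inv ?c z)) (at ?z)"
  have "((\<lambda>z. a (chart_inv ?c z) * b (chart_inv ?c z)) has_derivative
      (\<lambda>v. a (chart_inv ?c ?z) * ?D b v + ?D a v * b (chart_inv ?c ?z))) (at ?z)"
    by (intro has_derivative_mult mholomorphic_has_derivative[OF hol_functions_chart[OF a c(1)] zS]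
        mholomorphic_has_derivative[OF hol_functions_chart[OF b c(1)] zS])
  then have "((\<lambda>z. g (chart_inv ?c z)) has_derivative
      (\<lambda>v. a (chart_inv ?c ?z) * ?D b v + ?D a v * b (chart_inv ?c ?z))) (at ?z)"
    by (rule has_derivative_transform_within_open[OF _ open_chart_image[OF W c(1)] zS]) (use c g in auto)
  then have "?D g v = a (chart_inv ?c ?z) * ?D b v + ?D a v * b (chart_inv ?c ?z)"
    by (rule fun_cong[OF frechet_derivative_at[symmetric]])
  then show ?thesis using c by (simp add: differential_def)
qed

end

context F_mfd
begin

context
  fixes E assumes massive: "massive A m" and E: "euler_field_weight1 A m E"
begin

abbreviation hE :: "'a \<Rightarrow> complex" where "hE \<equiv> charpoly_at E 0"
abbreviation DE :: "'a set" where "DE \<equiv> discriminant A m E"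

lemma hE_eq: "hE p = det (matrix (m p (E p)))"
proof -
  have "mat 0 = (0 :: complex^'n^'n)" by (simp add: vec_eq_iff mat_component)
  then show ?thesis by (simp add: charpoly_at_def)
qed

lemma det_mult_matrix_hE: "c \<in> A \<Longrightarrow> p \<in> fst c \<Longrightarrow> det (mult_matrix c p (E p)) = hE p"
proof -
  assume c: "c \<in> A" "p \<in> fst c"
  have "mat 0 = (0 :: complex^'n^'n)" by (simp add: vec_eq_iff mat_component)
  then show ?thesis using det_mult_matrix[OF c, of "E p" 0] by (simp add: charpoly_at_def)
qed

lemma discriminant_iff: "p \<in> DE \<longleftrightarrow> p \<in> carr A \<and> hE p = 0"
  by (simp add: discriminant_def hE_eq)

lemma hE_hol: "hE \<in> holomorphic_functions A (carr A)"
  by (rule charpoly_hol[OF massive E])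

lemma E_field: "E \<in> vector_fields A (carr A)"
  by (rule euler_vector_field[OF massive E])

lemma hE_differential:
  assumes p: "p \<in> carr A"
  shows "differential A hE p v = Ddet (matrix (m p (E p))) (matrix (m p v))"
proof -
  have "mat 0 = (0 :: complex^'n^'n)" by (simp add: vec_eq_iff mat_component)
  then show ?thesis using charpoly_differential[OF massive E p, of 0 v] by simp
qed

text \<open>The counterpart of \<open>euler_matrix.good\<close> on the manifold: \<open>0\<close> is
  an algebraically simple eigenvalue. In particular \<open>hE\<close> has nonzero differential
  there.\<close>

definition good_point :: "'a \<Rightarrow> bool" where
  "good_point q \<longleftrightarrow> q \<in> DE \<and> differential A hE q (e q) \<noteq> 0"

lemma good_point_chart:
  assumes c: "c \<in> A" and q: "q \<in> fst c"
    and g: "euler_matrix.good (snd c ` fst c) (\<lambda>z. mult_matrix c (chart_inv c z) (E (chart_inv c z)))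
      (field_in_chart A c e) (snd c q)"
  shows "good_point q"
proof -
  interpret EM: euler_matrix "snd c ` fst c" "\<lambda>z. mult_matrix c (chart_inv c z) (E (chart_inv c z))" "field_in_chart A c e"
    by (rule euler_matrix_chart[OF massive E c])
  have qA: "q \<in> carr A" using c q by (auto simp: carr_def)
  have zS: "snd c q \<in> snd c ` fst c" using q by blast
  have eq: "det (mult_matrix c (chart_inv c z) (E (chart_inv c z))) = hE (chart_inv c z)" if "z \<in> snd c ` fst c" for z
    using det_mult_matrix_hE[OF c chart_chart_inv(2)[OF that]] .
  have "h0 = 0" if "h0 = EM.h (snd c q)" for h0 using g that unfolding EM.good_def by simp
  then have "hE q = 0" using eq[OF zS] c q by simp
  moreover have "((\<lambda>z. hE (chart_inv c z)) has_derivative frechet_derivative EM.h (at (snd c q))) (at (snd c q))"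
    by (rule has_derivative_transform_within_open[OF mholomorphic_has_derivative[OF EM.h_hol zS] EM.open_domain zS])
      (rule eq)
  then have "frechet_derivative EM.h (at (snd c q)) = frechet_derivative (\<lambda>z. hE (chart_inv c z)) (at (snd c q))"
    by (rule frechet_derivative_at)
  then have "frechet_derivative EM.h (at (snd c q)) (field_in_chart A c e (snd c q)) = differential A hE q (e q)"
    using differential_chart[OF hE_hol qA c q] field_in_chart_point[OF c q] by simp
  moreover have "frechet_derivative EM.h (at (snd c q)) (field_in_chart A c e (snd c q)) \<noteq> 0"
    using g unfolding EM.good_def by blast
  ultimately show ?thesis using qA by (simp add: good_point_def discriminant_iff)
qed

lemma hE_dense_nonzero:
  assumes W: "openin mtop W" "W \<noteq> {}"
  shows "\<exists>q\<in>W. hE q \<noteq> 0"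
proof -
  obtain p where p: "p \<in> W" using W(2) by blast
  have c: "chart_at A p \<in> A" "p \<in> fst (chart_at A p)" using chart_at_in openin_subset_carr[OF W(1)] p by blast+
  define c where "c = chart_at A p"
  note c = c[folded c_def]
  interpret EM: euler_matrix "snd c ` fst c" "\<lambda>z. mult_matrix c (chart_inv c z) (E (chart_inv c z))" "field_in_chart A c e"
    by (rule euler_matrix_chart[OF massive E c(1)])
  have "snd c ` (W \<inter> fst c) \<noteq> {}" using p c by blast
  then obtain z where z: "z \<in> snd c ` (W \<inter> fst c)" "EM.h z \<noteq> 0"
    using EM.dense_nonzero[OF open_chart_image[OF W(1) c(1)]] by blast
  then obtain q where q: "q \<in> W" "q \<in> fst c" "z = snd c q" by blast
  then have "hE q \<noteq> 0" using z(2) det_mult_matrix_hE[OF c(1) q(2)] c(1) by simp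
  then show ?thesis using q(1) by blast
qed

text \<open>Good points lie on the discriminant, so \<open>g\<close> vanishes at them and can be
  divided. This is the sense in which \<open>hE\<close> generates the functions vanishing on the
  discriminant.\<close>

lemma hE_generates:
  assumes g: "g \<in> holomorphic_functions A V" and p: "p \<in> V" and g0: "\<And>q. q \<in> V \<Longrightarrow> q \<in> DE \<Longrightarrow> g q = 0"
  obtains U k where "p \<in> U" "U \<subseteq> V" "k \<in> holomorphic_functions A U" "\<And>q. q \<in> U \<Longrightarrow> g q = hE q * k q"
proof -
  have V: "openin mtop V" by (rule hol_functions_openin[OF g])
  define c where "c = chart_at A p"
  have c: "c \<in> A" "p \<in> fst c" unfolding c_def using chart_at_in openin_subset_carr[OF V] p by blast+
  interpret EM: euler_matrix "snd c ` fst c" "\<lambda>z. mult_matrix c (chart_inv c z) (E (chart_inv c z))" "field_in_chart A c e"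
    by (rule euler_matrix_chart[OF massive E c(1)])
  let ?N = "snd c ` (V \<inter> fst c)"
  have N: "?N \<subseteq> snd c ` fst c" "snd c p \<in> ?N" using p c by auto
  have "g (chart_inv c z) = 0" if z: "z \<in> ?N" "EM.good z" for z
  proof -
    obtain q where q: "q \<in> V" "q \<in> fst c" "z = snd c q" using z(1) by blast
    have "good_point q" by (rule good_point_chart[OF c(1) q(2)]) (use z(2) q(3) in simp)
    then show ?thesis using g0[OF q(1)] q c(1) by (simp add: good_point_def)
  qed
  then obtain d k where d: "d > 0" "ball (snd c p) d \<subseteq> ?N" "mholomorphic_on k (ball (snd c p) d)"
    and gk: "\<And>z. z \<in> ball (snd c p) d \<Longrightarrow> g (chart_inv c z) = EM.h z * k z"
    using EM.division[OF hol_functions_chart[OF g c(1)] N] by blast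
  let ?B = "ball (snd c p) d"
  have BS: "?B \<subseteq> snd c ` fst c" using d(2) N(1) by (rule subset_trans)
  note U = openin_chart_preimage[OF c(1) open_ball BS]
  show ?thesis
  proof
    have "snd c p \<in> ?B" using d(1) by simp
    then show "p \<in> chart_inv c ` ?B" using c by (metis chart_inv_chart imageI)
    show "chart_inv c ` ?B \<subseteq> V"
    proof
      fix q assume "q \<in> chart_inv c ` ?B"
      then obtain z where z: "z \<in> ?B" "q = chart_inv c z" by blast
      then obtain q' where "q' \<in> V" "q' \<in> fst c" "z = snd c q'" using d(2) by blast
      then show "q \<in> V" using z c(1) by simp
    qed
    show "(\<lambda>q. k (snd c q)) \<in> holomorphic_functions A (chart_inv c ` ?B)"
    proof (rule hol_functions_chartI[OF c(1) U(1,2)])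
      show "mholomorphic_on (\<lambda>z. k (snd c (chart_inv c z))) (snd c ` chart_inv c ` ?B)"
        unfolding U(3)
        by (rule mholomorphic_on_cong[OF d(3)]) (use chart_chart_inv(1)[OF subsetD[OF BS]] in simp)
    qed
    show "g q = hE q * k (snd c q)" if qB: "q \<in> chart_inv c ` ?B" for q
    proof -
      obtain z where z: "z \<in> ?B" "q = chart_inv c z" using qB by blast
      note zi = chart_chart_inv[OF subsetD[OF BS z(1)]]
      show ?thesis using gk[OF z(1)] det_mult_matrix_hE[OF c(1) zi(2)] zi(1) z(2) by simp
    qed
  qed
qed

text \<open>A pointwise condition at good points is upgraded to local divisibility by
  \<open>vector_division\<close>. Both the logarithmic fields and the kernel are brought into the
  multiples of \<open>E\<close> by this criterion.\<close>

lemma E_times_fieldsI: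
  assumes X: "X \<in> vector_fields A U"
    and good: "\<And>q. q \<in> U \<Longrightarrow> good_point q \<Longrightarrow> \<exists>y. X q = m q (E q) y"
  shows "X \<in> E_times_fields A m E U"
proof -
  have "\<exists>V\<subseteq>U. p \<in> V \<and> (\<exists>Y\<in>vector_fields A V. \<forall>q\<in>V. X q = field_mult m E Y q)" if p: "p \<in> U" for p
  proof -
    have U: "openin mtop U" by (rule vector_fields_openin[OF X])
    define c where "c = chart_at A p"
    have c: "c \<in> A" "p \<in> fst c" unfolding c_def using chart_at_in openin_subset_carr[OF U] p by blast+
    let ?M = "\<lambda>z. mult_matrix c (chart_inv c z) (E (chart_inv c z))"
    interpret EM: euler_matrix "snd c ` fst c" ?M "field_in_chart A c e"
      by (rule euler_matrix_chart[OF massive E c(1)])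
    let ?N = "snd c ` (U \<inter> fst c)"
    have N: "?N \<subseteq> snd c ` fst c" "snd c p \<in> ?N" using p c by auto
    have gd: "\<exists>y. field_in_chart A c X z = ?M z *v y" if z: "z \<in> ?N" "EM.good z" for z
    proof -
      obtain q where q: "q \<in> U" "q \<in> fst c" "z = snd c q" using z(1) by blast
      have "good_point q" by (rule good_point_chart[OF c(1) q(2)]) (use z(2) q(3) in simp)
      then obtain y where "X q = m q (E q) y" using good[OF q(1)] by blast
      then have "field_in_chart A c X z = ?M z *v coords A c q y"
        using c(1) q by (simp add: field_in_chart_point mult_matrix_vec tangent_coords)
      then show ?thesis by blast
    qed
    obtain d Y where d: "d > 0" "ball (snd c p) d \<subseteq> ?N" and Y: "vholomorphic_on Y (ball (snd c p) d)"
      and XY: "\<And>z. z \<in> ball (snd c p) d \<Longrightarrow> field_in_chart A c X z = ?M z *v Y z"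
      using EM.vector_division[OF vector_fields_chart[OF X c(1)] N gd] by blast
    let ?B = "ball (snd c p) d"
    have BS: "?B \<subseteq> snd c ` fst c" using d(2) N(1) by (rule subset_trans)
    note V = openin_chart_preimage[OF c(1) open_ball BS]
    have "snd c p \<in> ?B" using d(1) by simp
    then have pV: "p \<in> chart_inv c ` ?B" using c by (metis chart_inv_chart imageI)
    have VU: "chart_inv c ` ?B \<subseteq> U"
    proof
      fix q assume "q \<in> chart_inv c ` ?B"
      then obtain z where z: "z \<in> ?B" "q = chart_inv c z" by blast
      then obtain q' where "q' \<in> U" "q' \<in> fst c" "z = snd c q'" using d(2) by blast
      then show "q \<in> U" using z c(1) by simp
    qed
    have "chart_field c Y \<in> vector_fields A (chart_inv c ` ?B)"
      by (rule chart_field_in_vector_fields[OF c(1) V(1,2)]) (use Y V(3) in simp)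
    moreover have "X q = field_mult m E (chart_field c Y) q" if qB: "q \<in> chart_inv c ` ?B" for q
    proof -
      obtain z where z: "z \<in> ?B" "q = chart_inv c z" using qB by blast
      note zi = chart_chart_inv[OF subsetD[OF BS z(1)], folded z(2)]
      have "coords A c q (X q) = mult_matrix c q (E q) *v Y z"
        using XY[OF z(1)] field_in_chart_point[OF c(1) zi(2), of X] zi(1) z(2) by simp
      then have "coords A c q (X q) = coords A c q (m q (E q) (tangent c q (Y z)))"
        using mult_matrix_vec[OF c(1) zi(2)] by simp
      then show ?thesis using coords_inj[OF c(1) zi(2)] zi(1) by (simp add: field_mult_def chart_field_def)
    qed
    ultimately show ?thesis using pV VU by blast
  qed
  then show ?thesis using X by (simp add: E_times_fields_def)
qed

section \<open>Comparison of logarithmic fields, kernel and multiples of \<open>E\<close>\<close>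

lemma E_times_pointwise:
  assumes "X \<in> E_times_fields A m E U" "p \<in> U"
  shows "\<exists>YV. snd YV \<subseteq> U \<and> p \<in> snd YV \<and> fst YV \<in> vector_fields A (snd YV) \<and>
    (\<forall>q\<in>snd YV. X q = m q (E q) (fst YV q))"
proof -
  have "\<exists>V\<subseteq>U. p \<in> V \<and> (\<exists>Y\<in>vector_fields A V. \<forall>q\<in>V. X q = m q (E q) (Y q))"
    using assms unfolding E_times_fields_def field_mult_def by blast
  then obtain V Y where "V \<subseteq> U" "p \<in> V" "Y \<in> vector_fields A V" "\<forall>q\<in>V. X q = m q (E q) (Y q)" by blast
  then show ?thesis by (intro exI[of _ "(Y, V)"]) simp
qed

text \<open>Multiplication by \<open>E \<circ> y\<close> factors through \<open>E \<circ>\<close>,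
  which is singular on the discriminant; hence \<open>Ddet_mult_right\<close>.\<close>

lemma hE_differential_range:
  assumes p: "p \<in> DE"
  shows "differential A hE p (m p (E p) y) = 0"
proof -
  have pA: "p \<in> carr A" and h0: "det (matrix (m p (E p))) = 0" using p by (auto simp: discriminant_def)
  note alg = alg[OF pA]
  have "m p (m p (E p) y) = m p (E p) \<circ> m p y" using alg_assoc[OF alg] by auto
  then have "matrix (m p (m p (E p) y)) = matrix (m p (E p)) ** matrix (m p y)"
    by (simp only: matrix_compose_gen[OF alg_linear[OF alg] alg_linear[OF alg]])
  then show ?thesis by (simp add: hE_differential[OF pA] Ddet_mult_right[OF h0])
qed

text \<open>Any regular local equation is \<open>g = hE * k\<close>. At a point of the discriminant
  the product rule leaves \<open>k\<close> times the differential of \<open>hE\<close>, which kills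
  multiples of \<open>E\<close>.\<close>

lemma E_times_subset_log: "E_times_fields A m E U \<subseteq> log_vector_fields A DE U"
proof
  fix X assume X: "X \<in> E_times_fields A m E U"
  have XU: "X \<in> vector_fields A U" using X by (simp add: E_times_fields_def)
  have "differential A g p (X p) = 0" if p: "p \<in> U" and reg: "regular_equation A DE p V g" for p V g
  proof -
    have V: "p \<in> V" "p \<in> DE" "g \<in> holomorphic_functions A V" "DE \<inter> V = {q \<in> V. g q = 0}"
      using reg unfolding regular_equation_def by auto
    have "g q = 0" if "q \<in> V" "q \<in> DE" for q using V(4) that by blast
    then obtain W k where W: "p \<in> W" "W \<subseteq> V" "k \<in> holomorphic_functions A W"
      "\<And>q. q \<in> W \<Longrightarrow> g q = hE q * k q"
      using hE_generates[OF V(3,1)] by blast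
    have "hE \<in> holomorphic_functions A W"
      by (rule hol_functions_subset[OF hE_hol hol_functions_openin[OF W(3)]
            openin_subset_carr[OF hol_functions_openin[OF W(3)]]])
    then have "differential A g p (X p) = hE p * differential A k p (X p) + differential A hE p (X p) * k p"
      using differential_mult[OF _ W(3) W(1,4)] by blast
    moreover have "hE p = 0" using V(2) by (simp add: discriminant_iff)
    moreover obtain YV where "p \<in> snd YV" "\<forall>q\<in>snd YV. X q = m q (E q) (fst YV q)"
      using E_times_pointwise[OF X p] by blast
    then have "differential A hE p (X p) = 0" using hE_differential_range[OF V(2)] by simp
    ultimately show ?thesis by simp
  qed
  then show "X \<in> log_vector_fields A DE U"
    using XU by (simp add: log_vector_fields_def tangent_space_at_def)
qed

text \<open>At a good point \<open>Ddet\<close> at \<open>E \<circ>\<close> in the direction of the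
  identity is nonzero, so any form that kills the image of \<open>E \<circ>\<close> but not
  \<open>e\<close> has that image as its kernel. It is applied with the differential of
  \<open>hE\<close> and with a character.\<close>

lemma good_point_range:
  assumes q: "good_point q" and lin: "Vector_Spaces.linear (*s) (*) \<phi>"
    and \<phi>: "\<And>u. \<phi> (m q (E q) u) = 0" "\<phi> (e q) \<noteq> 0" "\<phi> x = 0"
  shows "\<exists>y. x = m q (E q) y"
proof -
  have qA: "q \<in> carr A" using q by (simp add: good_point_def discriminant_def)
  note alg = alg[OF qA]
  have "Ddet (matrix (m q (E q))) (matrix (m q (e q))) \<noteq> 0"
    using q hE_differential[OF qA, of "e q"] by (simp add: good_point_def)
  then have "\<exists>u. x = matrix (m q (E q)) *v u"
    by (rule Ddet_nonzero_range[OF _ lin _ \<phi>(2,3)]) (simp add: alg_matrix[OF alg] \<phi>(1))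
  then show ?thesis by (simp add: alg_matrix[OF alg])
qed

text \<open>At a good point \<open>hE\<close> is itself a regular equation, so tangency of
  \<open>X\<close> means that its differential kills \<open>X\<close>.\<close>

lemma log_subset_E_times: "log_vector_fields A DE U \<subseteq> E_times_fields A m E U"
proof
  fix X assume X: "X \<in> log_vector_fields A DE U"
  show "X \<in> E_times_fields A m E U"
  proof (rule E_times_fieldsI)
    show "X \<in> vector_fields A U" using X by (simp add: log_vector_fields_def)
    fix q assume q: "q \<in> U" "good_point q"
    have qD: "q \<in> DE" "q \<in> carr A" using q(2) by (auto simp: good_point_def discriminant_def)
    have "DE \<inter> carr A = {q \<in> carr A. hE q = 0}" by (auto simp: discriminant_iff)
    then have reg: "regular_equation A DE q (carr A) hE"
      using qD hE_hol q(2) unfolding regular_equation_def good_point_def by blast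
    then have "q \<in> regular_part A DE" unfolding regular_part_def by blast
    then have "X q \<in> tangent_space_at A DE q" using X q(1) unfolding log_vector_fields_def by blast
    then have "differential A hE q (X q) = 0" using reg unfolding tangent_space_at_def by blast
    then show "\<exists>y. X q = m q (E q) y"
      using good_point_range[OF q(2) differential_linear[OF hE_hol qD(2)] hE_differential_range[OF qD(1)]] q(2)
      unfolding good_point_def by blast
  qed
qed

text \<open>If \<open>E \<circ>\<close> is singular, \<open>E\<close> lies in a proper ideal and
  hence in the kernel of a character; conversely a character killing \<open>E\<close> prevents
  \<open>E \<circ>\<close> from reaching the unit.\<close>

lemma discriminant_zero_fibre: "DE = fst ` zero_fibre A m e E"
proof (intro equalityI subsetI)
  fix p assume "p \<in> DE"
  then have p: "p \<in> carr A" "det (matrix (m p (E p))) = 0" by (auto simp: discriminant_def)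
  obtain \<xi> where "character (m p) (e p) \<xi>" "\<xi> (E p) = 0" using exists_character[OF alg[OF p(1)] p(2)] by blast
  then have "(p, \<xi>) \<in> zero_fibre A m e E"
    using p(1) by (simp add: zero_fibre_def analytic_spectrum_def fibre_linear_def character_def)
  then show "p \<in> fst ` zero_fibre A m e E" by force
next
  fix p assume "p \<in> fst ` zero_fibre A m e E"
  then obtain \<xi> where "p \<in> carr A" "character (m p) (e p) \<xi>" "\<xi> (E p) = 0"
    by (auto simp: zero_fibre_def analytic_spectrum_def fibre_linear_def character_def)
  then show "p \<in> DE" using character_singular[OF alg] by (auto simp: discriminant_def)
qed

lemma spectrum_ideal_zero:
  assumes h: "h \<in> spectrum_ideal A m e (p, \<xi>)" and \<xi>: "(p, \<xi>) \<in> analytic_spectrum A m e"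
  shows "h (p, \<xi>) = 0"
proof -
  obtain U \<delta> i0 W h0 k where \<delta>: "\<delta> i0 = e" and W: "(p, \<xi>) \<in> W"
    and eq: "\<forall>w\<in>W. h w = h0 w * (fibre_linear (\<delta> i0) w - 1) +
        (\<Sum>i\<in>(UNIV::'n set). \<Sum>j\<in>UNIV. k i j w * (fibre_linear (\<delta> i) w * fibre_linear (\<delta> j) w
           - fibre_linear (field_mult m (\<delta> i) (\<delta> j)) w))"
    using h unfolding spectrum_ideal_def by blast
  have "\<xi> (e p) = 1" "\<And>u v. \<xi> (m p u v) = \<xi> u * \<xi> v" using \<xi> by (auto simp: analytic_spectrum_def)
  then show ?thesis using bspec[OF eq W] by (simp add: fibre_linear_def field_mult_def \<delta>)
qed

text \<open>Over a good point lies a character \<open>\<xi>\<close> with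
  \<open>\<xi> (E q) = 0\<close>. Evaluating the ideal membership there gives
  \<open>\<xi> (X q) = 0\<close>; since \<open>\<xi>\<close> kills the image of
  \<open>E \<circ>\<close> and is 1 on the unit, \<open>good_point_range\<close> applies.\<close>

lemma kernel_subset_E_times: "kernel_aD A m e E U \<subseteq> E_times_fields A m E U"
proof
  fix X assume X: "X \<in> kernel_aD A m e E U"
  show "X \<in> E_times_fields A m E U"
  proof (rule E_times_fieldsI)
    show "X \<in> vector_fields A U" using X by (simp add: kernel_aD_def)
    fix q assume q: "q \<in> U" "good_point q"
    have "q \<in> fst ` zero_fibre A m e E" using q(2) discriminant_zero_fibre by (simp add: good_point_def)
    then obtain \<xi> where \<xi>: "(q, \<xi>) \<in> zero_fibre A m e E" by force
    then have sp: "(q, \<xi>) \<in> analytic_spectrum A m e" and \<xi>E: "\<xi> (E q) = 0"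
      by (auto simp: zero_fibre_def fibre_linear_def)
    have lin: "Vector_Spaces.linear (*s) (*) \<xi>" "\<xi> (e q) = 1" "\<And>u v. \<xi> (m q u v) = \<xi> u * \<xi> v"
      using sp by (auto simp: analytic_spectrum_def)
    have "fibre_linear X \<in> zero_fibre_ideal A m e E (q, \<xi>)"
      using X \<xi> q(1) unfolding kernel_aD_def by auto
    then obtain W g h where "(q, \<xi>) \<in> W" "h \<in> spectrum_ideal A m e (q, \<xi>)"
      "\<forall>w\<in>W. fibre_linear X w = g w * fibre_linear E w + h w"
      unfolding zero_fibre_ideal_def by blast
    then have "\<xi> (X q) = 0"
      using spectrum_ideal_zero[OF _ sp, of h] \<xi>E by (auto simp: fibre_linear_def)
    then show "\<exists>y. X q = m q (E q) y"
      by (intro good_point_range[OF q(2) lin(1)]) (simp_all add: lin \<xi>E)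
  qed
qed

section \<open>Freeness of the discriminant\<close>

lemma E_mult_unique:
  assumes Y: "Y \<in> vector_fields A W" "Y' \<in> vector_fields A W"
    and eq: "\<And>q. q \<in> W \<Longrightarrow> m q (E q) (Y q) = m q (E q) (Y' q)" and p: "p \<in> W"
  shows "Y p = Y' p"
proof (rule ccontr)
  assume ne: "Y p \<noteq> Y' p"
  have W: "openin mtop W" by (rule vector_fields_openin[OF Y(1)])
  define c where "c = chart_at A p"
  have c: "c \<in> A" "p \<in> fst c" unfolding c_def using chart_at_in openin_subset_carr[OF W] p by blast+
  let ?W = "W \<inter> fst c"
  have oW: "openin mtop ?W" by (rule openin_Int[OF W openin_chart[OF c(1)]])
  have "coords A c p (Y p) \<noteq> coords A c p (Y' p)" using ne coords_inj[OF c] by blast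
  then obtain i where i: "coords A c p (Y p) $ i \<noteq> coords A c p (Y' p) $ i" by (auto simp: vec_eq_iff)
  let ?f = "\<lambda>q. coords A c q (Y q) $ i - coords A c q (Y' q) $ i"
  have f1: "(\<lambda>q. coords A c q (Y q) $ i) \<in> holomorphic_functions A ?W"
    by (rule component_hol[OF vector_fields_subset[OF Y(1) oW] c(1)]) auto
  have f2: "(\<lambda>q. coords A c q (Y' q) $ i) \<in> holomorphic_functions A ?W"
    by (rule component_hol[OF vector_fields_subset[OF Y(2) oW] c(1)]) auto
  have "?f \<in> holomorphic_functions A ?W"
    using f1 f2 mholomorphic_diff unfolding holomorphic_functions_def by blast
  then have "openin mtop {q \<in> ?W. ?f q \<noteq> 0}" by (rule openin_nonzero)
  moreover have "p \<in> {q \<in> ?W. ?f q \<noteq> 0}" using p c i by simp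
  \<comment> \<open>The set where the \<open>i\<close>-th components differ is open and nonempty, so
    it contains a point at which \<open>E \<circ>\<close> is invertible.\<close>
  ultimately obtain q where q: "q \<in> W" "q \<in> fst c" "?f q \<noteq> 0" "hE q \<noteq> 0"
    using hE_dense_nonzero[of "{q \<in> ?W. ?f q \<noteq> 0}"] by blast
  have qA: "q \<in> carr A" using q(1) openin_subset_carr[OF W] by blast
  note alg = alg[OF qA]
  have "matrix (m q (E q)) *v (Y q - Y' q) = 0"
    by (simp add: alg_matrix[OF alg] alg_diff_right[OF alg] eq[OF q(1)])
  moreover have "invertible (matrix (m q (E q)))" using q(4) by (simp add: hE_eq invertible_det_nz)
  ultimately have "Y q - Y' q = 0"
    unfolding invertible_def using matrix_left_invertible_ker[of "matrix (m q (E q))"] by blast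
  then show False using q(3) by simp
qed

lemma discriminant_hypersurface: "hypersurface A DE"
  unfolding hypersurface_def
proof (intro conjI ballI)
  show "DE \<subseteq> carr A" by (auto simp: discriminant_def)
  show "nowhere_dense_in mtop DE"
    unfolding nowhere_dense_in_def
  proof (rule ccontr)
    let ?W = "mtop interior_of (mtop closure_of DE)"
    assume "?W \<noteq> {}"
    then obtain q where q: "q \<in> ?W" "hE q \<noteq> 0" using hE_dense_nonzero[OF openin_interior_of] by blast
    have "q \<in> mtop closure_of DE" using q(1) interior_of_subset by fast
    then have cl: "\<forall>T. q \<in> T \<and> openin mtop T \<longrightarrow> (\<exists>y. y \<in> DE \<and> y \<in> T)"
      unfolding in_closure_of by (rule conjunct2)
    have op: "openin mtop {q \<in> carr A. hE q \<noteq> 0}" by (rule openin_nonzero[OF hE_hol])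
    have "q \<in> {q \<in> carr A. hE q \<noteq> 0}"
      using q(2) subsetD[OF openin_subset_carr[OF openin_interior_of] q(1)] by simp
    with cl[rule_format, OF conjI[OF _ op]] obtain y where "y \<in> DE" "y \<in> {q \<in> carr A. hE q \<noteq> 0}"
      by blast
    then show False by (simp add: discriminant_iff)
  qed
  fix p assume p: "p \<in> carr A"
  have "DE \<inter> carr A = {q \<in> carr A. hE q = 0}" by (auto simp: discriminant_iff)
  then show "\<exists>U. p \<in> U \<and> (\<exists>g\<in>holomorphic_functions A U. DE \<inter> U = {q \<in> U. g q = 0})"
    using p hE_hol by blast
qed

text \<open>Multiplication by \<open>E\<close> carries the coordinate fields to a basis: it is onto
  the logarithmic fields by \<open>log_subset_E_times\<close> and injective on fields by
  \<open>E_mult_unique\<close>.\<close>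

lemma log_fields_basis:
  assumes c: "c \<in> A"
  shows "sheaf_basis A (log_vector_fields A DE) (fst c) (\<lambda>i. field_mult m E (coord_vector A c i))"
  unfolding sheaf_basis_def
proof (intro conjI allI impI ballI)
  have sub: "fst c \<subseteq> carr A" using c by (auto simp: carr_def)
  show U: "openin mtop (fst c)" by (rule openin_chart[OF c])
  have cv: "coord_vector A c i \<in> vector_fields A (fst c)" for i by (rule coord_vector_in_vector_fields[OF c])
  show "field_mult m E (coord_vector A c i) \<in> log_vector_fields A DE (fst c)" for i
  proof -
    have "field_mult m E (coord_vector A c i) \<in> vector_fields A (fst c)"
      by (intro field_mult_closed cv vector_fields_subset[OF E_field U sub])
    then have "field_mult m E (coord_vector A c i) \<in> E_times_fields A m E (fst c)"
      unfolding E_times_fields_def using cv by blast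
    then show ?thesis using E_times_subset_log by blast
  qed
  have combine: "m q (E q) (\<Sum>i\<in>UNIV. x i *s coord_vector A c i q)
      = (\<Sum>i\<in>UNIV. x i *s field_mult m E (coord_vector A c i) q)" if "q \<in> fst c" for q x
    using alg[of q] sub that by (simp add: alg_sum_right alg_smult_right field_mult_def subset_iff)
  fix V assume "openin mtop V \<and> V \<subseteq> fst c"
  then have V: "openin mtop V" "V \<subseteq> fst c" by auto
  {
    fix X assume "X \<in> log_vector_fields A DE V"
    then have X: "X \<in> E_times_fields A m E V" using log_subset_E_times by blast
    from bchoice[OF ballI[OF E_times_pointwise[OF X]]]
    obtain YV where "\<forall>p\<in>V. snd (YV p) \<subseteq> V \<and> p \<in> snd (YV p) \<and>
        fst (YV p) \<in> vector_fields A (snd (YV p)) \<and> (\<forall>q\<in>snd (YV p). X q = m q (E q) (fst (YV p) q))"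
      by (rule exE)
    note YV = bspec[OF this]
    \<comment> \<open>The coefficient at \<open>p\<close> is read from the local quotient chosen at
      \<open>p\<close> itself. That the choices at neighbouring points agree, and hence that
      \<open>f\<close> is holomorphic, is the uniqueness of the quotient.\<close>
    define f where "f = (\<lambda>i p. coords A c p (fst (YV p) p) $ i)"
    have agree: "fst (YV q) q = fst (YV p) q" if p: "p \<in> V" and q: "q \<in> snd (YV p)" for p q
    proof -
      have qV: "q \<in> V" using YV[OF p] q by blast
      let ?W = "snd (YV p) \<inter> snd (YV q)"
      have oW: "openin mtop ?W" using YV[OF p] YV[OF qV] vector_fields_openin by blast
      show ?thesis
      proof (rule E_mult_unique[of "fst (YV q)" ?W "fst (YV p)" q])
        show "fst (YV q) \<in> vector_fields A ?W" "fst (YV p) \<in> vector_fields A ?W"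
          using YV[OF p] YV[OF qV] vector_fields_subset[OF _ oW] by blast+
        show "q \<in> ?W" using q YV[OF qV] by blast
        show "m w (E w) (fst (YV q) w) = m w (E w) (fst (YV p) w)" if "w \<in> ?W" for w
          using YV[OF p] YV[OF qV] that by (metis IntE)
      qed
    qed
    have "f i \<in> holomorphic_functions A V" for i
    proof (rule hol_functions_local)
      fix p assume p: "p \<in> V"
      have "(\<lambda>q. coords A c q (fst (YV p) q) $ i) \<in> holomorphic_functions A (snd (YV p))"
        by (rule component_hol[OF _ c]) (use YV[OF p] V(2) in blast)+
      then have "f i \<in> holomorphic_functions A (snd (YV p))"
        by (rule hol_functions_cong) (simp add: f_def agree[OF p])
      then show "\<exists>V'. p \<in> V' \<and> V' \<subseteq> V \<and> f i \<in> holomorphic_functions A V'" using YV[OF p] by blast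
    qed
    moreover have "X p = (\<Sum>i\<in>UNIV. f i p *s field_mult m E (coord_vector A c i) p)" if p: "p \<in> V" for p
    proof -
      have pc: "p \<in> fst c" using p V(2) by blast
      have "X p = m p (E p) (fst (YV p) p)" using YV[OF p] by blast
      also have "\<dots> = m p (E p) (\<Sum>i\<in>UNIV. f i p *s coord_vector A c i p)"
        unfolding f_def vector_eq_coord_sum[OF c pc, symmetric] ..
      finally show ?thesis unfolding combine[OF pc] .
    qed
    ultimately show "\<exists>f. (\<forall>i. f i \<in> holomorphic_functions A V) \<and>
        (\<forall>p\<in>V. X p = (\<Sum>i\<in>UNIV. f i p *s field_mult m E (coord_vector A c i) p))" by blast
  }
  fix f :: "'n \<Rightarrow> 'a \<Rightarrow> complex" and i p
  assume f: "(\<forall>i. f i \<in> holomorphic_functions A V) \<and>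
      (\<forall>p\<in>V. (\<Sum>i\<in>UNIV. f i p *s field_mult m E (coord_vector A c i) p) = 0)" and p: "p \<in> V"
  have VS: "snd c ` (V \<inter> fst c) = snd c ` V" using V(2) by (simp add: Int_absorb2)
  \<comment> \<open>The coefficients are assembled into a field whose product with \<open>E\<close>
    is the given vanishing combination; comparison with the zero field gives their
    vanishing.\<close>
  let ?Y = "chart_field c (\<lambda>z. \<chi> i. f i (chart_inv c z))" and ?O = "chart_field c (\<lambda>z. 0)"
  have Y: "?Y \<in> vector_fields A V"
    using f hol_functions_chart[OF _ c, where U = V, unfolded VS]
    by (intro chart_field_in_vector_fields[OF c V]) simp
  have O: "?O \<in> vector_fields A V"
    using mholomorphic_const[OF open_chart_image[OF V(1) c, unfolded VS]]
    by (intro chart_field_in_vector_fields[OF c V]) simp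
  have Yq: "coords A c q (?Y q) = (\<chi> i. f i q)" "coords A c q (?O q) = 0" if "q \<in> V" for q
    using c V(2) that by (auto simp: chart_field_def coords_tangent subset_iff)
  have "?Y p = ?O p"
  proof (rule E_mult_unique[OF Y O _ p])
    fix q assume q: "q \<in> V"
    have qc: "q \<in> fst c" using q V(2) by blast
    have "m q (E q) (?Y q) = m q (E q) (\<Sum>i\<in>UNIV. f i q *s coord_vector A c i q)"
      by (subst vector_eq_coord_sum[OF c qc]) (simp add: Yq[OF q])
    also have "\<dots> = 0" unfolding combine[OF qc] using f q by blast
    finally have 1: "m q (E q) (?Y q) = 0" .
    have "?O q = (\<Sum>i\<in>UNIV. 0 *s coord_vector A c i q)"
      by (subst vector_eq_coord_sum[OF c qc]) (simp add: Yq[OF q])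
    then have "?O q = 0" by simp
    then show "m q (E q) (?Y q) = m q (E q) (?O q)"
      using 1 alg_zero(1)[OF alg] qc sub by (simp add: subset_iff)
  qed
  then have "(\<chi> i. f i p) = 0" using Yq[OF p] by metis
  then show "f i p = 0" by (simp add: vec_eq_iff)
qed

lemma discriminant_free_divisor: "free_divisor A DE"
  unfolding free_divisor_def locally_free_full_rank_def
  using discriminant_hypersurface log_fields_basis chart_at_in by blast

end

end

section \<open>Functions on the cotangent bundle\<close>

text \<open>Unlike \<open>openin_atlas_topology\<close>, this needs no compatibility of the charts.\<close>

lemma openin_atlas_topology_chart_inv:
  fixes B :: "('b, 'k::finite) chart set"
  shows "openin (atlas_topology B) W \<longleftrightarrow> W \<subseteq> carr B \<and>
    (\<forall>c\<in>B. open {z \<in> snd c ` fst c. chart_inv c z \<in> W})"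
proof -
  let ?P = "\<lambda>W. W \<subseteq> carr B \<and> (\<forall>c\<in>B. open {z \<in> snd c ` fst c. chart_inv c z \<in> W})"
  have "istopology ?P"
    unfolding istopology_def
  proof (intro conjI allI impI ballI)
    fix S T assume S: "?P S" and T: "?P T"
    show "S \<inter> T \<subseteq> carr B" using S by blast
    fix c assume "c \<in> B"
    then have "open ({z \<in> snd c ` fst c. chart_inv c z \<in> S} \<inter> {z \<in> snd c ` fst c. chart_inv c z \<in> T})"
      using S T by (intro open_Int) blast+
    moreover have "{z \<in> snd c ` fst c. chart_inv c z \<in> S \<inter> T}
        = {z \<in> snd c ` fst c. chart_inv c z \<in> S} \<inter> {z \<in> snd c ` fst c. chart_inv c z \<in> T}" by blast
    ultimately show "open {z \<in> snd c ` fst c. chart_inv c z \<in> S \<inter> T}" by simp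
  next
    fix K assume K: "\<forall>S\<in>K. ?P S"
    show "\<Union>K \<subseteq> carr B" using K by blast
    fix c assume "c \<in> B"
    then have "open (\<Union>S\<in>K. {z \<in> snd c ` fst c. chart_inv c z \<in> S})" using K by (intro open_UN) blast
    moreover have "{z \<in> snd c ` fst c. chart_inv c z \<in> \<Union>K} = (\<Union>S\<in>K. {z \<in> snd c ` fst c. chart_inv c z \<in> S})"
      by blast
    ultimately show "open {z \<in> snd c ` fst c. chart_inv c z \<in> \<Union>K}" by simp
  qed
  then show ?thesis unfolding atlas_topology_def by (simp add: topology_inverse')
qed

context atlas
begin

definition covectors :: "'a set \<Rightarrow> ('a, 'k) covector set" where
  "covectors U = {w. fst w \<in> U \<and> Vector_Spaces.linear (*s) (*) (snd w)}"

definition base_coords :: "complex^('k + 'k) \<Rightarrow> complex^'k" where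
  "base_coords \<zeta> = (\<chi> i. \<zeta> $ Inl i)"

text \<open>The inverse of \<open>cotangent_chart A c\<close> in explicit form: base point from the
  first half of the coordinates, and the form whose values on the coordinate fields are the second
  half.\<close>

definition covector_at :: "('a, 'k) chart \<Rightarrow> complex^('k + 'k) \<Rightarrow> ('a, 'k) covector" where
  "covector_at c \<zeta> = (chart_inv c (base_coords \<zeta>),
     \<lambda>v. \<Sum>i\<in>UNIV. coords A c (chart_inv c (base_coords \<zeta>)) v $ i * \<zeta> $ Inr i)"

lemma fst_cotangent_chart: "fst (cotangent_chart A c) = covectors (fst c)"
  by (auto simp: cotangent_chart_def covectors_def)

lemma snd_cotangent_chart:
  "snd (cotangent_chart A c) w $ Inl i = snd c (fst w) $ i"
  "snd (cotangent_chart A c) w $ Inr i = snd w (coord_vector A c i (fst w))"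
  by (auto simp: cotangent_chart_def split_beta)

lemma base_coords_chart: "base_coords (snd (cotangent_chart A c) w) = snd c (fst w)"
  by (simp add: base_coords_def vec_eq_iff snd_cotangent_chart)

lemma covector_at_in:
  assumes c: "c \<in> A" and \<zeta>: "base_coords \<zeta> \<in> snd c ` U" "U \<subseteq> fst c"
  shows "covector_at c \<zeta> \<in> covectors U"
    and "snd (cotangent_chart A c) (covector_at c \<zeta>) = \<zeta>"
proof -
  let ?q = "chart_inv c (base_coords \<zeta>)"
  obtain q where q: "q \<in> U" "base_coords \<zeta> = snd c q" using \<zeta>(1) by blast
  have qc: "q \<in> fst c" using q \<zeta>(2) by blast
  have q': "?q = q" using q(2) c qc by simp
  show "covector_at c \<zeta> \<in> covectors U"
    using q(1) coords_linear[OF c qc]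
    by (simp add: covectors_def covector_at_def q' linear_form_iff vlinear_iff sum.distrib
        distrib_right sum_distrib_left mult.assoc)
  have "snd (cotangent_chart A c) (covector_at c \<zeta>) $ k = \<zeta> $ k" for k
  proof (cases k)
    case (Inl i)
    have "snd c q $ i = base_coords \<zeta> $ i" using q(2) by simp
    then have "snd c q $ i = \<zeta> $ Inl i" by (simp add: base_coords_def)
    then show ?thesis by (simp add: Inl snd_cotangent_chart covector_at_def q')
  next
    case (Inr i)
    have "(\<Sum>j\<in>UNIV. coords A c q (coord_vector A c i q) $ j * \<zeta> $ Inr j)
        = (\<Sum>j\<in>UNIV. if j = i then \<zeta> $ Inr j else 0)"
      by (intro sum.cong) (auto simp: coord_vector_eq coords_tangent[OF c qc] axis_def)
    then show ?thesis by (simp add: Inr snd_cotangent_chart covector_at_def q')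
  qed
  then show "snd (cotangent_chart A c) (covector_at c \<zeta>) = \<zeta>" by (simp add: vec_eq_iff)
qed

lemma covector_at_chart:
  assumes c: "c \<in> A" and w: "w \<in> covectors (fst c)"
  shows "covector_at c (snd (cotangent_chart A c) w) = w"
proof -
  have q: "fst w \<in> fst c" and lin: "Vector_Spaces.linear (*s) (*) (snd w)"
    using w by (auto simp: covectors_def)
  have "(\<Sum>i\<in>UNIV. coords A c (fst w) v $ i * snd w (coord_vector A c i (fst w))) = snd w v" for v
  proof -
    have "snd w (tangent c (fst w) x) = (\<Sum>i\<in>UNIV. x $ i * snd w (tangent c (fst w) (axis i 1)))" for x
      by (rule linear_form_sum_axis[of "\<lambda>x. snd w (tangent c (fst w) x)"])
        (use lin tangent_linear[OF c q] in \<open>simp add: linear_form_iff vlinear_iff\<close>)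
    from this[of "coords A c (fst w) v"] show ?thesis
      by (simp add: coord_vector_eq tangent_coords[OF c q])
  qed
  then show ?thesis
    using c q by (simp add: covector_at_def base_coords_chart snd_cotangent_chart prod_eq_iff)
qed

lemma cotangent_chart_inv:
  assumes c: "c \<in> A" and \<zeta>: "base_coords \<zeta> \<in> snd c ` fst c"
  shows "chart_inv (cotangent_chart A c) \<zeta> = covector_at c \<zeta>"
proof -
  have "inj_on (snd (cotangent_chart A c)) (fst (cotangent_chart A c))"
    unfolding fst_cotangent_chart using covector_at_chart[OF c] by (rule inj_on_inverseI)
  then have "inv_into (fst (cotangent_chart A c)) (snd (cotangent_chart A c))
      (snd (cotangent_chart A c) (covector_at c \<zeta>)) = covector_at c \<zeta>"
    by (rule inv_into_f_f) (simp add: fst_cotangent_chart covector_at_in(1)[OF c \<zeta>])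
  then show ?thesis by (simp add: chart_inv_def covector_at_in(2)[OF c \<zeta>])
qed

lemma cotangent_chart_image:
  assumes c: "c \<in> A"
  shows "snd (cotangent_chart A c) ` (covectors U \<inter> fst (cotangent_chart A c))
    = base_coords -` (snd c ` (U \<inter> fst c))"
proof -
  have "covectors U \<inter> fst (cotangent_chart A c) = covectors (U \<inter> fst c)"
    unfolding fst_cotangent_chart by (auto simp: covectors_def)
  moreover have "snd (cotangent_chart A c) ` covectors (U \<inter> fst c) = base_coords -` (snd c ` (U \<inter> fst c))"
  proof (intro equalityI subsetI)
    fix \<zeta> assume "\<zeta> \<in> snd (cotangent_chart A c) ` covectors (U \<inter> fst c)"
    then show "\<zeta> \<in> base_coords -` (snd c ` (U \<inter> fst c))"
      by (auto simp: base_coords_chart covectors_def)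
  next
    fix \<zeta> assume "\<zeta> \<in> base_coords -` (snd c ` (U \<inter> fst c))"
    then have "base_coords \<zeta> \<in> snd c ` (U \<inter> fst c)" by simp
    from covector_at_in[OF c this] show "\<zeta> \<in> snd (cotangent_chart A c) ` covectors (U \<inter> fst c)"
      by (metis Int_lower2 imageI)
  qed
  ultimately show ?thesis by simp
qed

lemma base_coords_hol: "open S \<Longrightarrow> vholomorphic_on base_coords S"
  by (simp add: base_coords_def mholomorphic_component)

lemma open_base_coords:
  assumes "open S" shows "open (base_coords -` S)"
  using vholomorphic_continuous_on[OF base_coords_hol[OF open_UNIV]] assms by (rule open_vimage[rotated])

text \<open>In cotangent coordinates the bundle over \<open>U\<close> is the preimage of an open set
  under \<open>base_coords\<close>, and \<open>chart_inv\<close> is the explicit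
  \<open>covector_at\<close>. Both openness and holomorphy are thereby reduced to formulas.\<close>

lemma cotangent_holI:
  assumes U: "openin mtop U"
    and f: "\<And>c. c \<in> A \<Longrightarrow>
      mholomorphic_on (\<lambda>\<zeta>. f (covector_at c \<zeta>)) (base_coords -` (snd c ` (U \<inter> fst c)))"
  shows "f \<in> holomorphic_functions (cotangent_atlas A) (covectors U)"
proof -
  have "openin (atlas_topology (cotangent_atlas A)) (covectors U)"
    unfolding openin_atlas_topology_chart_inv
  proof (intro conjI ballI)
    show "covectors U \<subseteq> carr (cotangent_atlas A)"
    proof
      fix w assume w: "w \<in> covectors U"
      then obtain c where "c \<in> A" "fst w \<in> fst c"
        using openin_subset_carr[OF U] by (auto simp: covectors_def carr_def)
      then show "w \<in> carr (cotangent_atlas A)"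
        using w unfolding carr_def cotangent_atlas_def by (auto simp: fst_cotangent_chart covectors_def)
    qed
    fix c' assume "c' \<in> cotangent_atlas A"
    then obtain c where c: "c \<in> A" "c' = cotangent_chart A c" by (auto simp: cotangent_atlas_def)
    have "{\<zeta> \<in> snd c' ` fst c'. chart_inv c' \<zeta> \<in> covectors U} = snd c' ` (covectors U \<inter> fst c')"
    proof (intro equalityI subsetI)
      fix \<zeta> assume "\<zeta> \<in> {\<zeta> \<in> snd c' ` fst c'. chart_inv c' \<zeta> \<in> covectors U}"
      then show "\<zeta> \<in> snd c' ` (covectors U \<inter> fst c')"
        using f_inv_into_f[of \<zeta> "snd c'" "fst c'"] inv_into_into[of \<zeta> "snd c'" "fst c'"]
        unfolding chart_inv_def by (metis (no_types, lifting) IntI imageI mem_Collect_eq)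
    next
      fix \<zeta> assume "\<zeta> \<in> snd c' ` (covectors U \<inter> fst c')"
      then obtain w where w: "w \<in> covectors U" "w \<in> fst c'" "\<zeta> = snd c' w" by blast
      have "base_coords \<zeta> \<in> snd c ` fst c"
        using w(2,3) unfolding c(2) by (auto simp: base_coords_chart fst_cotangent_chart covectors_def)
      then have "chart_inv c' \<zeta> = w"
        using cotangent_chart_inv[OF c(1)] covector_at_chart[OF c(1)] w(2,3) unfolding c(2)
        by (simp add: fst_cotangent_chart)
      then show "\<zeta> \<in> {\<zeta> \<in> snd c' ` fst c'. chart_inv c' \<zeta> \<in> covectors U}" using w by blast
    qed
    then show "open {\<zeta> \<in> snd c' ` fst c'. chart_inv c' \<zeta> \<in> covectors U}"
      using open_base_coords[OF open_chart_image[OF U c(1)]] cotangent_chart_image[OF c(1)] c(2) by simp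
  qed
  moreover have "mholomorphic_on (\<lambda>\<zeta>. f (chart_inv c' \<zeta>)) (snd c' ` (covectors U \<inter> fst c'))"
    if c': "c' \<in> cotangent_atlas A" for c'
  proof -
    obtain c where c: "c \<in> A" "c' = cotangent_chart A c" using c' by (auto simp: cotangent_atlas_def)
    have "covector_at c \<zeta> = chart_inv c' \<zeta>" if "\<zeta> \<in> base_coords -` (snd c ` (U \<inter> fst c))" for \<zeta>
    proof -
      have "base_coords \<zeta> \<in> snd c ` fst c" using that by blast
      then show ?thesis unfolding c(2) using cotangent_chart_inv[OF c(1)] by simp
    qed
    then show ?thesis
      unfolding c(2) cotangent_chart_image[OF c(1)] using c(2)
      by (intro mholomorphic_on_cong[OF f[OF c(1)]]) simp
  qed
  ultimately show ?thesis unfolding holomorphic_functions_def by blast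
qed

lemma cotangent_hol_base:
  assumes f: "f \<in> holomorphic_functions A U"
  shows "(\<lambda>w. f (fst w)) \<in> holomorphic_functions (cotangent_atlas A) (covectors U)"
proof (rule cotangent_holI[OF hol_functions_openin[OF f]])
  fix c assume c: "c \<in> A"
  have oS: "open (snd c ` (U \<inter> fst c))" by (rule open_chart_image[OF hol_functions_openin[OF f] c])
  show "mholomorphic_on (\<lambda>\<zeta>. f (fst (covector_at c \<zeta>))) (base_coords -` (snd c ` (U \<inter> fst c)))"
    unfolding covector_at_def fst_conv
    by (rule mholomorphic_compose[OF hol_functions_chart[OF f c] base_coords_hol[OF open_base_coords[OF oS]]]) blast
qed

lemma cotangent_hol_fibre:
  assumes X: "X \<in> vector_fields A U"
  shows "fibre_linear X \<in> holomorphic_functions (cotangent_atlas A) (covectors U)"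
proof (rule cotangent_holI[OF vector_fields_openin[OF X]])
  fix c assume c: "c \<in> A"
  have oS: "open (snd c ` (U \<inter> fst c))" by (rule open_chart_image[OF vector_fields_openin[OF X] c])
  let ?T = "base_coords -` (snd c ` (U \<inter> fst c))"
  have oT: "open ?T" by (rule open_base_coords[OF oS])
  have comp: "mholomorphic_on (\<lambda>\<zeta>. field_in_chart A c X (base_coords \<zeta>) $ i) ?T" for i
    by (rule mholomorphic_compose[OF _ base_coords_hol[OF oT], where T = "snd c ` (U \<inter> fst c)"])
      (use vector_fields_chart[OF X c] in blast)+
  have "mholomorphic_on (\<lambda>\<zeta>. \<Sum>i\<in>UNIV. field_in_chart A c X (base_coords \<zeta>) $ i * \<zeta> $ Inr i) ?T"
    by (intro mholomorphic_sum oT mholomorphic_mult comp mholomorphic_component)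
  then show "mholomorphic_on (\<lambda>\<zeta>. fibre_linear X (covector_at c \<zeta>)) ?T"
    by (simp add: fibre_linear_def covector_at_def field_in_chart_def)
qed

text \<open>The ideal of the spectrum is defined by frames that contain the unit field. Where the
  component \<open>i0\<close> of \<open>Z\<close> is nonzero, \<open>Z\<close> may replace the
  coordinate field \<open>i0\<close>; solving for coefficients then only divides by that
  component.\<close>

lemma frame_with_field:
  assumes Z: "Z \<in> vector_fields A V" and p: "p \<in> V" and Zp: "Z p \<noteq> 0"
  obtains U \<delta> i0 where "p \<in> U" "U \<subseteq> V" "sheaf_basis A (vector_fields A) U \<delta>" "\<delta> i0 = Z"
proof -
  have V: "openin mtop V" by (rule vector_fields_openin[OF Z])
  define c where "c = chart_at A p"
  have c: "c \<in> A" "p \<in> fst c" unfolding c_def using chart_at_in openin_subset_carr[OF V] p by blast+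
  let ?V = "V \<inter> fst c"
  have V': "openin mtop ?V" by (rule openin_Int[OF V openin_chart[OF c(1)]])
  define \<zeta> where "\<zeta> = (\<lambda>i q. coords A c q (Z q) $ i)"
  have c0: "coords A c q 0 = 0" if "q \<in> fst c" for q
    using vlinear_sum[OF coords_linear[OF c(1) that] finite.emptyI] by simp
  have "coords A c p (Z p) \<noteq> 0" using Zp coords_inj[OF c, of "Z p" 0] c0[OF c(2)] by simp
  then obtain i0 where i0: "\<zeta> i0 p \<noteq> 0" by (auto simp: vec_eq_iff \<zeta>_def)
  have \<zeta>: "\<zeta> i \<in> holomorphic_functions A ?V" for i
    unfolding \<zeta>_def by (rule component_hol[OF vector_fields_subset[OF Z V'] c(1)]) auto
  define U where "U = {q \<in> ?V. \<zeta> i0 q \<noteq> 0}"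
  have U: "openin mtop U" unfolding U_def by (rule openin_nonzero[OF \<zeta>])
  have Uc: "U \<subseteq> fst c" and UV: "U \<subseteq> V" by (auto simp: U_def)
  define \<delta> where "\<delta> = (\<lambda>i. if i = i0 then Z else coord_vector A c i)"
  have comb: "coords A c q (\<Sum>i\<in>UNIV. f i *s \<delta> i q) = (\<chi> j. if j = i0 then f i0 * \<zeta> i0 q else f i0 * \<zeta> j q + f j)"
    if q: "q \<in> fst c" for q f
  proof -
    have lin: "coords A c q (\<Sum>i\<in>UNIV. f i *s \<delta> i q) = (\<Sum>i\<in>UNIV. f i *s coords A c q (\<delta> i q))"
      by (rule vlinear_sum[OF coords_linear[OF c(1) q] finite])
    have "(\<Sum>i\<in>UNIV. f i *s coords A c q (\<delta> i q))
        = f i0 *s coords A c q (Z q) + (\<Sum>i\<in>UNIV - {i0}. f i *s axis i 1)"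
      by (subst sum.remove[of UNIV i0])
        (auto simp: \<delta>_def coord_vector_eq coords_tangent[OF c(1) q] intro!: sum.cong)
    moreover have "(\<Sum>i\<in>UNIV - {i0}. f i *s axis i 1) $ j = (if j = i0 then 0 else f j)" for j
    proof -
      have "(\<Sum>i\<in>UNIV - {i0}. f i *s axis i 1) $ j = (\<Sum>i\<in>UNIV - {i0}. if i = j then f i else 0)"
        unfolding sum_component by (intro sum.cong) (auto simp: axis_def)
      then show ?thesis by simp
    qed
    ultimately show ?thesis unfolding lin by (simp add: vec_eq_iff \<zeta>_def)
  qed
  have "sheaf_basis A (vector_fields A) U \<delta>"
    unfolding sheaf_basis_def
  proof (intro conjI allI impI ballI)
    show "openin mtop U" by (rule U)
    show "\<delta> i \<in> vector_fields A U" for i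
      unfolding \<delta>_def using vector_fields_subset[OF Z U UV]
        vector_fields_subset[OF coord_vector_in_vector_fields[OF c(1)] U Uc] by simp
    fix W assume "openin mtop W \<and> W \<subseteq> U"
    then have W: "openin mtop W" "W \<subseteq> U" by auto
    have Wc: "W \<subseteq> fst c" using W Uc by blast
    have W\<zeta>: "\<zeta> i0 q \<noteq> 0" if "q \<in> W" for q using W(2) that by (auto simp: U_def)
    have \<zeta>W: "\<zeta> i \<in> holomorphic_functions A W" for i
      by (rule hol_functions_subset[OF \<zeta> W(1)]) (use W(2) in \<open>auto simp: U_def\<close>)
    {
      fix X assume X: "X \<in> vector_fields A W"
      define x where "x = (\<lambda>i q. coords A c q (X q) $ i)"
      have x: "x i \<in> holomorphic_functions A W" for i
        unfolding x_def by (rule component_hol[OF X c(1) Wc])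
      define f where "f = (\<lambda>i q. if i = i0 then x i0 q / \<zeta> i0 q else x i q - x i0 q / \<zeta> i0 q * \<zeta> i q)"
      have f0: "(\<lambda>q. x i0 q / \<zeta> i0 q) \<in> holomorphic_functions A W"
      proof -
        have "mholomorphic_on (\<lambda>z. x i0 (chart_inv d z) / \<zeta> i0 (chart_inv d z)) (snd d ` (W \<inter> fst d))"
          if d: "d \<in> A" for d
          by (rule mholomorphic_divide[OF hol_functions_chart[OF x d] hol_functions_chart[OF \<zeta>W d]])
            (use W\<zeta> d in auto)
        then show ?thesis using W(1) by (simp add: holomorphic_functions_def)
      qed
      have "f i \<in> holomorphic_functions A W" for i
      proof (cases "i = i0")
        case True
        then show ?thesis using f0 by (simp add: f_def)
      next
        case False
        have "mholomorphic_on (\<lambda>z. x i (chart_inv d z) - x i0 (chart_inv d z) / \<zeta> i0 (chart_inv d z) * \<zeta> i (chart_inv d z))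
            (snd d ` (W \<inter> fst d))" if d: "d \<in> A" for d
          using hol_functions_chart[OF x d] hol_functions_chart[OF f0 d] hol_functions_chart[OF \<zeta>W d]
          by (intro mholomorphic_diff mholomorphic_mult) auto
        then show ?thesis using False W(1) by (simp add: f_def holomorphic_functions_def)
      qed
      moreover have "X q = (\<Sum>i\<in>UNIV. f i q *s \<delta> i q)" if q: "q \<in> W" for q
      proof -
        have qc: "q \<in> fst c" using q Wc by blast
        have "coords A c q (\<Sum>i\<in>UNIV. f i q *s \<delta> i q) = coords A c q (X q)"
          unfolding comb[OF qc] using W\<zeta>[OF q] by (simp add: f_def x_def vec_eq_iff)
        then show ?thesis using coords_inj[OF c(1) qc] by metis
      qed
      ultimately show "\<exists>f. (\<forall>i. f i \<in> holomorphic_functions A W) \<and>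
          (\<forall>p\<in>W. X p = (\<Sum>i\<in>UNIV. f i p *s \<delta> i p))" by blast
    }
    fix f :: "'k \<Rightarrow> 'a \<Rightarrow> complex" and i q
    assume f: "(\<forall>i. f i \<in> holomorphic_functions A W) \<and> (\<forall>p\<in>W. (\<Sum>i\<in>UNIV. f i p *s \<delta> i p) = 0)" and q: "q \<in> W"
    have qc: "q \<in> fst c" using q Wc by blast
    have "(\<Sum>i\<in>UNIV. f i q *s \<delta> i q) = 0" using f q by blast
    then have eq: "(\<chi> j. if j = i0 then f i0 q * \<zeta> i0 q else f i0 q * \<zeta> j q + f j q) = 0"
      using comb[OF qc, of "\<lambda>i. f i q"] c0[OF qc] by simp
    have "f i0 q * \<zeta> i0 q = 0" using arg_cong[OF eq, of "\<lambda>v. v $ i0"] by simp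
    then have fi0: "f i0 q = 0" using W\<zeta>[OF q] by simp
    show "f i q = 0"
      using arg_cong[OF eq, of "\<lambda>v. v $ i"] fi0 by (cases "i = i0") simp_all
  qed
  moreover have "p \<in> U" using p c i0 by (simp add: U_def)
  moreover have "\<delta> i0 = Z" by (simp add: \<delta>_def)
  ultimately show ?thesis using that UV by blast
qed

end

section \<open>Multiples of \<open>E\<close> in the ideal of the zero fibre\<close>

context F_mfd
begin

text \<open>For \<open>E = \<Sum>i. b i \<delta> i\<close> and
  \<open>Y = \<Sum>j. f j \<delta> j\<close>, the fibrewise linear function of
  \<open>E \<circ> Y\<close> minus the product of those of \<open>Y\<close> and \<open>E\<close> is
  the combination of the quadratic generators with coefficients \<open>- b i * f j\<close>, pulled
  back from the base; the generator for the unit gets coefficient 0. Thus the function of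
  \<open>X\<close> is a multiple of that of \<open>E\<close> modulo the ideal.\<close>

lemma E_times_subset_kernel:
  assumes E: "E \<in> vector_fields A (carr A)"
  shows "E_times_fields A m E U \<subseteq> kernel_aD A m e E U"
proof
  fix X assume X: "X \<in> E_times_fields A m E U"
  have "fibre_linear X \<in> zero_fibre_ideal A m e E w" if w: "w \<in> zero_fibre A m e E" "fst w \<in> U" for w
  proof -
    define p where "p = fst w"
    have lin: "Vector_Spaces.linear (*s) (*) (snd w)" and pA: "p \<in> carr A"
      using w(1) by (auto simp: zero_fibre_def analytic_spectrum_def p_def split_beta)
    obtain V Y where V: "V \<subseteq> U" "p \<in> V" and Y: "Y \<in> vector_fields A V"
      and XY: "\<And>q. q \<in> V \<Longrightarrow> X q = m q (E q) (Y q)"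
      using X w(2) unfolding E_times_fields_def field_mult_def p_def by blast
    have oV: "openin mtop V" by (rule vector_fields_openin[OF Y])
    have VA: "V \<subseteq> carr A" by (rule openin_subset_carr[OF oV])
    obtain U' \<delta> i0 where U': "p \<in> U'" "U' \<subseteq> V" "sheaf_basis A (vector_fields A) U' \<delta>" "\<delta> i0 = e"
      using frame_with_field[OF vector_fields_subset[OF unit_field oV VA] V(2) alg_unit_nonzero[OF alg[OF pA]]]
      by blast
    have oU': "openin mtop U'" and basis: "\<And>Z. Z \<in> vector_fields A U' \<Longrightarrow>
        \<exists>f. (\<forall>i. f i \<in> holomorphic_functions A U') \<and> (\<forall>q\<in>U'. Z q = (\<Sum>i\<in>UNIV. f i q *s \<delta> i q))"
      using U'(3) unfolding sheaf_basis_def by blast+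
    have EU: "E \<in> vector_fields A U'" by (rule vector_fields_subset[OF E oU' openin_subset_carr[OF oU']])
    have YU: "Y \<in> vector_fields A U'" by (rule vector_fields_subset[OF Y oU' U'(2)])
    obtain b where b: "\<And>i. b i \<in> holomorphic_functions A U'" "\<And>q. q \<in> U' \<Longrightarrow> E q = (\<Sum>i\<in>UNIV. b i q *s \<delta> i q)"
      using basis[OF EU] by blast
    obtain f where f: "\<And>i. f i \<in> holomorphic_functions A U'" "\<And>q. q \<in> U' \<Longrightarrow> Y q = (\<Sum>i\<in>UNIV. f i q *s \<delta> i q)"
      using basis[OF YU] by blast
    let ?W = "covectors U'"
    have wW: "w \<in> ?W" using U'(1) lin by (simp add: covectors_def p_def)
    define k where "k = (\<lambda>i j (w :: ('a, 'n) covector). - 1 * (b i (fst w) * f j (fst w)))"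
    define r where "r = (\<lambda>w :: ('a, 'n) covector. fibre_linear X w - fibre_linear Y w * fibre_linear E w)"
    have khol: "k i j \<in> holomorphic_functions (cotangent_atlas A) ?W" for i j
    proof -
      have "(\<lambda>q. - 1 * (b i q * f j q)) \<in> holomorphic_functions A U'"
        using b(1)[of i] f(1)[of j] unfolding holomorphic_functions_def
        by (auto intro!: mholomorphic_minus mholomorphic_mult)
      then show ?thesis unfolding k_def by (rule cotangent_hol_base)
    qed
    have "(\<lambda>q. 0) \<in> holomorphic_functions A U'"
      using oU' open_chart_image[OF oU'] by (simp add: holomorphic_functions_def mholomorphic_const)
    then have zero: "(\<lambda>w. 0) \<in> holomorphic_functions (cotangent_atlas A) ?W" by (rule cotangent_hol_base)
    have r: "r v = 0 * (fibre_linear (\<delta> i0) v - 1) +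
        (\<Sum>i\<in>UNIV. \<Sum>j\<in>UNIV. k i j v * (fibre_linear (\<delta> i) v * fibre_linear (\<delta> j) v
           - fibre_linear (field_mult m (\<delta> i) (\<delta> j)) v))" if v: "v \<in> ?W" for v
    proof -
      define q \<xi> where "q = fst v" and "\<xi> = snd v"
      have q: "q \<in> U'" and lin: "Vector_Spaces.linear (*s) (*) \<xi>" using v by (auto simp: covectors_def q_def \<xi>_def)
      have qV: "q \<in> V" and qA: "q \<in> carr A" using q U'(2) VA by auto
      note alg = alg[OF qA]
      have fl: "fibre_linear Z v = \<xi> (Z q)" for Z by (simp add: fibre_linear_def q_def \<xi>_def split_beta)
      have \<xi>sum: "\<xi> (\<Sum>i\<in>UNIV. a i *s g i) = (\<Sum>i\<in>(UNIV::'n set). a i * \<xi> (g i))" for a g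
      proof -
        have "\<xi> (\<Sum>i\<in>I. a i *s g i) = (\<Sum>i\<in>I. a i * \<xi> (g i))" if "finite I" for I :: "'n set"
          using that
        proof induction
          case empty
          have "\<xi> (0 *s 0) = 0 * \<xi> 0" using lin unfolding linear_form_iff by blast
          then show ?case by simp
        qed (use lin in \<open>simp add: linear_form_iff\<close>)
        then show ?thesis by simp
      qed
      have "X q = (\<Sum>i\<in>UNIV. b i q *s (\<Sum>j\<in>UNIV. f j q *s m q (\<delta> i q) (\<delta> j q)))"
        unfolding XY[OF qV] b(2)[OF q] f(2)[OF q] alg_sum_left[OF alg]
        by (simp only: alg_smult_left[OF alg] alg_sum_right[OF alg] alg_smult_right[OF alg]
            vec.scale_sum_right vector_smult_assoc mult.commute)
      then have 1: "fibre_linear X v = (\<Sum>i\<in>UNIV. \<Sum>j\<in>UNIV. b i q * (f j q * \<xi> (m q (\<delta> i q) (\<delta> j q))))"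
        by (simp add: fl \<xi>sum sum_distrib_left)
      have 2: "fibre_linear Y v * fibre_linear E v
          = (\<Sum>i\<in>UNIV. \<Sum>j\<in>UNIV. b i q * (f j q * (\<xi> (\<delta> i q) * \<xi> (\<delta> j q))))"
        unfolding fl b(2)[OF q] f(2)[OF q] \<xi>sum mult.commute[of "\<Sum>i\<in>UNIV. f i q * \<xi> (\<delta> i q)"]
        by (simp add: sum_product mult_ac)
      show ?thesis
        unfolding r_def 1 2 sum_subtractf[symmetric]
        by (simp add: k_def fl field_mult_def q_def[symmetric])
          (intro sum.cong refl, simp add: algebra_simps)
    qed
    have "r \<in> spectrum_ideal A m e w"
      unfolding spectrum_ideal_def mem_Collect_eq
    proof (intro exI conjI)
      show "sheaf_basis A (vector_fields A) U' \<delta>" "\<delta> i0 = e" "w \<in> ?W" by (fact U'(3), fact U'(4), fact wW)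
      show "fst ` ?W \<subseteq> U'" by (auto simp: covectors_def)
      show "(\<lambda>w. 0) \<in> holomorphic_functions (cotangent_atlas A) ?W" by (rule zero)
      show "\<forall>i j. k i j \<in> holomorphic_functions (cotangent_atlas A) ?W" using khol by blast
      show "\<forall>v\<in>?W. r v = 0 * (fibre_linear (\<delta> i0) v - 1) +
        (\<Sum>i\<in>UNIV. \<Sum>j\<in>UNIV. k i j v * (fibre_linear (\<delta> i) v * fibre_linear (\<delta> j) v
           - fibre_linear (field_mult m (\<delta> i) (\<delta> j)) v))" using r by blast
    qed
    moreover have "fibre_linear Y \<in> holomorphic_functions (cotangent_atlas A) ?W" by (rule cotangent_hol_fibre[OF YU])
    moreover have "\<forall>v\<in>?W. fibre_linear X v = fibre_linear Y v * fibre_linear E v + r v" by (simp add: r_def)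
    ultimately show ?thesis unfolding zero_fibre_ideal_def mem_Collect_eq using wW by blast
  qed
  then show "X \<in> kernel_aD A m e E U" using X by (simp add: kernel_aD_def E_times_fields_def)
qed

end

theorem theorem13p1:
  fixes A :: "('a, 'n::finite) chart set"
    and m :: "'a \<Rightarrow> complex^'n \<Rightarrow> complex^'n \<Rightarrow> complex^'n"
    and e E :: "'a \<Rightarrow> complex^'n"
  assumes "F_manifold A m e"
    and "massive A m"
    and "euler_field_weight1 A m E"
  shows "discriminant A m E = fst ` zero_fibre A m e E \<and>
    (free_divisor A (discriminant A m E) \<and>
      (\<forall>U. openin (atlas_topology A) U \<longrightarrow>
         log_vector_fields A (discriminant A m E) U = E_times_fields A m E U)) \<and>
    (\<forall>U. openin (atlas_topology A) U \<longrightarrow>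
       kernel_aD A m e E U = E_times_fields A m E U \<and>
       E_times_fields A m E U = log_vector_fields A (discriminant A m E) U)"
proof -
  interpret F_mfd A m e by (rule F_mfd.intro[OF assms(1)])
  note massive_euler = assms(2,3)
  have log: "log_vector_fields A (discriminant A m E) U = E_times_fields A m E U" for U
    by (intro equalityI log_subset_E_times[OF massive_euler] E_times_subset_log[OF massive_euler])
  have ker: "kernel_aD A m e E U = E_times_fields A m E U" for U
    by (intro equalityI kernel_subset_E_times[OF massive_euler]
        E_times_subset_kernel[OF E_field[OF massive_euler]])
  show ?thesis
    using log ker discriminant_zero_fibre[OF massive_euler] discriminant_free_divisor[OF massive_euler] by blast
qed

end
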